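(* Let $q$ be a prime, $a,h\in\mathbb{F}_q^{\times}$, let $M,N\leqslant q/2$ be positive integers and let $\bm{\alpha}=(\alpha_m)_{m\sim M}$, $\bm{\beta}=(\beta_n)_{n\sim N}$ be arbitrary complex weights. Then $$|W_{a,q}(\bm{\alpha},\bm{\beta};h,M,N)|\leqslant \|\bm{\alpha}\|_2\|\bm{\beta}\|_\infty^{1/3}\|\bm{\beta}\|_1^{2/3}\,q^{1/8+o(1)}M^{7/24}N^{1/8}\left(\frac{M^{7/48}}{q^{1/16}}+1\right)\left(\frac{N^{7/48}}{q^{1/16}}+1\right)$$ and $$|W_{a,q}(\bm{\alpha},\bm{\beta};h,M,N)|\leqslant \|\bm{\alpha}\|_2\|\bm{\beta}\|_1^{3/4}\|\bm{\beta}\|_\infty^{1/4}\,q^{1/8+o(1)}M^{5/16}N^{1/16}\left(\frac{M^{3/16}}{q^{1/8}}+1\right)\left(\frac{N^{3/16}}{q^{1/8}}+1\right),$$ where $o(1)$ denotes a quantity tending to $0$ as $q\to\infty$, uniformly in the other parameters.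
   Context: $a\sim A$ means $A\leqslant a<2A$. $\mathbf{e}_q(\xi)=\exp(2\pi i\xi/q)$; $\mathbb{F}_q$ is identified with $\{0,\dots,q-1\}$. For weights $\bm{\alpha}=(\alpha_m)_{m\sim M}$: $\|\bm{\alpha}\|_\infty=\max_{m\sim M}|\alpha_m|$ and $\|\bm{\alpha}\|_\sigma=(\sum_{m\sim M}|\alpha_m|^\sigma)^{1/\sigma}$, similarly for $\bm{\beta}$. The bilinear form is $$W_{a,q}(\bm{\alpha},\bm{\beta};h,M,N)=\sum_{m\sim M}\sum_{n\sim N}\alpha_m\beta_n\sum_{\substack{x\in\mathbb{F}_q\\ x^2=amn}}\mathbf{e}_q(hx).$$ *)

theory Defs
  imports "HOL-Analysis.Analysis" "HOL-Number_Theory.Number_Theory"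
begin

definition eq :: "nat \<Rightarrow> int \<Rightarrow> complex" where
  "eq q \<xi> = exp (2 * pi * \<i> * of_int \<xi> / of_nat q)"

definition dyad :: "nat \<Rightarrow> nat set" where
  "dyad M = {M..<2*M}"

definition wnorm_inf :: "(nat \<Rightarrow> complex) \<Rightarrow> nat \<Rightarrow> real" where
  "wnorm_inf w M = Max ((\<lambda>m. cmod (w m)) ` dyad M)"

definition wnorm :: "real \<Rightarrow> (nat \<Rightarrow> complex) \<Rightarrow> nat \<Rightarrow> real" where
  "wnorm \<sigma> w M = (\<Sum>m\<in>dyad M. cmod (w m) powr \<sigma>) powr (1 / \<sigma>)"

text \<open>The bilinear form W_{a,q}; F_q is identified with {0,...,q-1}.\<close>
definition W :: "nat \<Rightarrow> nat \<Rightarrow> (nat \<Rightarrow> complex) \<Rightarrow> (nat \<Rightarrow> complex) \<Rightarrow> nat \<Rightarrow> nat \<Rightarrow> nat \<Rightarrow> complex" where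
  "W a q \<alpha> \<beta> h M N =
     (\<Sum>m\<in>dyad M. \<Sum>n\<in>dyad N. \<alpha> m * \<beta> n *
        (\<Sum>x\<in>{x. x < q \<and> [x^2 = a*m*n] (mod q)}. eq q (int h * int x)))"

end

theory Submission
  imports Defs "HOL-Real_Asymp.Real_Asymp"
begin

text \<open>
  Write a root of \<open>x\<^sup>2 = a m n\<close> as \<open>x = u v\<close> with \<open>j u\<^sup>2 = a m\<close> and \<open>v\<^sup>2 = j n\<close>, and average over the
  units \<open>j\<close>. Three applications of Cauchy--Schwarz and Parseval bound the eighth power of each resulting
  bilinear form in \<open>e(h u v)\<close> by \<open>q\<close> times the weighted additive energies of the sets of \<open>u\<close> and of \<open>v\<close>.

  Let \<open>r(l)\<close> count the pairs with \<open>v - w = l\<close>, where \<open>v\<^sup>2 = c m\<close>, \<open>w\<^sup>2 = c n\<close> and \<open>m, n \<sim> N\<close>. For \<open>l \<noteq> 0\<close> the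
  pair is determined by \<open>d = m - n\<close>, and \<open>s = m + n\<close> satisfies \<open>c\<^sup>2 d\<^sup>2 + l\<^sup>4 = 2 c l\<^sup>2 s\<close> modulo \<open>q\<close>. So \<open>r(l)\<close>
  counts points of a parabola in a box. A Fejer kernel and Weyl differencing give
  \<open>r(l) \<le> N\<^sup>2 / q + N\<^bsup>1/2\<^esup>\<close> up to \<open>q\<^bsup>o(1)\<^esup>\<close>, hence the second bound.

  For the first bound, differences of two points of the parabola are points \<open>(X, Y)\<close>
  of the lattice \<open>c X = 2 l\<^sup>2 Y\<close> with \<open>|X| \<le> 2 N\<^sup>2\<close>, \<open>|Y| \<le> 2 N\<close>, and by the divisor bound each is hit \<open>q\<^bsup>o(1)\<^esup>\<close>
  times. So \<open>r(l)\<^sup>2\<close> is at most \<open>N\<^sup>3 / q\<close> plus the number of multiples of a shortest lattice vector in the box.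
  That vector determines \<open>l\<^sup>2\<close>, so summing over all vectors gives
  \<open>\<Sum> r(l)\<^sup>4 \<le> N\<^sup>3 + N\<^sup>2 (N\<^sup>3 / q)\<^bsup>3/2\<^esup>\<close>, and interpolation with \<open>\<Sum> r(l)\<close> yields the energy.
\<close>

section \<open>The divisor function\<close>


text \<open>If neither \<open>a m\<close> nor \<open>n\<close> is a square, their product may still
  be one; the unit \<open>j\<close> repairs the factorisation in that case. Every pair of a root
  \<open>x\<close> and a unit \<open>v\<close> arises exactly once, so the average is an identity
  and nothing is lost there. The first Cauchy-Schwarz removes \<open>\<alpha>\<close> entirely.
  Hence \<open>\<alpha>\<close> enters only through its 2-norm, the energy on the \<open>m\<close>
  side is unweighted while that on the \<open>n\<close> side keeps \<open>\<beta>\<close>, and the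
  powers of \<open>M\<close> and \<open>N\<close> differ. In the lattice argument no good pointwise
  bound is available, because single \<open>l\<close> may have very short vectors. Squared counts
  are at most a constant times \<open>N^3 / (|X| |Y|)\<close>, whose sum over the whole box is
  logarithmic: this is why the fourth moment of \<open>r\<close> appears. All losses are numerical
  constants times the maximal divisor count and a harmonic sum up to \<open>q^2\<close>, so one
  explicit exponent depending on \<open>q\<close> alone serves as o(1). The argument inverts 2
  modulo \<open>q\<close>; for \<open>q = 2\<close> only \<open>M = N = 1\<close> remains and is
  checked by hand.\<close>

definition ndiv :: "nat \<Rightarrow> nat" where
  "ndiv n = card {d. d dvd n}"

lemma ndiv_prime_power_mult_le:
  fixes p :: nat
  assumes "prime p" and "m > 0"
  shows "ndiv (p ^ k * m) \<le> (k + 1) * ndiv m"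
proof -
  have "{d. d dvd p ^ k * m} \<subseteq> (\<lambda>(i, d). p ^ i * d) ` ({..k} \<times> {d. d dvd m})"
  proof
    fix d assume "d \<in> {d. d dvd p ^ k * m}"
    then obtain x y where "d = x * y" "x dvd p ^ k" "y dvd m"
      using division_decomp by blast
    moreover obtain i where "i \<le> k" "x = p ^ i"
      using \<open>x dvd p ^ k\<close> assms(1) divides_primepow_nat by blast
    ultimately show "d \<in> (\<lambda>(i, d). p ^ i * d) ` ({..k} \<times> {d. d dvd m})"
      by force
  qed
  moreover have fin: "finite ({..k} \<times> {d. d dvd m})"
    using assms(2) by (intro finite_cartesian_product) auto
  ultimately have "ndiv (p ^ k * m) \<le> card ({..k} \<times> {d. d dvd m})"
    unfolding ndiv_def by (meson card_mono card_image_le finite_imageI order_trans)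
  then show ?thesis by (simp add: card_cartesian_product ndiv_def)
qed

text \<open>With \<open>t = \<epsilon> ln 2\<close>, \<open>e^x >= 1 + x\<close> gives
  \<open>2^(k \<epsilon>) >= 1 + k t\<close>, and the factor \<open>1 + 1/t\<close> lifts
  \<open>1 + k t\<close> above \<open>1 + k\<close>. This is the price of one small prime in the
  divisor bound.\<close>

lemma Suc_le_const_mult_powr:
  fixes \<epsilon> :: real
  assumes "\<epsilon> > 0"
  shows "real k + 1 \<le> (1 + 1 / (\<epsilon> * ln 2)) * 2 powr (real k * \<epsilon>)"
proof -
  define t where "t = \<epsilon> * ln 2"
  have t: "t > 0" using assms by (simp add: t_def)
  have "1 + real k * t \<le> 2 powr (real k * \<epsilon>)"
    using exp_ge_add_one_self[of "real k * t"] by (simp add: powr_def t_def mult_ac)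
  then have "(1 + 1 / t) * (1 + real k * t) \<le> (1 + 1 / t) * 2 powr (real k * \<epsilon>)"
    using t by (intro mult_left_mono) (auto simp: add_nonneg_nonneg)
  moreover have "(1 + 1 / t) * (1 + real k * t) = 1 + real k + real k * t + 1 / t"
    using t by (simp add: field_simps)
  moreover have "real k * t + 1 / t \<ge> 0" using t by simp
  ultimately show ?thesis unfolding t_def[symmetric] by linarith
qed

text \<open>Prime powers are stripped off one at a time. A prime with
  \<open>p^\<epsilon> >= 2\<close> costs nothing, because
  \<open>k + 1 <= 2^k <= p^(k \<epsilon>)\<close>; each smaller prime costs one constant
  factor.\<close>

lemma ndiv_le_small_primes:
  fixes \<epsilon> :: real
  assumes \<epsilon>: "\<epsilon> > 0" and "n > 0"
  shows "real (ndiv n) \<le> (1 + 1 / (\<epsilon> * ln 2)) ^ card {p. prime p \<and> p dvd n \<and> real p powr \<epsilon> < 2}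
           * real n powr \<epsilon>"
  using \<open>n > 0\<close>
proof (induction n rule: less_induct)
  case (less n)
  define C where "C = 1 + 1 / (\<epsilon> * ln 2)"
  define S where "S n = {p. prime p \<and> p dvd n \<and> real p powr \<epsilon> < 2}" for n :: nat
  have C: "C \<ge> 1" using \<epsilon> by (simp add: C_def)
  show ?case
  proof (cases "n = 1")
    case True
    have "{d :: nat. d dvd 1} = {1}" by auto
    moreover have "C ^ card {p. prime p \<and> p dvd n \<and> real p powr \<epsilon> < 2} \<ge> 1"
      using C by (rule one_le_power)
    ultimately show ?thesis using True by (simp add: ndiv_def C_def)
  next
    case False
    then obtain p where p: "prime p" "p dvd n"
      using prime_factor_nat by blast
    define k where "k = multiplicity p n"
    have k: "k > 0" using p less.prems
      by (simp add: k_def prime_multiplicity_gt_zero_iff)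
    obtain m where m: "n = p ^ k * m" "\<not> p dvd m"
      using multiplicity_decompose'[of n p] less.prems p(1) unfolding k_def
      by (metis not_prime_unit not_less0)
    have m0: "m > 0" using m less.prems by (auto intro: Nat.gr0I)
    have p1: "p ^ k > 1" using prime_gt_1_nat[OF p(1)] k by (intro one_less_power) auto
    have "m < n" using m(1) p1 m0 by simp
    have IH: "real (ndiv m) \<le> C ^ card (S m) * real m powr \<epsilon>"
      using less.IH[OF \<open>m < n\<close> m0] unfolding C_def S_def .
    have n_powr: "real n powr \<epsilon> = (real p powr \<epsilon>) ^ k * real m powr \<epsilon>"
    proof -
      have "real n powr \<epsilon> = (real p ^ k * real m) powr \<epsilon>"
        by (subst m(1)) simp
      also have "\<dots> = (real p powr real k) powr \<epsilon> * real m powr \<epsilon>"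
        using prime_gt_0_nat[OF p(1)] by (simp add: powr_mult powr_realpow)
      also have "(real p powr real k) powr \<epsilon> = (real p powr \<epsilon>) ^ k"
        using prime_gt_0_nat[OF p(1)] by (simp add: powr_powr powr_power mult.commute)
      finally show ?thesis .
    qed
    have finS: "finite (S n)"
      unfolding S_def using less.prems by (auto intro: finite_subset[of _ "{d. d dvd n}"])
    have nd: "real (ndiv n) \<le> (real k + 1) * real (ndiv m)"
    proof -
      have "ndiv n \<le> (k + 1) * ndiv m"
        using ndiv_prime_power_mult_le[OF p(1) m0, of k] m(1) by simp
      then have "real (ndiv n) \<le> real ((k + 1) * ndiv m)" by (rule of_nat_mono)
      then show ?thesis by (simp add: algebra_simps)
    qed
    have Sm: "S m \<subseteq> S n" using m(1) by (auto simp: S_def)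
    have "real (ndiv n) \<le> C ^ card (S n) * real n powr \<epsilon>"
    proof (cases "real p powr \<epsilon> < 2")
      case True
      have "insert p (S m) \<subseteq> S n" using Sm True p by (auto simp: S_def)
      moreover have "p \<notin> S m" using m(2) by (auto simp: S_def)
      ultimately have card: "Suc (card (S m)) \<le> card (S n)"
        using card_mono[OF finS, of "insert p (S m)"] finite_subset[OF Sm finS] by simp
      have "real k + 1 \<le> C * 2 powr (real k * \<epsilon>)"
        unfolding C_def by (rule Suc_le_const_mult_powr[OF \<epsilon>])
      also have "\<dots> \<le> C * (real p powr \<epsilon>) ^ k"
      proof -
        have "2 powr (real k * \<epsilon>) \<le> real p powr (real k * \<epsilon>)"
          using prime_ge_2_nat[OF p(1)] \<epsilon> by (intro powr_mono2) auto
        then show ?thesis using C prime_gt_0_nat[OF p(1)] by (simp add: powr_power mult.commute)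
      qed
      finally have "(real k + 1) * real (ndiv m) \<le>
          (C * (real p powr \<epsilon>) ^ k) * (C ^ card (S m) * real m powr \<epsilon>)"
        using IH C by (intro mult_mono) auto
      also have "\<dots> = C ^ Suc (card (S m)) * real n powr \<epsilon>"
        by (simp add: n_powr)
      also have "\<dots> \<le> C ^ card (S n) * real n powr \<epsilon>"
        using card C by (intro mult_right_mono power_increasing) auto
      finally show ?thesis using nd by linarith
    next
      case False
      have "real k + 1 \<le> 2 ^ k"
        by (induction k) auto
      also have "\<dots> \<le> (real p powr \<epsilon>) ^ k" using False by (intro power_mono) auto
      finally have "(real k + 1) * real (ndiv m) \<le>
          (real p powr \<epsilon>) ^ k * (C ^ card (S m) * real m powr \<epsilon>)"
        using IH C by (intro mult_mono) auto
      also have "\<dots> = C ^ card (S m) * real n powr \<epsilon>"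
        by (simp add: n_powr)
      also have "\<dots> \<le> C ^ card (S n) * real n powr \<epsilon>"
        using card_mono[OF finS Sm] C by (intro mult_right_mono power_increasing) auto
      finally show ?thesis using nd by linarith
    qed
    then show ?thesis unfolding C_def S_def .
  qed
qed

text \<open>The primes that cost a factor lie below \<open>2^(1/\<epsilon>)\<close>, so their number
  is bounded independently of \<open>n\<close>.\<close>

lemma ndiv_bound:
  fixes \<epsilon> :: real
  assumes \<epsilon>: "\<epsilon> > 0"
  obtains C where "C \<ge> 1" and "\<And>n. n > 0 \<Longrightarrow> real (ndiv n) \<le> C * real n powr \<epsilon>"
proof -
  define c where "c = 1 + 1 / (\<epsilon> * ln 2)"
  define B where "B = nat \<lceil>2 powr (1 / \<epsilon>)\<rceil>"
  have c: "c \<ge> 1" using \<epsilon> by (simp add: c_def)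
  have "real (ndiv n) \<le> c ^ Suc B * real n powr \<epsilon>" if "n > 0" for n
  proof -
    have "{p. prime p \<and> p dvd n \<and> real p powr \<epsilon> < 2} \<subseteq> {..B}"
    proof
      fix p assume "p \<in> {p. prime p \<and> p dvd n \<and> real p powr \<epsilon> < 2}"
      then have p: "prime p" "real p powr \<epsilon> < 2" by auto
      have "real p = (real p powr \<epsilon>) powr (1 / \<epsilon>)"
        using \<epsilon> by (simp add: powr_powr)
      also have "\<dots> \<le> 2 powr (1 / \<epsilon>)" using p \<epsilon> by (intro powr_mono2) auto
      finally show "p \<in> {..B}" unfolding B_def atMost_iff by linarith
    qed
    then have "card {p. prime p \<and> p dvd n \<and> real p powr \<epsilon> < 2} \<le> Suc B"
      using card_mono[of "{..B}"] by fastforce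
    then have "c ^ card {p. prime p \<and> p dvd n \<and> real p powr \<epsilon> < 2} * real n powr \<epsilon>
        \<le> c ^ Suc B * real n powr \<epsilon>"
      using c by (intro mult_right_mono power_increasing) auto
    then show ?thesis
      using ndiv_le_small_primes[OF \<epsilon> that] unfolding c_def by linarith
  qed
  moreover have "c ^ Suc B \<ge> 1" using c by (rule one_le_power)
  ultimately show thesis using that by blast
qed

section \<open>Maximal divisor count and harmonic sum up to q^2\<close>

text \<open>A maximum instead of a bound \<open>C q^\<epsilon>\<close>: one function of
  \<open>q\<close> then serves all \<open>\<epsilon>\<close> at once. The range reaches
  \<open>q^2\<close> because it is applied to differences of squares of size up to
  \<open>N^2\<close>.\<close>

definition divmax :: "nat \<Rightarrow> real" where
  "divmax q = real (Max (ndiv ` {1..q\<^sup>2}))"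

text \<open>The range covers the first coordinates of lattice points, which go up to
  \<open>2 N^2\<close>.\<close>

definition logsum :: "nat \<Rightarrow> real" where
  "logsum q = (\<Sum>k = 1..q\<^sup>2. 1 / real k)"

lemma ndiv_le_divmax:
  assumes "0 < n" "n \<le> q\<^sup>2"
  shows "real (ndiv n) \<le> divmax q"
  unfolding divmax_def using assms by (intro of_nat_mono Max_ge) auto

lemma divmax_ge_1: "q > 0 \<Longrightarrow> divmax q \<ge> 1"
  using ndiv_le_divmax[of 1 q] by (simp add: ndiv_def)

lemma logsum_ge_1: "q > 0 \<Longrightarrow> logsum q \<ge> 1"
  unfolding logsum_def using sum_mono2[of "{1..q\<^sup>2}" "{1}" "\<lambda>k. 1 / real k"] by simp

lemma sum_inverse_le_logsum:
  assumes "n \<le> q\<^sup>2"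
  shows "(\<Sum>k = 1..n. 1 / real k) \<le> logsum q"
  unfolding logsum_def using assms by (intro sum_mono2) auto

lemma sum_inverse_le_ln: "n > 0 \<Longrightarrow> (\<Sum>k = 1..n. 1 / real k) \<le> 1 + ln (real n)"
proof (induction n rule: nat_induct_non_zero)
  case (Suc n)
  have "ln (real n / real (Suc n)) \<le> real n / real (Suc n) - 1"
    using Suc.hyps by (intro ln_le_minus_one) auto
  also have "\<dots> = - (1 / real (Suc n))" by (simp add: field_simps)
  finally have "1 / real (Suc n) \<le> ln (real (Suc n)) - ln (real n)"
    using Suc.hyps by (simp add: ln_div)
  then show ?case using Suc.IH by simp
qed simp

lemma ln_divmax_tendsto: "(\<lambda>q. ln (divmax q) / ln (real q)) \<longlonglongrightarrow> 0"
proof (rule LIMSEQ_I)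
  fix r :: real assume r: "r > 0"
  obtain C where C: "C \<ge> 1" "\<And>n. n > 0 \<Longrightarrow> real (ndiv n) \<le> C * real n powr (r / 4)"
    using ndiv_bound[of "r / 4"] r by auto
  \<comment> \<open>Beyond this threshold \<open>ln C < (r / 4) ln q\<close>; together with
    \<open>(q^2)^(r / 4) = q^(r / 2)\<close> the exponent stays below \<open>r\<close>.\<close>
  obtain n1 where n1: "real n1 > exp (4 * ln C / r)"
    using reals_Archimedean2 by blast
  define n0 where "n0 = max n1 2"
  have n0: "real n0 > exp (4 * ln C / r)" "n0 \<ge> 2"
    using n1 by (auto simp: n0_def)
  have "norm (ln (divmax q) / ln (real q) - 0) < r" if q: "q \<ge> n0" for q
  proof -
    have q2: "q \<ge> 2" using q n0 by linarith
    then have lq: "ln (real q) > 0" by simp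
    have "Max (ndiv ` {1..q\<^sup>2}) \<in> ndiv ` {1..q\<^sup>2}"
      using q2 by (intro Max_in) (auto simp: Suc_le_eq)
    then obtain n where n: "n \<in> {1..q\<^sup>2}" "divmax q = real (ndiv n)"
      unfolding divmax_def by auto
    have "divmax q \<le> C * real n powr (r / 4)" using C n by auto
    also have "\<dots> \<le> C * real (q\<^sup>2) powr (r / 4)"
      using C(1) n(1) r by (intro mult_left_mono powr_mono2) (auto simp del: of_nat_power)
    finally have "ln (divmax q) \<le> ln (C * real (q\<^sup>2) powr (r / 4))"
      using divmax_ge_1[of q] q2 C(1) by (subst ln_le_cancel_iff) (auto intro!: mult_pos_pos)
    also have "\<dots> = ln C + r / 2 * ln (real q)"
      using q2 C(1) by (simp add: ln_mult ln_powr ln_realpow)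
    also have "ln C < r / 4 * ln (real q)"
    proof -
      have "exp (4 * ln C / r) < real q" using n0 q by linarith
      then have "4 * ln C / r < ln (real q)"
        using q2 ln_less_cancel_iff[of "exp (4 * ln C / r)" "real q"] by simp
      then show ?thesis using r by (simp add: field_simps)
    qed
    finally have "ln (divmax q) < r * ln (real q)" using mult_pos_pos[OF r lq] by (simp add: algebra_simps)
    then show ?thesis using lq divmax_ge_1[of q] q2 by (simp add: divide_less_eq)
  qed
  then show "\<exists>no. \<forall>n\<ge>no. norm (ln (divmax n) / ln (real n) - 0) < r" by blast
qed

lemma ln_logsum_tendsto: "(\<lambda>q. ln (logsum q) / ln (real q)) \<longlonglongrightarrow> 0"
proof (rule tendsto_sandwich)
  show "\<forall>\<^sub>F q in sequentially. 0 \<le> ln (logsum q) / ln (real q)"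
    using eventually_gt_at_top[of 0] by eventually_elim (auto intro!: divide_nonneg_nonneg simp: logsum_ge_1)
  show "\<forall>\<^sub>F q in sequentially. ln (logsum q) / ln (real q) \<le> ln (1 + 2 * ln (real q)) / ln (real q)"
    using eventually_gt_at_top[of 1]
  proof eventually_elim
    case (elim q)
    have "logsum q \<le> 1 + ln (real (q\<^sup>2))"
      unfolding logsum_def using elim by (intro sum_inverse_le_ln) auto
    also have "\<dots> = 1 + 2 * ln (real q)" using elim by (simp add: ln_realpow)
    finally show ?case using logsum_ge_1[of q] elim by (intro divide_right_mono) auto
  qed
  show "(\<lambda>q. ln (1 + 2 * ln (real q)) / ln (real q)) \<longlonglongrightarrow> 0" by real_asymp
qed simp

section \<open>Additive characters and correlations\<close>


lemma eq_eq_cis: "eq q x = cis (2 * pi * of_int x / of_nat q)"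
  by (simp add: eq_def cis_conv_exp mult_ac)

lemma eq_add: "eq q (x + y) = eq q x * eq q y"
  by (simp add: eq_eq_cis cis_mult add_divide_distrib distrib_left)

lemma eq_0 [simp]: "eq q 0 = 1"
  by (simp add: eq_eq_cis)

lemma norm_eq [simp]: "cmod (eq q x) = 1"
  by (simp add: eq_eq_cis)

lemma cnj_eq: "cnj (eq q x) = eq q (- x)"
  by (simp add: eq_eq_cis cis_cnj)

lemma eq_power: "eq q x ^ n = eq q (int n * x)"
  by (simp add: eq_eq_cis Complex.DeMoivre mult_ac)

lemma eq_eq_1_iff:
  assumes "q > 0"
  shows "eq q x = 1 \<longleftrightarrow> int q dvd x"
proof -
  have "eq q x = 1 \<longleftrightarrow> (\<exists>n :: int. 2 * pi * of_int x / of_nat q = of_int (2 * n) * pi)"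
    by (simp add: eq_def exp_eq_1)
  also have "\<dots> \<longleftrightarrow> (\<exists>n :: int. real_of_int x = of_int (int q * n))"
    using assms by (intro ex_cong1) (auto simp: field_simps)
  also have "\<dots> \<longleftrightarrow> int q dvd x"
    by (simp only: of_int_eq_iff dvd_def)
  finally show ?thesis .
qed

lemma eq_cong:
  assumes "[x = y] (mod int q)"
  shows "eq q x = eq q y"
proof (cases "q = 0")
  case False
  have "eq q (x - y) = 1"
    using assms False by (subst eq_eq_1_iff) (auto simp: cong_iff_dvd_diff)
  then show ?thesis using eq_add[of q "x - y" y] by simp
qed (use assms in \<open>simp add: cong_0_iff cong_def\<close>)

lemma sum_eq_interval:
  fixes t :: int
  shows "(\<Sum>d\<in>{a..<b}. eq q (d * t)) = eq q (a * t) * (\<Sum>n<nat (b - a). eq q t ^ n)"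
proof -
  have "(\<Sum>n<nat (b - a). eq q ((a + int n) * t)) = (\<Sum>d\<in>{a..<b}. eq q (d * t))"
    by (rule sum.reindex_bij_witness[of _ "\<lambda>d. nat (d - a)" "\<lambda>n. a + int n"]) auto
  then show ?thesis
    by (simp add: distrib_right eq_add eq_power sum_distrib_left)
qed

lemma norm_sum_eq_interval_le:
  fixes t :: int
  assumes "eq q t \<noteq> 1"
  shows "cmod (\<Sum>d\<in>{a..<b}. eq q (d * t)) \<le> 2 / cmod (1 - eq q t)"
proof -
  have "cmod (\<Sum>d\<in>{a..<b}. eq q (d * t)) = cmod (1 - eq q t ^ nat (b - a)) / cmod (1 - eq q t)"
    using assms by (simp add: sum_eq_interval norm_mult norm_divide sum_gp_strict)
  also have "cmod (1 - eq q t ^ nat (b - a)) \<le> 2"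
    using norm_triangle_ineq4[of 1 "eq q t ^ nat (b - a)"] by (simp add: norm_power)
  finally show ?thesis by (simp add: divide_right_mono)
qed

lemma sum_eq_residues:
  assumes "q > 0"
  shows "(\<Sum>x\<in>{0..<int q}. eq q (x * t)) = (if int q dvd t then of_nat q else 0)"
proof (cases "int q dvd t")
  case True
  then have "eq q t = 1" using eq_eq_1_iff[OF assms] by blast
  then show ?thesis using True by (simp add: sum_eq_interval)
next
  case False
  then have "eq q t \<noteq> 1" using eq_eq_1_iff[OF assms] by blast
  moreover have "eq q t ^ q = 1" using eq_eq_1_iff[OF assms] by (simp add: eq_power)
  ultimately show ?thesis using False by (simp add: sum_eq_interval sum_gp_strict)
qed

lemma residues_eqI:
  fixes x y :: int
  assumes "[x = y] (mod int q)" "x \<in> {0..<int q}" "y \<in> {0..<int q}"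
  shows "x = y"
  using assms by (simp add: cong_def)

lemma parseval_residues:
  fixes f :: "int \<Rightarrow> complex"
  assumes q: "q > 0" and h: "coprime h (int q)"
  shows "(\<Sum>x\<in>{0..<int q}. (cmod (\<Sum>l\<in>{0..<int q}. f l * eq q (h * x * l)))\<^sup>2)
       = real q * (\<Sum>l\<in>{0..<int q}. (cmod (f l))\<^sup>2)"
proof -
  let ?R = "{0..<int q}"
  have "complex_of_real (\<Sum>x\<in>?R. (cmod (\<Sum>l\<in>?R. f l * eq q (h * x * l)))\<^sup>2)
      = (\<Sum>x\<in>?R. (\<Sum>l\<in>?R. f l * eq q (h * x * l)) * cnj (\<Sum>l\<in>?R. f l * eq q (h * x * l)))"
    by (simp only: of_real_sum complex_norm_square)
  also have "\<dots> = (\<Sum>x\<in>?R. \<Sum>l\<in>?R. \<Sum>m\<in>?R. f l * cnj (f m) * eq q (x * (h * (l - m))))"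
    unfolding cnj_sum sum_product
    by (intro sum.cong refl) (simp add: cnj_eq algebra_simps eq_add flip: eq_add)
  also have "\<dots> = (\<Sum>l\<in>?R. \<Sum>m\<in>?R. \<Sum>x\<in>?R. f l * cnj (f m) * eq q (x * (h * (l - m))))"
    by (rule trans[OF sum.swap], rule sum.cong[OF refl], rule sum.swap)
  also have "\<dots> = (\<Sum>l\<in>?R. \<Sum>m\<in>?R. f l * cnj (f m) * (if l = m then of_nat q else 0))"
  proof (intro sum.cong refl)
    fix l m assume lm: "l \<in> ?R" "m \<in> ?R"
    have "int q dvd h * (l - m) \<longleftrightarrow> int q dvd l - m"
      using h by (simp add: coprime_dvd_mult_right_iff coprime_commute)
    also have "\<dots> \<longleftrightarrow> l = m" using lm residues_eqI[of l m q]
      by (auto simp: cong_iff_dvd_diff)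
    finally show "(\<Sum>x\<in>?R. f l * cnj (f m) * eq q (x * (h * (l - m))))
        = f l * cnj (f m) * (if l = m then of_nat q else 0)"
      by (simp add: sum_eq_residues[OF q] flip: sum_distrib_left)
  qed
  also have "\<dots> = (\<Sum>l\<in>?R. f l * cnj (f l) * of_nat q)"
    by (intro sum.cong refl) (simp add: if_distrib cong: if_cong)
  also have "\<dots> = complex_of_real (real q * (\<Sum>l\<in>?R. (cmod (f l))\<^sup>2))"
    unfolding of_real_mult of_real_sum complex_norm_square by (simp add: sum_distrib_left mult_ac)
  finally show ?thesis using of_real_eq_iff by blast
qed

section \<open>Difference correlations and the eighth power of a bilinear form\<close>

text \<open>For \<open>b = 1\<close> this is the count \<open>r(l)\<close>. The sum of its squares
  over a full residue system is the weighted additive energy of \<open>V\<close> modulo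
  \<open>q\<close>.\<close>

definition corr :: "nat \<Rightarrow> int set \<Rightarrow> (int \<Rightarrow> real) \<Rightarrow> int \<Rightarrow> real" where
  "corr q V b l = (\<Sum>(v, w)\<in>{(v, w) \<in> V \<times> V. (v - w) mod int q = l}. b v * b w)"

lemma sum_pairs_by_difference:
  fixes g :: "int \<Rightarrow> int \<Rightarrow> 'a :: comm_monoid_add"
  assumes "q > 0" and "finite V"
  shows "(\<Sum>l\<in>{0..<int q}. \<Sum>(v, w)\<in>{(v, w) \<in> V \<times> V. (v - w) mod int q = l}. g v w)
       = (\<Sum>v\<in>V. \<Sum>w\<in>V. g v w)"
proof -
  have "(\<Sum>v\<in>V. \<Sum>w\<in>V. g v w) = (\<Sum>(v, w)\<in>V \<times> V. g v w)"
    by (simp add: sum.cartesian_product)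
  also have "\<dots> = (\<Sum>l\<in>{0..<int q}. \<Sum>(v, w)\<in>{p \<in> V \<times> V. (fst p - snd p) mod int q = l}. g v w)"
    using assms by (intro sum.group[symmetric]) auto
  also have "\<dots> = (\<Sum>l\<in>{0..<int q}. \<Sum>(v, w)\<in>{(v, w) \<in> V \<times> V. (v - w) mod int q = l}. g v w)"
    by (intro sum.cong refl) auto
  finally show ?thesis by simp
qed

lemma corr_nonneg: "(\<And>v. v \<in> V \<Longrightarrow> b v \<ge> 0) \<Longrightarrow> corr q V b l \<ge> 0"
  unfolding corr_def by (intro sum_nonneg) auto

lemma sum_corr:
  assumes "q > 0" "finite V"
  shows "(\<Sum>l\<in>{0..<int q}. corr q V b l) = (\<Sum>v\<in>V. b v)\<^sup>2"
  unfolding corr_def using sum_pairs_by_difference[OF assms, of "\<lambda>v w. b v * b w"]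
  by (simp add: power2_eq_square sum_product)

text \<open>The squared modulus of an exponential sum is the Fourier transform of the difference
  count, so Parseval will turn its fourth moment into an additive energy.\<close>

lemma norm_square_sum_eq:
  assumes "q > 0" and "finite U"
  shows "(\<Sum>l\<in>{0..<int q}. complex_of_real (corr q U (\<lambda>_. 1) l) * eq q (h * x * l))
       = complex_of_real ((cmod (\<Sum>u\<in>U. eq q (h * x * u)))\<^sup>2)"
proof -
  have "complex_of_real ((cmod (\<Sum>u\<in>U. eq q (h * x * u)))\<^sup>2)
      = (\<Sum>u\<in>U. \<Sum>w\<in>U. eq q (h * x * (u - w)))"
    unfolding complex_norm_square cnj_sum sum_product
    by (intro sum.cong refl) (simp add: cnj_eq right_diff_distrib flip: eq_add)
  also have "\<dots> = (\<Sum>l\<in>{0..<int q}. \<Sum>(v, w)\<in>{(v, w) \<in> U \<times> U. (v - w) mod int q = l}.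
      eq q (h * x * (v - w)))"
    by (rule sum_pairs_by_difference[OF assms, symmetric])
  also have "\<dots> = (\<Sum>l\<in>{0..<int q}. complex_of_real (corr q U (\<lambda>_. 1) l) * eq q (h * x * l))"
  proof (intro sum.cong refl)
    fix l :: int
    have "(\<Sum>(v, w)\<in>{(v, w) \<in> U \<times> U. (v - w) mod int q = l}. eq q (h * x * (v - w)))
        = (\<Sum>(v, w)\<in>{(v, w) \<in> U \<times> U. (v - w) mod int q = l}. eq q (h * x * l))"
      by (intro sum.cong refl) (auto intro!: eq_cong cong_mult simp: cong_def)
    then show "(\<Sum>(v, w)\<in>{(v, w) \<in> U \<times> U. (v - w) mod int q = l}. eq q (h * x * (v - w)))
        = complex_of_real (corr q U (\<lambda>_. 1) l) * eq q (h * x * l)"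
      by (simp add: corr_def case_prod_unfold)
  qed
  finally show ?thesis by simp
qed

lemma fourth_moment_eq:
  assumes "q > 0" and "finite U" and "coprime h (int q)"
  shows "(\<Sum>x\<in>{0..<int q}. (cmod (\<Sum>u\<in>U. eq q (h * x * u))) ^ 4)
       = real q * (\<Sum>l\<in>{0..<int q}. (corr q U (\<lambda>_. 1) l)\<^sup>2)"
proof -
  have "(\<Sum>x\<in>{0..<int q}. (cmod (\<Sum>u\<in>U. eq q (h * x * u))) ^ 4)
      = (\<Sum>x\<in>{0..<int q}. (cmod (\<Sum>l\<in>{0..<int q}.
            complex_of_real (corr q U (\<lambda>_. 1) l) * eq q (h * x * l)))\<^sup>2)"
    unfolding norm_square_sum_eq[OF assms(1,2)] norm_of_real by simp
  also have "\<dots> = real q * (\<Sum>l\<in>{0..<int q}. (corr q U (\<lambda>_. 1) l)\<^sup>2)"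
    unfolding parseval_residues[OF assms(1,3)] norm_of_real by simp
  finally show ?thesis .
qed

text \<open>Cauchy-Schwarz in \<open>u\<close> removes \<open>A\<close>. Opening the square leaves a
  kernel \<open>K (v - w)\<close> that depends only on the difference, so pairs are grouped by
  \<open>l\<close>. Two more applications separate the correlation of \<open>V\<close> from
  \<open>K\<close>, whose fourth moment is \<open>q\<close> times the energy of
  \<open>U\<close>.\<close>

lemma bilinear_sum_power_8_le:
  fixes A B :: "int \<Rightarrow> complex"
  assumes q: "q > 0" and U: "finite U" and V: "finite V" and h: "coprime h (int q)"
  shows "(cmod (\<Sum>u\<in>U. \<Sum>v\<in>V. A u * B v * eq q (h * u * v))) ^ 8
     \<le> (\<Sum>u\<in>U. (cmod (A u))\<^sup>2) ^ 4 * (\<Sum>v\<in>V. cmod (B v)) ^ 4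
        * (\<Sum>l\<in>{0..<int q}. (corr q V (\<lambda>v. cmod (B v)) l)\<^sup>2)
        * (real q * (\<Sum>l\<in>{0..<int q}. (corr q U (\<lambda>_. 1) l)\<^sup>2))"
proof -
  let ?R = "{0..<int q}"
  define b where "b = (\<lambda>v. cmod (B v))"
  define \<rho> where "\<rho> = corr q V b"
  define F where "F = (\<lambda>u. \<Sum>v\<in>V. B v * eq q (h * u * v))"
  define K where "K = (\<lambda>l. \<Sum>u\<in>U. eq q (h * l * u))"
  define S where "S = cmod (\<Sum>u\<in>U. \<Sum>v\<in>V. A u * B v * eq q (h * u * v))"
  have \<rho>0: "\<rho> l \<ge> 0" for l unfolding \<rho>_def b_def by (rule corr_nonneg) auto
  have "S \<le> (\<Sum>u\<in>U. cmod (A u) * cmod (F u))"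
    unfolding S_def F_def
    by (rule order_trans[OF norm_sum], intro sum_mono)
       (simp add: sum_distrib_left mult.assoc flip: norm_mult)
  then have "S\<^sup>2 \<le> (\<Sum>u\<in>U. cmod (A u) * cmod (F u))\<^sup>2"
    by (intro power_mono) (auto simp: S_def)
  also have "\<dots> \<le> (\<Sum>u\<in>U. (cmod (A u))\<^sup>2) * (\<Sum>u\<in>U. (cmod (F u))\<^sup>2)"
    by (rule Cauchy_Schwarz_ineq_sum)
  finally have S2: "S\<^sup>2 \<le> (\<Sum>u\<in>U. (cmod (A u))\<^sup>2) * (\<Sum>u\<in>U. (cmod (F u))\<^sup>2)" .
  have "complex_of_real (\<Sum>u\<in>U. (cmod (F u))\<^sup>2)
      = (\<Sum>u\<in>U. \<Sum>v\<in>V. \<Sum>w\<in>V. B v * cnj (B w) * eq q (h * (v - w) * u))"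
    unfolding F_def of_real_sum complex_norm_square cnj_sum sum_product
    by (intro sum.cong refl) (simp add: cnj_eq algebra_simps flip: eq_add)
  also have "\<dots> = (\<Sum>v\<in>V. \<Sum>w\<in>V. \<Sum>u\<in>U. B v * cnj (B w) * eq q (h * (v - w) * u))"
    by (rule trans[OF sum.swap], rule sum.cong[OF refl], rule sum.swap)
  also have "\<dots> = (\<Sum>v\<in>V. \<Sum>w\<in>V. B v * cnj (B w) * K (v - w))"
    by (simp add: K_def sum_distrib_left)
  finally have expand: "complex_of_real (\<Sum>u\<in>U. (cmod (F u))\<^sup>2)
      = (\<Sum>v\<in>V. \<Sum>w\<in>V. B v * cnj (B w) * K (v - w))" .
  have "(\<Sum>u\<in>U. (cmod (F u))\<^sup>2) = cmod (\<Sum>v\<in>V. \<Sum>w\<in>V. B v * cnj (B w) * K (v - w))"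
    unfolding expand[symmetric] norm_of_real by (simp add: sum_nonneg)
  also have "\<dots> \<le> (\<Sum>v\<in>V. \<Sum>w\<in>V. b v * b w * cmod (K (v - w)))"
    by (intro order_trans[OF norm_sum] sum_mono) (auto simp: b_def norm_mult)
  also have "\<dots> = (\<Sum>l\<in>?R. \<Sum>(v, w)\<in>{(v, w) \<in> V \<times> V. (v - w) mod int q = l}.
      b v * b w * cmod (K (v - w)))"
    by (rule sum_pairs_by_difference[OF q V, symmetric])
  also have "\<dots> = (\<Sum>l\<in>?R. \<rho> l * cmod (K l))"
  proof (intro sum.cong refl)
    fix l :: int
    have K: "K (v - w) = K l" if "(v - w) mod int q = l" for v w
      unfolding K_def using that by (auto intro!: sum.cong eq_cong cong_mult simp: cong_def)
    show "(\<Sum>(v, w)\<in>{(v, w) \<in> V \<times> V. (v - w) mod int q = l}. b v * b w * cmod (K (v - w)))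
        = \<rho> l * cmod (K l)"
      unfolding \<rho>_def corr_def sum_distrib_right by (intro sum.cong refl) (auto simp: K)
  qed
  finally have F2: "(\<Sum>u\<in>U. (cmod (F u))\<^sup>2) \<le> (\<Sum>l\<in>?R. \<rho> l * cmod (K l))" .
  define T where "T = (\<Sum>l\<in>?R. \<rho> l * cmod (K l))"
  have T0: "T \<ge> 0" unfolding T_def by (intro sum_nonneg) (simp add: \<rho>0)
  \<comment> \<open>Splitting \<open>\<rho>\<close> into two square roots yields the exactly known
    sum of \<open>\<rho>\<close> as one factor, and leaves a factor still linear in
    \<open>\<rho>\<close> for the last Cauchy-Schwarz.\<close>
  have "T = (\<Sum>l\<in>?R. sqrt (\<rho> l) * (sqrt (\<rho> l) * cmod (K l)))"
    unfolding T_def by (intro sum.cong refl) (simp add: \<rho>0 flip: mult.assoc)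
  then have "T\<^sup>2 \<le> (\<Sum>l\<in>?R. (sqrt (\<rho> l))\<^sup>2) * (\<Sum>l\<in>?R. (sqrt (\<rho> l) * cmod (K l))\<^sup>2)"
    using Cauchy_Schwarz_ineq_sum by metis
  also have "(\<Sum>l\<in>?R. (sqrt (\<rho> l))\<^sup>2) = (\<Sum>v\<in>V. b v)\<^sup>2"
    using sum_corr[OF q V, of b] by (simp add: \<rho>0 flip: \<rho>_def)
  also have "(\<Sum>l\<in>?R. (sqrt (\<rho> l) * cmod (K l))\<^sup>2) = (\<Sum>l\<in>?R. \<rho> l * (cmod (K l))\<^sup>2)"
    by (simp add: power_mult_distrib \<rho>0)
  finally have T2: "T\<^sup>2 \<le> (\<Sum>v\<in>V. b v)\<^sup>2 * (\<Sum>l\<in>?R. \<rho> l * (cmod (K l))\<^sup>2)" .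
  define P where "P = (\<Sum>l\<in>?R. \<rho> l * (cmod (K l))\<^sup>2)"
  have P0: "P \<ge> 0" unfolding P_def by (intro sum_nonneg) (simp add: \<rho>0)
  have "P\<^sup>2 \<le> (\<Sum>l\<in>?R. (\<rho> l)\<^sup>2) * (\<Sum>l\<in>?R. ((cmod (K l))\<^sup>2)\<^sup>2)"
    unfolding P_def by (rule Cauchy_Schwarz_ineq_sum)
  also have "(\<Sum>l\<in>?R. ((cmod (K l))\<^sup>2)\<^sup>2) = real q * (\<Sum>l\<in>?R. (corr q U (\<lambda>_. 1) l)\<^sup>2)"
    using fourth_moment_eq[OF q U h] by (simp add: K_def)
  finally have P2: "P\<^sup>2 \<le> (\<Sum>l\<in>?R. (\<rho> l)\<^sup>2) * (real q * (\<Sum>l\<in>?R. (corr q U (\<lambda>_. 1) l)\<^sup>2))" .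
  define a where "a = (\<Sum>u\<in>U. (cmod (A u))\<^sup>2)"
  define \<beta> where "\<beta> = (\<Sum>v\<in>V. b v)"
  have a0: "a \<ge> 0" and \<beta>0: "\<beta> \<ge> 0" by (auto simp: a_def \<beta>_def b_def intro: sum_nonneg)
  have "S\<^sup>2 \<le> a * T"
    using S2 F2 a0 mult_left_mono unfolding T_def a_def by (meson order_trans)
  then have "(S\<^sup>2) ^ 4 \<le> (a * T) ^ 4" by (intro power_mono) auto
  then have "S ^ 8 \<le> a ^ 4 * (T\<^sup>2)\<^sup>2" by (simp add: power_mult_distrib)
  also have "\<dots> \<le> a ^ 4 * (\<beta>\<^sup>2 * P)\<^sup>2"
    using T2 a0 unfolding P_def \<beta>_def by (intro mult_left_mono power_mono) auto
  also have "\<dots> = a ^ 4 * \<beta> ^ 4 * P\<^sup>2" by (simp add: power_mult_distrib)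
  also have "\<dots> \<le> a ^ 4 * \<beta> ^ 4 * ((\<Sum>l\<in>?R. (\<rho> l)\<^sup>2) * (real q * (\<Sum>l\<in>?R. (corr q U (\<lambda>_. 1) l)\<^sup>2)))"
    using P2 a0 \<beta>0 by (intro mult_left_mono) auto
  finally show ?thesis unfolding S_def a_def \<beta>_def \<rho>_def b_def by (simp add: mult.assoc)
qed

section \<open>Short vectors in planar lattices\<close>


text \<open>A weighted sup norm, scaled so that the box \<open>|X| <= 2 N^2\<close>,
  \<open>|Y| <= 2 N\<close> is the ball of radius \<open>2 N^2\<close>.\<close>

definition lnorm :: "nat \<Rightarrow> int \<times> int \<Rightarrow> int" where
  "lnorm N P = max \<bar>fst P\<bar> (int N * \<bar>snd P\<bar>)"

definition lball :: "nat \<Rightarrow> int \<Rightarrow> int \<Rightarrow> nat \<Rightarrow> int \<Rightarrow> (int \<times> int) set" where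
  "lball q c e N F = {P. [c * fst P = e * snd P] (mod int q) \<and> lnorm N P \<le> F}"

lemma finite_lball:
  assumes "N > 0"
  shows "finite (lball q c e N F)"
proof (rule finite_subset)
  show "lball q c e N F \<subseteq> {- F..F} \<times> {- F..F}"
  proof
    fix P assume "P \<in> lball q c e N F"
    then have 1: "\<bar>fst P\<bar> \<le> F" "int N * \<bar>snd P\<bar> \<le> F" by (auto simp: lball_def lnorm_def)
    have "1 * \<bar>snd P\<bar> \<le> int N * \<bar>snd P\<bar>" using assms by (intro mult_right_mono) auto
    then show "P \<in> {- F..F} \<times> {- F..F}" using 1 by (cases P) auto
  qed
qed auto

text \<open>Eliminating \<open>e\<close> from the two congruences leaves \<open>c\<close> times the
  determinant, and \<open>c\<close> is a unit. Hence the lines parallel to a fixed lattice vector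
  that carry lattice points are indexed by multiples of \<open>q\<close>.\<close>

lemma lattice_det_dvd:
  assumes "coprime c (int q)"
    and P: "[c * X = e * Y] (mod int q)" and P': "[c * X' = e * Y'] (mod int q)"
  shows "int q dvd X * Y' - X' * Y"
proof -
  have "[c * X * Y' - c * X' * Y = e * Y * Y' - e * Y' * Y] (mod int q)"
    by (intro cong_diff cong_mult[OF P cong_refl] cong_mult[OF P' cong_refl])
  then have "int q dvd c * (X * Y' - X' * Y)"
    by (simp add: cong_iff_dvd_diff algebra_simps)
  then show ?thesis using assms(1)
    by (simp add: coprime_dvd_mult_right_iff coprime_commute)
qed

lemma lball_det_bound:
  assumes "lnorm N E \<le> f" "lnorm N P \<le> F"
  shows "int N * \<bar>fst E * snd P - fst P * snd E\<bar> \<le> 2 * f * F"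
proof -
  have E: "\<bar>fst E\<bar> \<le> f" "int N * \<bar>snd E\<bar> \<le> f" and P: "\<bar>fst P\<bar> \<le> F" "int N * \<bar>snd P\<bar> \<le> F"
    using assms by (auto simp: lnorm_def)
  have "int N * \<bar>fst E * snd P - fst P * snd E\<bar> \<le> int N * (\<bar>fst E\<bar> * \<bar>snd P\<bar> + \<bar>fst P\<bar> * \<bar>snd E\<bar>)"
    by (intro mult_left_mono order_trans[OF abs_triangle_ineq4]) (auto simp: abs_mult)
  also have "\<dots> = \<bar>fst E\<bar> * (int N * \<bar>snd P\<bar>) + (int N * \<bar>snd E\<bar>) * \<bar>fst P\<bar>"
    by (simp add: algebra_simps)
  also have "\<dots> \<le> f * F + f * F"
    using E P by (intro add_mono mult_mono) auto
  finally show ?thesis by (simp add: mult_ac)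
qed

text \<open>A vector parallel to \<open>E\<close> attains its maximum in the same coordinate as
  \<open>E\<close>. Along such a line the norm is therefore the absolute value of one linear
  coordinate, and the line can be cut into cells of prescribed length.\<close>

lemma lnorm_diff_collinear:
  assumes E: "lnorm N E > 0" and col: "fst E * y = x * snd E"
  shows "lnorm N (x, y) = (if \<bar>fst E\<bar> \<ge> int N * \<bar>snd E\<bar> then \<bar>x\<bar> else int N * \<bar>y\<bar>)"
proof (cases "\<bar>fst E\<bar> \<ge> int N * \<bar>snd E\<bar>")
  case True
  have "\<bar>fst E\<bar> * (int N * \<bar>y\<bar>) = int N * \<bar>fst E * y\<bar>" by (simp add: abs_mult)
  also have "\<dots> = (int N * \<bar>snd E\<bar>) * \<bar>x\<bar>" unfolding col by (simp add: abs_mult)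
  also have "\<dots> \<le> \<bar>fst E\<bar> * \<bar>x\<bar>" using True by (intro mult_right_mono) auto
  finally have "int N * \<bar>y\<bar> \<le> \<bar>x\<bar>"
    using E True by (subst (asm) mult_le_cancel_left_pos) (auto simp: lnorm_def)
  then show ?thesis using True by (simp add: lnorm_def)
next
  case False
  have "(int N * \<bar>snd E\<bar>) * \<bar>x\<bar> = int N * \<bar>fst E * y\<bar>" unfolding col by (simp add: abs_mult)
  also have "\<dots> = \<bar>fst E\<bar> * (int N * \<bar>y\<bar>)" by (simp add: abs_mult)
  also have "\<dots> \<le> (int N * \<bar>snd E\<bar>) * (int N * \<bar>y\<bar>)" using False by (intro mult_right_mono) auto
  finally have "\<bar>x\<bar> \<le> int N * \<bar>y\<bar>"
    using E False by (subst (asm) mult_le_cancel_left_pos) (auto simp: lnorm_def)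
  then show ?thesis using False by (simp add: lnorm_def)
qed

lemma div_eq_imp_abs_diff_less:
  fixes a b m :: int
  assumes "m > 0" "a div m = b div m"
  shows "\<bar>a - b\<bar> < m"
proof -
  have "a = m * (b div m) + a mod m" "b = m * (b div m) + b mod m"
    using assms(2) by (metis mult_div_mod_eq)+
  then show ?thesis
    using pos_mod_bound[OF assms(1), of a] pos_mod_bound[OF assms(1), of b]
      pos_mod_sign[OF assms(1), of a] pos_mod_sign[OF assms(1), of b] by linarith
qed

text \<open>The points of the ball lie on at most \<open>4 f F / (N q) + 1\<close> lines parallel to a shortest
  nonzero vector (of norm \<open>f\<close>), and on each line consecutive points are at distance at least \<open>f\<close>.\<close>

lemma card_lball_le_shortest:
  assumes q: "q > 0" and N: "N > 0" and c: "coprime c (int q)"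
    and ex: "lball q c e N F \<noteq> {(0, 0)}" and F: "F \<ge> 0"
  obtains E where "E \<in> lball q c e N F" "lnorm N E > 0"
    "real (card (lball q c e N F))
       \<le> 12 * (real_of_int F)\<^sup>2 / (real N * real q) + 3 * real_of_int F / real_of_int (lnorm N E)"
proof -
  let ?S = "lball q c e N F"
  have zero: "(0, 0) \<in> ?S" using F by (simp add: lball_def lnorm_def)
  have pos: "lnorm N P > 0" if "P \<noteq> (0, 0)" for P
    using that N by (cases P) (auto simp: lnorm_def less_max_iff_disj)
  have fin: "finite (?S - {(0, 0)})" using finite_lball[OF N] by blast
  have ne: "?S - {(0, 0)} \<noteq> {}" using ex zero by blast
  obtain E where E: "E \<in> ?S - {(0, 0)}" and min: "\<And>P. P \<in> ?S - {(0, 0)} \<Longrightarrow> lnorm N E \<le> lnorm N P"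
    using arg_min_if_finite(1)[OF fin ne, of "lnorm N"] arg_min_least[OF fin ne, of _ "lnorm N"]
    by blast
  define f where "f = lnorm N E"
  have f: "f > 0" using pos E unfolding f_def by blast
  have fF: "f \<le> F" using E unfolding f_def by (simp add: lball_def)
  define g where "g P = (if \<bar>fst E\<bar> \<ge> int N * \<bar>snd E\<bar> then fst P else int N * snd P)" for P :: "int \<times> int"
  define det where "det P = fst E * snd P - fst P * snd E" for P
  have gF: "\<bar>g P\<bar> \<le> F" if "P \<in> ?S" for P
    using that by (auto simp: g_def lball_def lnorm_def abs_mult)
  have detdvd: "int q dvd det P" if "P \<in> ?S" for P
    using lattice_det_dvd[OF c, of "fst E" e "snd E" "fst P" "snd P"] that E
    by (auto simp: lball_def det_def)
  define k where "k = (2 * f * F) div (int N * int q)"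
  have Nq: "int N * int q > 0" using N q by simp
  \<comment> \<open>The first entry names the line parallel to \<open>E\<close>, the second a cell
    of length \<open>f\<close> on it. Two points with the same image differ by a lattice vector
    shorter than the shortest nonzero one, hence by zero.\<close>
  define \<phi> where "\<phi> P = (det P div int q, (g P + F) div f)" for P
  have "inj_on \<phi> ?S"
  proof (rule inj_onI)
    fix P P' assume P: "P \<in> ?S" "P' \<in> ?S" and eq: "\<phi> P = \<phi> P'"
    have "det P = det P'"
      using eq detdvd[OF P(1)] detdvd[OF P(2)] unfolding \<phi>_def
      by (metis dvd_div_mult_self prod.inject)
    then have col: "fst E * (snd P - snd P') = (fst P - fst P') * snd E"
      by (simp add: det_def algebra_simps)
    have "(g P + F) div f = (g P' + F) div f" using eq by (simp add: \<phi>_def)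
    from div_eq_imp_abs_diff_less[OF f this] have lt: "\<bar>g P - g P'\<bar> < f" by simp
    let ?D = "(fst P - fst P', snd P - snd P')"
    have "lnorm N ?D = \<bar>g P - g P'\<bar>"
      using lnorm_diff_collinear[OF _ col] f unfolding f_def g_def
      by (auto simp: abs_mult simp flip: right_diff_distrib)
    then have small: "lnorm N ?D < f" using lt by simp
    have "[c * fst P - c * fst P' = e * snd P - e * snd P'] (mod int q)"
      using P by (intro cong_diff) (auto simp: lball_def)
    then have "?D \<in> ?S" using small fF by (simp add: lball_def right_diff_distrib)
    then have "?D = (0, 0)" using min[of ?D] small unfolding f_def by fastforce
    then show "P = P'" by (simp add: prod_eq_iff)
  qed
  moreover have "\<phi> ` ?S \<subseteq> {- k..k} \<times> {0..(2 * F) div f}"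
  proof (rule image_subsetI)
    fix P assume P: "P \<in> ?S"
    obtain t where t: "det P = int q * t" using detdvd[OF P] by (auto elim: dvdE)
    have "int N * \<bar>det P\<bar> \<le> 2 * f * F"
      unfolding det_def by (rule lball_det_bound) (use P in \<open>auto simp: f_def lball_def\<close>)
    then have "\<bar>t\<bar> * (int N * int q) \<le> 2 * f * F" using t by (simp add: abs_mult mult_ac)
    from zdiv_mono1[OF this Nq] have "\<bar>t\<bar> \<le> k" unfolding k_def using N q by simp
    moreover have "det P div int q = t" using t q by simp
    moreover have "0 \<le> (g P + F) div f" using gF[OF P] f by (simp add: pos_imp_zdiv_nonneg_iff)
    moreover have "(g P + F) div f \<le> (2 * F) div f" using gF[OF P] f by (intro zdiv_mono1) auto
    ultimately show "\<phi> P \<in> {- k..k} \<times> {0..(2 * F) div f}" by (auto simp: \<phi>_def)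
  qed
  ultimately have "card ?S \<le> card ({- k..k} \<times> {0..(2 * F) div f})"
    by (intro card_inj_on_le) auto
  then have "int (card ?S) \<le> (2 * k + 1) * ((2 * F) div f + 1)"
  proof -
    have "0 \<le> k" using f F Nq unfolding k_def by (simp add: pos_imp_zdiv_nonneg_iff)
    moreover have "0 \<le> (2 * F) div f" using f F by (simp add: pos_imp_zdiv_nonneg_iff)
    ultimately have "int (card ({- k..k} \<times> {0..(2 * F) div f})) = (2 * k + 1) * ((2 * F) div f + 1)"
      by (simp add: card_cartesian_product)
    then show ?thesis using \<open>card ?S \<le> _\<close> by linarith
  qed
  then have "real (card ?S) \<le> (2 * real_of_int k + 1) * (real_of_int ((2 * F) div f) + 1)"
    by (metis (mono_tags) of_int_1 of_int_add of_int_le_iff of_int_mult of_int_numeral of_int_of_nat_eq)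
  \<comment> \<open>Here \<open>k <= 2 f F / (N q)\<close>, and the \<open>+ 1\<close> in the number
    of cells is absorbed by \<open>f <= F\<close>, which gives \<open>3 F / f\<close>.\<close>
  also have "\<dots> \<le> (2 * (2 * real_of_int f * real_of_int F / (real N * real q)) + 1)
      * (3 * real_of_int F / real_of_int f)"
  proof (rule mult_mono)
    show "2 * real_of_int k + 1 \<le> 2 * (2 * real_of_int f * real_of_int F / (real N * real q)) + 1"
      unfolding k_def using real_of_int_div4[of "2 * f * F" "int N * int q"] by simp
    have "real_of_int ((2 * F) div f) \<le> 2 * real_of_int F / real_of_int f"
      using real_of_int_div4[of "2 * F" f] by simp
    moreover have "1 \<le> real_of_int F / real_of_int f" using f fF by simp
    ultimately show "real_of_int ((2 * F) div f) + 1 \<le> 3 * real_of_int F / real_of_int f" by simp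
    have "0 \<le> (2 * F) div f" using f F by (simp add: pos_imp_zdiv_nonneg_iff)
    then show "0 \<le> real_of_int ((2 * F) div f) + 1" by linarith
    show "0 \<le> 2 * (2 * real_of_int f * real_of_int F / (real N * real q)) + 1" using f F by simp
  qed
  also have "\<dots> = 12 * (real_of_int F)\<^sup>2 / (real N * real q) + 3 * real_of_int F / real_of_int f"
    using f N q by (simp add: field_simps power2_eq_square)
  finally show thesis using that[of E] E f unfolding f_def by blast
qed

section \<open>Differences of modular square roots\<close>


definition roots :: "nat \<Rightarrow> int \<Rightarrow> nat \<Rightarrow> int set" where
  "roots q c n = {v \<in> {0..<int q}. [v\<^sup>2 = c * int n] (mod int q)}"

definition dyad_roots :: "nat \<Rightarrow> int \<Rightarrow> nat \<Rightarrow> int set" where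
  "dyad_roots q c N = (\<Union>n\<in>dyad N. roots q c n)"

lemma finite_roots [simp]: "finite (roots q c n)"
  by (rule finite_subset[of _ "{0..<int q}"]) (auto simp: roots_def)

lemma finite_dyad [simp]: "finite (dyad N)"
  by (simp add: dyad_def)

lemma finite_dyad_roots [simp]: "finite (dyad_roots q c N)"
  by (simp add: dyad_roots_def)

lemma prime_int_dvd_mult_iff:
  "prime q \<Longrightarrow> int q dvd a * b \<longleftrightarrow> int q dvd a \<or> int q dvd b"
  by (simp add: prime_dvd_mult_iff)

lemma square_cong_imp:
  fixes v w :: int
  assumes "prime q" "[v\<^sup>2 = w\<^sup>2] (mod int q)"
  shows "[v = w] (mod int q) \<or> [v = - w] (mod int q)"
proof -
  have "int q dvd (v - w) * (v + w)"
    using assms(2) by (simp add: cong_iff_dvd_diff algebra_simps power2_eq_square)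
  then show ?thesis using assms(1) by (auto simp: prime_int_dvd_mult_iff cong_iff_dvd_diff)
qed

lemma card_square_class_le_2:
  assumes "prime q" and S: "S \<subseteq> {0..<int q}"
    and sq: "\<And>v w. v \<in> S \<Longrightarrow> w \<in> S \<Longrightarrow> [v\<^sup>2 = w\<^sup>2] (mod int q)"
  shows "card S \<le> 2"
proof (cases "S = {}")
  case False
  then obtain w where w: "w \<in> S" by blast
  have "S \<subseteq> {w, (- w) mod int q}"
  proof
    fix v assume v: "v \<in> S"
    then have "[v = w] (mod int q) \<or> [v = - w] (mod int q)"
      using square_cong_imp[OF assms(1) sq] w by blast
    then show "v \<in> {w, (- w) mod int q}"
      using subsetD[OF S v] subsetD[OF S w] residues_eqI[of v w q] by (auto simp: cong_def)
  qed
  then have "card S \<le> card {w, (- w) mod int q}" by (intro card_mono) auto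
  also have "\<dots> \<le> 2" by (simp add: card_insert_le_m1)
  finally show ?thesis .
qed simp

lemma card_roots_le_2:
  assumes "prime q"
  shows "card (roots q c n) \<le> 2"
  by (rule card_square_class_le_2[OF assms]) (auto simp: roots_def intro: cong_trans cong_sym)

lemma roots_disjoint:
  assumes "v \<in> roots q c m" "v \<in> roots q c n" "m \<in> dyad N" "n \<in> dyad N"
    and "coprime c (int q)" "2 * N \<le> q"
  shows "m = n"
proof -
  have "[c * int m = c * int n] (mod int q)"
    using assms(1,2) by (auto simp: roots_def intro: cong_trans cong_sym)
  then have "[int m = int n] (mod int q)"
    using assms(5) by (simp add: cong_mult_lcancel)
  then have "int m = int n"
    using assms(3,4,6) residues_eqI[of "int m" "int n" q] by (auto simp: dyad_def)
  then show ?thesis by simp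
qed

definition root_index :: "nat \<Rightarrow> int \<Rightarrow> nat \<Rightarrow> int \<Rightarrow> nat" where
  "root_index q c N v = (SOME n. n \<in> dyad N \<and> v \<in> roots q c n)"

lemma root_index:
  assumes "v \<in> dyad_roots q c N"
  shows "root_index q c N v \<in> dyad N" "v \<in> roots q c (root_index q c N v)"
proof -
  have "\<exists>n. n \<in> dyad N \<and> v \<in> roots q c n" using assms by (auto simp: dyad_roots_def)
  from someI_ex[OF this] show "root_index q c N v \<in> dyad N" "v \<in> roots q c (root_index q c N v)"
    unfolding root_index_def by blast+
qed

lemma sum_dyad_roots:
  fixes g :: "nat \<Rightarrow> int \<Rightarrow> 'a :: comm_monoid_add"
  assumes "coprime c (int q)" "2 * N \<le> q"
  shows "(\<Sum>n\<in>dyad N. \<Sum>v\<in>roots q c n. g n v)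
       = (\<Sum>v\<in>dyad_roots q c N. g (root_index q c N v) v)"
proof -
  have index: "root_index q c N v = n" if "n \<in> dyad N" "v \<in> roots q c n" for n v
  proof -
    have "v \<in> dyad_roots q c N" using that by (auto simp: dyad_roots_def)
    from root_index[OF this] show ?thesis using roots_disjoint that assms by metis
  qed
  have "(\<Sum>v\<in>dyad_roots q c N. g (root_index q c N v) v)
      = (\<Sum>n\<in>dyad N. \<Sum>v\<in>roots q c n. g (root_index q c N v) v)"
    unfolding dyad_roots_def using roots_disjoint[OF _ _ _ _ assms]
    by (intro sum.UNION_disjoint) auto
  also have "\<dots> = (\<Sum>n\<in>dyad N. \<Sum>v\<in>roots q c n. g n v)"
    by (intro sum.cong refl) (simp add: index)
  finally show ?thesis by simp
qed

lemma sum_dyad_roots_le: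
  fixes g :: "nat \<Rightarrow> real"
  assumes "prime q" "coprime c (int q)" "2 * N \<le> q" "\<And>n. g n \<ge> 0"
  shows "(\<Sum>v\<in>dyad_roots q c N. g (root_index q c N v)) \<le> 2 * (\<Sum>n\<in>dyad N. g n)"
proof -
  have "(\<Sum>v\<in>dyad_roots q c N. g (root_index q c N v)) = (\<Sum>n\<in>dyad N. real (card (roots q c n)) * g n)"
    using sum_dyad_roots[OF assms(2,3), of "\<lambda>n _. g n"] by simp
  also have "\<dots> \<le> (\<Sum>n\<in>dyad N. 2 * g n)"
    using card_roots_le_2[OF assms(1)] assms(4) by (intro sum_mono mult_right_mono) auto
  finally show ?thesis by (simp add: sum_distrib_left)
qed

lemma card_dyad_roots_le:
  assumes "prime q" "coprime c (int q)" "2 * N \<le> q"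
  shows "card (dyad_roots q c N) \<le> 2 * N"
proof -
  have "real (card (dyad_roots q c N)) \<le> real (2 * N)"
    using sum_dyad_roots_le[OF assms, of "\<lambda>_. 1"] by (simp add: dyad_def)
  then show ?thesis by (simp only: of_nat_le_iff)
qed

section \<open>The parabola of gaps and the lattice of its differences\<close>

text \<open>\<open>d\<close> stands for \<open>m - n\<close> and \<open>s\<close> for
  \<open>m + n\<close>; the ranges are those of a difference and a sum of two elements of
  \<open>dyad N\<close>. The parity relation between them and the existence of square roots are not
  recorded, so the set only dominates the pairs with difference \<open>l\<close>.\<close>

definition gap_set :: "nat \<Rightarrow> int \<Rightarrow> nat \<Rightarrow> int \<Rightarrow> int set" where
  "gap_set q c N l = {d \<in> {- int N<..<int N}.
     \<exists>s\<in>{2 * int N..<4 * int N}. [c\<^sup>2 * d\<^sup>2 + l ^ 4 = 2 * c * l\<^sup>2 * s] (mod int q)}"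

lemma finite_gap_set [simp]: "finite (gap_set q c N l)"
  by (rule finite_subset[of _ "{- int N<..<int N}"]) (auto simp: gap_set_def)

text \<open>The first congruence is \<open>(v - w) (v + w) = v^2 - w^2\<close>. Squaring it and
  adding \<open>l^4 = l^2 (v - w)^2\<close>, the parallelogram law
  \<open>(v + w)^2 + (v - w)^2 = 2 (v^2 + w^2)\<close> eliminates the roots.\<close>

lemma roots_difference:
  assumes v: "v \<in> roots q c m" and w: "w \<in> roots q c n" and l: "(v - w) mod int q = l"
  shows "[l * (v + w) = c * (int m - int n)] (mod int q)"
    and "[c\<^sup>2 * (int m - int n)\<^sup>2 + l ^ 4 = 2 * c * l\<^sup>2 * (int m + int n)] (mod int q)"
proof -
  have vw: "[v\<^sup>2 = c * int m] (mod int q)" "[w\<^sup>2 = c * int n] (mod int q)"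
    using v w by (auto simp: roots_def)
  have l': "[l = v - w] (mod int q)" using l by (auto simp: cong_def)
  have "[l * (v + w) = (v - w) * (v + w)] (mod int q)" by (intro cong_mult l' cong_refl)
  also have "(v - w) * (v + w) = v\<^sup>2 - w\<^sup>2" by (simp add: power2_eq_square algebra_simps)
  also have "[v\<^sup>2 - w\<^sup>2 = c * int m - c * int n] (mod int q)" by (intro cong_diff vw)
  finally show 1: "[l * (v + w) = c * (int m - int n)] (mod int q)"
    by (simp add: right_diff_distrib)
  have "[c\<^sup>2 * (int m - int n)\<^sup>2 + l ^ 4 = (l * (v + w))\<^sup>2 + l\<^sup>2 * l\<^sup>2] (mod int q)"
    using cong_pow[OF cong_sym[OF 1], of 2]
    by (intro cong_add) (auto simp: power_mult_distrib simp flip: power_add)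
  also have "[(l * (v + w))\<^sup>2 + l\<^sup>2 * l\<^sup>2 = (l * (v + w))\<^sup>2 + l\<^sup>2 * (v - w)\<^sup>2] (mod int q)"
    by (intro cong_add cong_mult cong_pow l' cong_refl)
  also have "(l * (v + w))\<^sup>2 + l\<^sup>2 * (v - w)\<^sup>2 = 2 * l\<^sup>2 * (v\<^sup>2 + w\<^sup>2)"
    by (simp add: power2_eq_square algebra_simps)
  also have "[2 * l\<^sup>2 * (v\<^sup>2 + w\<^sup>2) = 2 * l\<^sup>2 * (c * int m + c * int n)] (mod int q)"
    by (intro cong_mult cong_add vw cong_refl)
  also have "2 * l\<^sup>2 * (c * int m + c * int n) = 2 * c * l\<^sup>2 * (int m + int n)"
    by (simp add: algebra_simps)
  finally show "[c\<^sup>2 * (int m - int n)\<^sup>2 + l ^ 4 = 2 * c * l\<^sup>2 * (int m + int n)] (mod int q)" .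
qed

lemma not_dvd_residue: "l \<in> {1..<int q} \<Longrightarrow> \<not> int q dvd l"
  by (auto dest: zdvd_imp_le)

text \<open>For a unit \<open>l\<close> the gap \<open>m - n\<close> fixes \<open>v + w\<close>;
  since \<open>v - w = l\<close> and 2 is invertible, it fixes both roots.\<close>

lemma corr_le_card_gap_set:
  assumes q: "prime q" "odd q" and l: "l \<in> {1..<int q}"
  shows "corr q (dyad_roots q c N) (\<lambda>_. 1) l \<le> real (card (gap_set q c N l))"
proof -
  let ?V = "dyad_roots q c N"
  let ?P = "{(v, w) \<in> ?V \<times> ?V. (v - w) mod int q = l}"
  define i where "i v = int (root_index q c N v)" for v
  define \<phi> where "\<phi> = (\<lambda>(v, w). i v - i w)"
  have ql: "coprime l (int q)" and q2: "coprime 2 (int q)"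
    using prime_imp_coprime[of "int q" l] not_dvd_residue[OF l] q
    by (auto simp: coprime_commute)
  have inj: "inj_on \<phi> ?P"
  proof (rule inj_onI, clarsimp)
    fix v w v' w' assume V: "v \<in> ?V" "w \<in> ?V" "v' \<in> ?V" "w' \<in> ?V"
      and d: "(v' - w') mod int q = (v - w) mod int q" "l = (v - w) mod int q"
      and eq: "\<phi> (v, w) = \<phi> (v', w')"
    have "[l * (v + w) = l * (v' + w')] (mod int q)"
      using roots_difference(1)[OF root_index(2)[OF V(1)] root_index(2)[OF V(2)], of l]
        roots_difference(1)[OF root_index(2)[OF V(3)] root_index(2)[OF V(4)], of l] d eq
      by (auto simp: \<phi>_def i_def intro: cong_trans cong_sym)
    then have sum: "[v + w = v' + w'] (mod int q)" using ql by (simp add: cong_mult_lcancel)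
    have diff: "[v - w = v' - w'] (mod int q)" using d by (simp add: cong_def)
    have "[2 * v = 2 * v'] (mod int q)" using cong_add[OF sum diff] by simp
    then have 1: "[v = v'] (mod int q)" using q2 by (simp add: cong_mult_lcancel)
    have "[2 * w = 2 * w'] (mod int q)" using cong_diff[OF sum diff] by simp
    then have 2: "[w = w'] (mod int q)" using q2 by (simp add: cong_mult_lcancel)
    show "v = v' \<and> w = w'"
      using 1 2 V residues_eqI[of v v' q] residues_eqI[of w w' q]
      by (auto simp: dyad_roots_def roots_def)
  qed
  have sub: "\<phi> ` ?P \<subseteq> gap_set q c N l"
  proof (clarsimp simp: \<phi>_def)
    fix v w assume V: "v \<in> ?V" "w \<in> ?V" and l: "l = (v - w) mod int q"
    have "root_index q c N v \<in> dyad N" "root_index q c N w \<in> dyad N" using root_index V by blast+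
    then have "i v - i w \<in> {- int N<..<int N}" "i v + i w \<in> {2 * int N..<4 * int N}"
      by (auto simp: i_def dyad_def)
    moreover have "[c\<^sup>2 * (i v - i w)\<^sup>2 + l ^ 4 = 2 * c * l\<^sup>2 * (i v + i w)] (mod int q)"
      unfolding i_def
      by (rule roots_difference(2)[OF root_index(2)[OF V(1)] root_index(2)[OF V(2)] l[symmetric]])
    ultimately show "i v - i w \<in> gap_set q c N ((v - w) mod int q)"
      unfolding gap_set_def l by blast
  qed
  have "card ?P \<le> card (gap_set q c N l)"
    by (rule card_inj_on_le[OF inj sub]) simp
  then show ?thesis by (simp add: corr_def case_prod_unfold)
qed

lemma card_int_divisors_le:
  fixes x :: int
  assumes "x \<noteq> 0"
  shows "card {t. t dvd x} \<le> 2 * ndiv (nat \<bar>x\<bar>)"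
proof -
  let ?D = "{d. d dvd nat \<bar>x\<bar>}"
  have fin: "finite ?D" using assms by (intro finite_divisors_nat) simp
  have "{t. t dvd x} \<subseteq> int ` ?D \<union> (\<lambda>d. - int d) ` ?D"
  proof
    fix t assume "t \<in> {t. t dvd x}"
    then have "nat \<bar>t\<bar> \<in> ?D" by (simp add: nat_abs_dvd_iff)
    moreover have "t = int (nat \<bar>t\<bar>) \<or> t = - int (nat \<bar>t\<bar>)" by linarith
    ultimately show "t \<in> int ` ?D \<union> (\<lambda>d. - int d) ` ?D" by blast
  qed
  then have "card {t. t dvd x} \<le> card (int ` ?D \<union> (\<lambda>d. - int d) ` ?D)"
    using fin by (intro card_mono) auto
  also have "\<dots> \<le> card (int ` ?D) + card ((\<lambda>d. - int d) ` ?D)" by (rule card_Un_le)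
  also have "\<dots> \<le> card ?D + card ?D" by (intro add_mono card_image_le fin)
  finally show ?thesis by (simp add: ndiv_def)
qed

text \<open>The divisor \<open>d - d'\<close> of the nonzero number \<open>x\<close> determines
  \<open>d + d'\<close> and thus the pair.\<close>

lemma card_square_differences_le:
  fixes D :: "int set" and x :: int
  assumes "x \<noteq> 0" "finite D"
  shows "card {(d, d') \<in> D \<times> D. d\<^sup>2 - d'\<^sup>2 = x} \<le> 2 * ndiv (nat \<bar>x\<bar>)"
proof -
  let ?P = "{(d, d') \<in> D \<times> D. d\<^sup>2 - d'\<^sup>2 = x}"
  have fac: "(d - d') * (d + d') = d\<^sup>2 - d'\<^sup>2" for d d' :: int
    by (simp add: power2_eq_square algebra_simps)
  have "inj_on (\<lambda>(d, d'). d - d') ?P"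
  proof (rule inj_onI, clarsimp)
    fix d d' a a' :: int
    assume eq: "d - d' = a - a'" and x: "a\<^sup>2 - a'\<^sup>2 = d\<^sup>2 - d'\<^sup>2" "x = d\<^sup>2 - d'\<^sup>2"
    have "(a - a') * (d + d') = (a - a') * (a + a')" using fac[of d d'] fac[of a a'] x eq by simp
    moreover have "a - a' \<noteq> 0" using assms(1) x eq fac[of d d'] by auto
    ultimately have "d + d' = a + a'" by simp
    then show "d = a \<and> d' = a'" using eq by linarith
  qed
  moreover have "(\<lambda>(d, d'). d - d') ` ?P \<subseteq> {t. t dvd x}"
    using fac by (auto simp: dvd_def) (metis fac)+
  moreover have "finite {t. t dvd x}" using assms(1) by simp
  ultimately have "card ?P \<le> card {t. t dvd x}" by (intro card_inj_on_le)
  also have "\<dots> \<le> 2 * ndiv (nat \<bar>x\<bar>)" by (rule card_int_divisors_le[OF assms(1)])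
  finally show ?thesis .
qed

text \<open>Subtracting two equations of the parabola cancels \<open>l^4\<close> and, after division
  by \<open>c\<close>, leaves a congruence linear in \<open>d^2 - d'^2\<close> and
  \<open>s - s'\<close>. Pairs of gaps thus map to lattice points, and the divisor function bounds
  the fibres.\<close>

lemma card_gap_set_square_le:
  assumes q: "q > 0" and c: "coprime c (int q)" and N: "N > 0" "N \<le> q"
  shows "(real (card (gap_set q c N l)))\<^sup>2
      \<le> 8 * divmax q * real (card (lball q c (2 * l\<^sup>2) N (2 * (int N)\<^sup>2)))"
proof -
  let ?D = "gap_set q c N l"
  let ?B = "lball q c (2 * l\<^sup>2) N (2 * (int N)\<^sup>2)"
  define s where "s d = (SOME s. s \<in> {2 * int N..<4 * int N} \<and>
    [c\<^sup>2 * d\<^sup>2 + l ^ 4 = 2 * c * l\<^sup>2 * s] (mod int q))" for d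
  have s: "s d \<in> {2 * int N..<4 * int N}" "[c\<^sup>2 * d\<^sup>2 + l ^ 4 = 2 * c * l\<^sup>2 * s d] (mod int q)"
    if "d \<in> ?D" for d
  proof -
    have "\<exists>s. s \<in> {2 * int N..<4 * int N} \<and> [c\<^sup>2 * d\<^sup>2 + l ^ 4 = 2 * c * l\<^sup>2 * s] (mod int q)"
      using that by (auto simp: gap_set_def)
    from someI_ex[OF this] show "s d \<in> {2 * int N..<4 * int N}"
      "[c\<^sup>2 * d\<^sup>2 + l ^ 4 = 2 * c * l\<^sup>2 * s d] (mod int q)"
      unfolding s_def by blast+
  qed
  have sq: "d\<^sup>2 \<le> (int N)\<^sup>2" if "d \<in> ?D" for d
    using that by (auto simp: gap_set_def intro!: power2_le_iff_abs_le[THEN iffD2])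
  have in_ball: "(d\<^sup>2 - d'\<^sup>2, s d - s d') \<in> ?B" if d: "d \<in> ?D" "d' \<in> ?D" for d d'
  proof -
    have "[c * (c * (d\<^sup>2 - d'\<^sup>2)) = c * (2 * l\<^sup>2 * (s d - s d'))] (mod int q)"
      using cong_diff[OF s(2)[OF d(1)] s(2)[OF d(2)]] by (simp add: algebra_simps power2_eq_square)
    then have "[c * (d\<^sup>2 - d'\<^sup>2) = 2 * l\<^sup>2 * (s d - s d')] (mod int q)"
      using c by (simp only: cong_mult_lcancel)
    moreover have "\<bar>d\<^sup>2 - d'\<^sup>2\<bar> \<le> 2 * (int N)\<^sup>2"
      using sq[OF d(1)] sq[OF d(2)] zero_le_power2[of d] zero_le_power2[of d'] by linarith
    moreover have "int N * \<bar>s d - s d'\<bar> \<le> int N * (2 * int N)"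
      using s(1)[OF d(1)] s(1)[OF d(2)] by (intro mult_left_mono) auto
    ultimately show ?thesis by (simp add: lball_def lnorm_def power2_eq_square)
  qed
  have finB: "finite ?B" by (rule finite_lball[OF N(1)])
  let ?fib = "\<lambda>P. {(d, d') \<in> ?D \<times> ?D. d\<^sup>2 - d'\<^sup>2 = fst P}"
  \<comment> \<open>Both squares lie between 0 and \<open>N^2\<close>, so the first coordinate stays
    in the range of \<open>divmax\<close>. It must also be nonzero for the divisor bound; the pairs
    \<open>d' = d\<close> and \<open>d' = - d\<close> are counted apart.\<close>
  let ?B' = "{P \<in> ?B. fst P \<noteq> 0 \<and> \<bar>fst P\<bar> \<le> (int N)\<^sup>2}"
  have "?D \<times> ?D \<subseteq> (\<lambda>d. (d, d)) ` ?D \<union> (\<lambda>d. (d, - d)) ` ?D \<union> (\<Union>P\<in>?B'. ?fib P)"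
  proof
    fix p assume p: "p \<in> ?D \<times> ?D"
    obtain d d' where dd: "p = (d, d')" by fastforce
    have D: "d \<in> ?D" "d' \<in> ?D" using p dd by auto
    show "p \<in> (\<lambda>d. (d, d)) ` ?D \<union> (\<lambda>d. (d, - d)) ` ?D \<union> (\<Union>P\<in>?B'. ?fib P)"
    proof (cases "d\<^sup>2 = d'\<^sup>2")
      case True
      then have "d' = d \<or> d' = - d" by (auto simp: power2_eq_iff)
      then show ?thesis using D dd by auto
    next
      case False
      have "\<bar>d\<^sup>2 - d'\<^sup>2\<bar> \<le> (int N)\<^sup>2"
        using sq[OF D(1)] sq[OF D(2)] zero_le_power2[of d] zero_le_power2[of d'] by linarith
      then have "(d\<^sup>2 - d'\<^sup>2, s d - s d') \<in> ?B'" using in_ball[OF D] False by simp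
      moreover have "p \<in> ?fib (d\<^sup>2 - d'\<^sup>2, s d - s d')" using D dd by simp
      ultimately show ?thesis by blast
    qed
  qed
  then have "card (?D \<times> ?D) \<le> card ((\<lambda>d. (d, d)) ` ?D \<union> (\<lambda>d. (d, - d)) ` ?D \<union> (\<Union>P\<in>?B'. ?fib P))"
    using finB by (intro card_mono) (auto intro: finite_subset[of _ "?D \<times> ?D"])
  also have "\<dots> \<le> card ((\<lambda>d. (d, d)) ` ?D) + card ((\<lambda>d. (d, - d)) ` ?D) + card (\<Union>P\<in>?B'. ?fib P)"
    by (meson card_Un_le add_le_mono1 order_trans)
  also have "\<dots> \<le> card ?D + card ?D + (\<Sum>P\<in>?B'. card (?fib P))"
    using finB by (intro add_mono card_image_le card_UN_le) auto
  finally have "real (card (?D \<times> ?D)) \<le> real (card ?D + card ?D + (\<Sum>P\<in>?B'. card (?fib P)))"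
    by (rule of_nat_mono)
  also have "\<dots> = 2 * real (card ?D) + (\<Sum>P\<in>?B'. real (card (?fib P)))" by simp
  also have "(\<Sum>P\<in>?B'. real (card (?fib P))) \<le> (\<Sum>P\<in>?B'. 2 * divmax q)"
  proof (rule sum_mono)
    fix P assume P: "P \<in> ?B'"
    have "card (?fib P) \<le> 2 * ndiv (nat \<bar>fst P\<bar>)"
      using P by (intro card_square_differences_le) auto
    then have "real (card (?fib P)) \<le> real (2 * ndiv (nat \<bar>fst P\<bar>))" by (rule of_nat_mono)
    also have "\<dots> = 2 * real (ndiv (nat \<bar>fst P\<bar>))" by simp
    also have "real (ndiv (nat \<bar>fst P\<bar>)) \<le> divmax q"
    proof (rule ndiv_le_divmax)
      have "nat \<bar>fst P\<bar> \<le> nat ((int N)\<^sup>2)" using P by (intro nat_mono) simp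
      also have "\<dots> = N\<^sup>2" by (simp add: nat_power_eq)
      also have "\<dots> \<le> q\<^sup>2" using N by (intro power_mono) auto
      finally show "nat \<bar>fst P\<bar> \<le> q\<^sup>2" .
      show "0 < nat \<bar>fst P\<bar>" using P by simp
    qed
    finally show "real (card (?fib P)) \<le> 2 * divmax q" by simp
  qed
  also have "(\<Sum>P\<in>?B'. 2 * divmax q) \<le> 2 * divmax q * real (card ?B)"
  proof -
    have "card ?B' \<le> card ?B" using finB by (intro card_mono) auto
    then show ?thesis using divmax_ge_1[OF q] by (simp add: mult_right_mono mult.commute)
  qed
  finally have main: "(real (card ?D))\<^sup>2 \<le> 2 * real (card ?D) + 2 * divmax q * real (card ?B)"
    by (simp add: card_cartesian_product power2_eq_square)
  \<comment> \<open>The term \<open>2 |D|\<close> coming from \<open>d' = d\<close> and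
    \<open>d' = - d\<close> is absorbed: it is at most \<open>|D|^2 / 2 + 2\<close>.\<close>
  have "0 \<le> (real (card ?D) - 2)\<^sup>2" by simp
  then have "4 * real (card ?D) \<le> (real (card ?D))\<^sup>2 + 4"
    by (simp add: power2_eq_square algebra_simps)
  moreover have "1 \<le> divmax q * real (card ?B)"
  proof -
    have "(0, 0) \<in> ?B" by (simp add: lball_def lnorm_def)
    then have "card ?B \<ge> 1" using finB by (metis One_nat_def Suc_leI card_gt_0_iff empty_iff)
    then show ?thesis using mult_mono[of 1 "divmax q" 1 "real (card ?B)"] divmax_ge_1[OF q] by simp
  qed
  ultimately show ?thesis using main by linarith
qed

section \<open>Fourth moment of the correlations\<close>


text \<open>For radius \<open>2 N^2\<close> the ball count is at most
  \<open>48 N^3 / q + 6 N^2 / f\<close>, with \<open>f\<close> the norm of a shortest vector. Above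
  twice the first term the second dominates, so the count is at most \<open>12 N^2 / f\<close>; the
  \<open>+ 1\<close> excludes a ball consisting of zero alone. \<open>Y = 0\<close> would force
  \<open>|X| >= q\<close> and hence a small count; \<open>X = 0\<close> would make \<open>q\<close>
  divide \<open>2 l^2 Y\<close>, a product of units. Finally \<open>f^2 >= |X| * N |Y|\<close> turns
  the squared count into a product that sums over the box up to logarithms.\<close>

lemma lball_shortest_large:
  fixes l :: int
  assumes q: "prime q" "odd q" and c: "coprime c (int q)" and N: "N > 0" "2 * N \<le> q"
    and l: "l \<in> {1..<int q}"
    and large: "real (card (lball q c (2 * l\<^sup>2) N (2 * (int N)\<^sup>2))) > 96 * real N ^ 3 / real q + 1"
  shows "\<exists>P. fst P \<in> {- 2 * (int N)\<^sup>2..2 * (int N)\<^sup>2} - {0} \<and> snd P \<in> {- 2 * int N..2 * int N} - {0}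
    \<and> [c * fst P = 2 * l\<^sup>2 * snd P] (mod int q)
    \<and> (real (card (lball q c (2 * l\<^sup>2) N (2 * (int N)\<^sup>2))))\<^sup>2
       \<le> 144 * real N ^ 3 * (1 / (\<bar>real_of_int (fst P)\<bar> * \<bar>real_of_int (snd P)\<bar>))"
proof -
  let ?B = "lball q c (2 * l\<^sup>2) N (2 * (int N)\<^sup>2)"
  have q0: "q > 0" using q(1) prime_gt_0_nat by blast
  have "?B \<noteq> {(0, 0)}"
  proof
    assume "?B = {(0, 0)}"
    then have "real (card ?B) = 1" by simp
    moreover have "96 * real N ^ 3 / real q \<ge> 0" by simp
    ultimately show False using large by linarith
  qed
  from card_lball_le_shortest[OF q0 N(1) c this] obtain P where
    P: "P \<in> ?B" and pos: "lnorm N P > 0" and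
    "real (card ?B) \<le> 12 * (real_of_int (2 * (int N)\<^sup>2))\<^sup>2 / (real N * real q)
        + 3 * real_of_int (2 * (int N)\<^sup>2) / real_of_int (lnorm N P)"
    by auto
  moreover have "12 * (real_of_int (2 * (int N)\<^sup>2))\<^sup>2 / (real N * real q) = 48 * real N ^ 3 / real q"
    using N by (simp add: power2_eq_square power3_eq_cube field_simps)
  ultimately have "real (card ?B) \<le> 48 * real N ^ 3 / real q + 6 * (real N)\<^sup>2 / real_of_int (lnorm N P)"
    by simp
  then have G: "real (card ?B) \<le> 12 * (real N)\<^sup>2 / real_of_int (lnorm N P)"
    using large by simp
  obtain X Y where XY: "P = (X, Y)" by fastforce
  have cong: "[c * X = 2 * l\<^sup>2 * Y] (mod int q)" and Xle: "\<bar>X\<bar> \<le> 2 * (int N)\<^sup>2"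
    and "int N * \<bar>Y\<bar> \<le> 2 * (int N)\<^sup>2"
    using P XY by (auto simp: lball_def lnorm_def)
  then have "int N * \<bar>Y\<bar> \<le> int N * (2 * int N)" by (simp add: power2_eq_square)
  then have Yle: "\<bar>Y\<bar> \<le> 2 * int N" using N by simp
  have "2 * N \<noteq> q" using q(2) by auto
  then have Nq: "2 * int N < int q" using N by linarith
  have "Y \<noteq> 0"
  proof
    assume Y: "Y = 0"
    then have "int q dvd c * X" using cong by (simp add: cong_0_iff)
    then have "int q dvd X" using c by (simp add: coprime_dvd_mult_right_iff coprime_commute)
    moreover have "X \<noteq> 0" using pos XY Y by (auto simp: lnorm_def)
    ultimately have "int q \<le> \<bar>X\<bar>" using dvd_imp_le_int[of X "int q"] by simp
    then have "int q \<le> lnorm N P" using XY by (simp add: lnorm_def)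
    then have "real q \<le> real_of_int (lnorm N P)" by linarith
    then have "12 * (real N)\<^sup>2 / real_of_int (lnorm N P) \<le> 12 * (real N)\<^sup>2 / real q"
      using q0 by (intro divide_left_mono) auto
    also have "\<dots> \<le> 12 * real N ^ 3 / real q"
      using N by (intro divide_right_mono mult_left_mono power_increasing) auto
    also have "\<dots> \<le> 96 * real N ^ 3 / real q"
      by (intro divide_right_mono mult_right_mono) auto
    finally show False using G large by linarith
  qed
  moreover have qY: "\<not> int q dvd Y"
  proof
    assume "int q dvd Y"
    from dvd_imp_le_int[OF \<open>Y \<noteq> 0\<close> this] show False using Yle Nq by linarith
  qed
  moreover have "X \<noteq> 0"
  proof
    assume "X = 0"
    then have "int q dvd 2 * l\<^sup>2 * Y" using cong_sym[OF cong] by (simp add: cong_0_iff)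
    then have "int q dvd 2 \<or> int q dvd l"
      using qY prime_int_dvd_mult_iff[OF q(1)] unfolding power2_eq_square by blast
    moreover have "\<not> int q dvd 2"
    proof
      assume "int q dvd 2"
      from zdvd_imp_le[OF this] have "q = 2" using prime_ge_2_nat[OF q(1)] by simp
      then show False using q(2) by simp
    qed
    ultimately show False using not_dvd_residue[OF l] by blast
  qed
  moreover have "(real (card ?B))\<^sup>2 \<le> 144 * real N ^ 3 * (1 / (\<bar>real_of_int X\<bar> * \<bar>real_of_int Y\<bar>))"
  proof -
    let ?f = "real_of_int (lnorm N P)"
    have f0: "?f > 0" using pos by simp
    have "\<bar>X\<bar> \<le> lnorm N P" "int N * \<bar>Y\<bar> \<le> lnorm N P" using XY by (auto simp: lnorm_def)
    then have "real_of_int \<bar>X\<bar> \<le> ?f" "real_of_int (int N * \<bar>Y\<bar>) \<le> ?f"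
      by (simp_all only: of_int_le_iff)
    then have fXY: "\<bar>real_of_int X\<bar> \<le> ?f" "real N * \<bar>real_of_int Y\<bar> \<le> ?f" by simp_all
    have "(real (card ?B))\<^sup>2 \<le> (12 * (real N)\<^sup>2 / ?f)\<^sup>2" using G by (intro power_mono) auto
    also have "\<dots> = 144 * real N ^ 4 / (?f * ?f)"
      by (simp add: power_divide power_mult_distrib power2_eq_square power4_eq_xxxx mult_ac)
    also have "\<dots> \<le> 144 * real N ^ 4 / (\<bar>real_of_int X\<bar> * (real N * \<bar>real_of_int Y\<bar>))"
      using fXY f0 \<open>X \<noteq> 0\<close> \<open>Y \<noteq> 0\<close> N by (intro divide_left_mono mult_mono) auto
    also have "\<dots> = 144 * real N ^ 3 * (1 / (\<bar>real_of_int X\<bar> * \<bar>real_of_int Y\<bar>))"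
      using N by (simp add: power4_eq_xxxx power3_eq_cube)
    finally show ?thesis .
  qed
  ultimately show ?thesis using cong Xle Yle XY by (intro exI[of _ P]) auto
qed

lemma sum_inverse_abs_le:
  fixes n :: nat
  assumes "n \<le> q\<^sup>2"
  shows "(\<Sum>x\<in>{- int n..int n} - {0}. 1 / \<bar>real_of_int x\<bar>) \<le> 2 * logsum q"
proof -
  have "{- int n..int n} - {0} = int ` {1..n} \<union> (\<lambda>k. - int k) ` {1..n}"
  proof (rule Set.set_eqI, rule iffI)
    fix x assume "x \<in> {- int n..int n} - {0}"
    then have "nat \<bar>x\<bar> \<in> {1..n}" "x = int (nat \<bar>x\<bar>) \<or> x = - int (nat \<bar>x\<bar>)" by auto
    then show "x \<in> int ` {1..n} \<union> (\<lambda>k. - int k) ` {1..n}" by blast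
  qed auto
  then have "(\<Sum>x\<in>{- int n..int n} - {0}. 1 / \<bar>real_of_int x\<bar>)
      = (\<Sum>x\<in>int ` {1..n}. 1 / \<bar>real_of_int x\<bar>) + (\<Sum>x\<in>(\<lambda>k. - int k) ` {1..n}. 1 / \<bar>real_of_int x\<bar>)"
    by (simp only:) (intro sum.union_disjoint; auto)
  also have "\<dots> = 2 * (\<Sum>k = 1..n. 1 / real k)"
    by (simp add: sum.reindex inj_on_def)
  also have "\<dots> \<le> 2 * logsum q" using sum_inverse_le_logsum[OF assms] by simp
  finally show ?thesis .
qed

lemma sum_le_two_to_one:
  fixes g :: "'b \<Rightarrow> real"
  assumes "finite A" "finite B" "f ` A \<subseteq> B" and g: "\<And>y. y \<in> B \<Longrightarrow> g y \<ge> 0"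
    and two: "\<And>y. card {x \<in> A. f x = y} \<le> 2"
  shows "(\<Sum>x\<in>A. g (f x)) \<le> 2 * (\<Sum>y\<in>B. g y)"
proof -
  have "(\<Sum>x\<in>A. g (f x)) = (\<Sum>y\<in>B. \<Sum>x\<in>{x \<in> A. f x = y}. g (f x))"
    using assms(1-3) by (rule sum.group[symmetric])
  also have "\<dots> = (\<Sum>y\<in>B. real (card {x \<in> A. f x = y}) * g y)"
    by (intro sum.cong refl) simp
  also have "\<dots> \<le> (\<Sum>y\<in>B. 2 * g y)"
    using two g by (intro sum_mono mult_right_mono) auto
  finally show ?thesis by (simp add: sum_distrib_left)
qed

lemma powr_three_halves_le:
  fixes y :: real
  assumes "y \<ge> 0"
  shows "(96 * y + 1) powr (3/2) \<le> 1000 * (1 + y powr (3/2))"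
proof -
  have "(96 * y + 1) powr (3/2) \<le> (97 * max y 1) powr (3/2)"
    using assms by (intro powr_mono2) auto
  also have "\<dots> = 97 powr (3/2) * max y 1 powr (3/2)" by (simp add: powr_mult)
  also have "\<dots> \<le> 1000 * (1 + y powr (3/2))"
  proof (rule mult_mono)
    have "(97 :: real) powr (3/2) \<le> 100 powr (3/2)" by (intro powr_mono2) auto
    also have "(100 :: real) powr (3/2) = (10 powr 2) powr (3/2)" by simp
    also have "\<dots> = 10 powr 3" unfolding powr_powr by simp
    also have "\<dots> = 1000" by simp
    finally show "(97 :: real) powr (3/2) \<le> 1000" .
    show "max y 1 powr (3/2) \<le> 1 + y powr (3/2)" by (auto simp: max_def)
  qed auto
  finally show ?thesis .
qed

text \<open>Where the lattice ball is small, \<open>r^3\<close> is bounded pointwise and the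
  remaining factor \<open>r\<close> has sum at most \<open>4 N^2\<close>. Where it is large,
  \<open>r^4\<close> is controlled by the squared ball count, and the shortest vectors, one for each
  \<open>l\<close>, are summed over the whole box with weight \<open>1 / (|X| |Y|)\<close>.\<close>

lemma sum_corr_fourth_power_le:
  assumes q: "prime q" "odd q" and c: "coprime c (int q)" and N: "N > 0" "2 * N \<le> q"
  shows "(\<Sum>l\<in>{1..<int q}. (corr q (dyad_roots q c N) (\<lambda>_. 1) l) ^ 4)
     \<le> 400000 * (divmax q)\<^sup>2 * (logsum q)\<^sup>2 * (real N ^ 3 + (real N)\<^sup>2 * (real N ^ 3 / real q) powr (3/2))"
proof -
  have q0: "q > 0" using q(1) prime_gt_0_nat by blast
  let ?V = "dyad_roots q c N" and ?R = "{1..<int q}"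
  define D where "D = divmax q"
  define L where "L = logsum q"
  define y where "y = real N ^ 3 / real q"
  define r where "r l = corr q ?V (\<lambda>_. 1) l" for l
  define G where "G l = real (card (lball q c (2 * l\<^sup>2) N (2 * (int N)\<^sup>2)))" for l
  have D: "D \<ge> 1" and L: "L \<ge> 1" using divmax_ge_1 logsum_ge_1 q0 by (auto simp: D_def L_def)
  have y: "y \<ge> 0" by (simp add: y_def)
  have r0: "r l \<ge> 0" for l unfolding r_def by (rule corr_nonneg) simp
  have r2: "(r l)\<^sup>2 \<le> 8 * D * G l" if "l \<in> ?R" for l
  proof -
    have "(r l)\<^sup>2 \<le> (real (card (gap_set q c N l)))\<^sup>2"
      using corr_le_card_gap_set[OF q that, of c N] r0 unfolding r_def by (intro power_mono) auto
    also have "\<dots> \<le> 8 * D * G l"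
      unfolding D_def G_def using N by (intro card_gap_set_square_le[OF q0 c]) auto
    finally show ?thesis .
  qed
  have sum_r: "(\<Sum>l\<in>?R. r l) \<le> 4 * (real N)\<^sup>2"
  proof -
    have "(\<Sum>l\<in>?R. r l) \<le> (\<Sum>l\<in>{0..<int q}. r l)" using r0 by (intro sum_mono2) auto
    also have "\<dots> = (real (card ?V))\<^sup>2" unfolding r_def using sum_corr[OF q0, of ?V] by simp
    also have "\<dots> \<le> (2 * real N)\<^sup>2"
      using card_dyad_roots_le[OF q(1) c N(2)] by (intro power_mono) auto
    finally show ?thesis by (simp add: power_mult_distrib)
  qed
  define good where "good = {l \<in> ?R. G l \<le> 96 * y + 1}"
  define bad where "bad = {l \<in> ?R. G l > 96 * y + 1}"
  have split: "?R = good \<union> bad" "good \<inter> bad = {}"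
    by (auto simp: good_def bad_def)
  have fin: "finite good" "finite bad"
    by (rule finite_subset[of _ ?R], use split(1) in blast, simp)+
  have "(\<Sum>l\<in>good. (r l) ^ 4) \<le> (\<Sum>l\<in>good. r l * (64 * D\<^sup>2 * (1000 * (1 + y powr (3/2)))))"
  proof (rule sum_mono)
    fix l assume "l \<in> good"
    then have l: "l \<in> ?R" "G l \<le> 96 * y + 1" by (auto simp: good_def)
    have "(r l) ^ 3 = ((r l)\<^sup>2) powr (3/2)"
    proof -
      have "((r l)\<^sup>2) powr (3/2) = (r l powr 2) powr (3/2)" using r0[of l] by simp
      also have "\<dots> = r l powr 3" unfolding powr_powr by simp
      also have "\<dots> = (r l) ^ 3" using r0[of l] by simp
      finally show ?thesis ..
    qed
    also have "\<dots> \<le> (8 * D * (96 * y + 1)) powr (3/2)"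
    proof (rule powr_mono2)
      have "8 * D * G l \<le> 8 * D * (96 * y + 1)" using l D by (intro mult_left_mono) auto
      then show "(r l)\<^sup>2 \<le> 8 * D * (96 * y + 1)" using r2[OF l(1)] by linarith
    qed auto
    also have "\<dots> = (8 * D) powr (3/2) * (96 * y + 1) powr (3/2)"
      using D y by (simp add: powr_mult)
    \<comment> \<open>Since \<open>8 D >= 1\<close>, the exponent 3/2 may be rounded up to 2,
      matching the power of \<open>D\<close> in the other part.\<close>
    also have "\<dots> \<le> (8 * D) powr 2 * (1000 * (1 + y powr (3/2)))"
      using D powr_three_halves_le[OF y] by (intro mult_mono powr_mono) auto
    also have "(8 * D) powr 2 = 64 * D\<^sup>2" using D by (simp add: power_mult_distrib)
    finally have "r l * (r l) ^ 3 \<le> r l * (64 * D\<^sup>2 * (1000 * (1 + y powr (3/2))))"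
      by (intro mult_left_mono r0)
    then show "(r l) ^ 4 \<le> r l * (64 * D\<^sup>2 * (1000 * (1 + y powr (3/2))))"
      by (simp add: power3_eq_cube power4_eq_xxxx mult.assoc)
  qed
  also have "\<dots> = (\<Sum>l\<in>good. r l) * (64 * D\<^sup>2 * (1000 * (1 + y powr (3/2))))"
    by (simp add: sum_distrib_right)
  also have "\<dots> \<le> (4 * (real N)\<^sup>2) * (64 * D\<^sup>2 * (1000 * (1 + y powr (3/2))))"
  proof (rule mult_right_mono)
    have "(\<Sum>l\<in>good. r l) \<le> (\<Sum>l\<in>?R. r l)" using r0 by (intro sum_mono2) (auto simp: good_def)
    then show "(\<Sum>l\<in>good. r l) \<le> 4 * (real N)\<^sup>2" using sum_r by linarith
  qed auto
  also have "\<dots> = 256000 * D\<^sup>2 * ((real N)\<^sup>2 + (real N)\<^sup>2 * y powr (3/2))"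
    by (simp add: algebra_simps)
  also have "\<dots> \<le> 256000 * D\<^sup>2 * (real N ^ 3 + (real N)\<^sup>2 * y powr (3/2))"
    using N by (intro mult_left_mono add_mono power_increasing) auto
  finally have goodsum: "(\<Sum>l\<in>good. (r l) ^ 4) \<le> 256000 * D\<^sup>2 * (real N ^ 3 + (real N)\<^sup>2 * y powr (3/2))" .

  define BX where "BX = {- int (2 * N\<^sup>2)..int (2 * N\<^sup>2)} - {0}"
  define BY where "BY = {- int (2 * N)..int (2 * N)} - {0}"
  define g where "g P = 1 / (\<bar>real_of_int (fst P)\<bar> * \<bar>real_of_int (snd P)\<bar>)" for P :: "int \<times> int"
  have "\<forall>l\<in>bad. \<exists>P. fst P \<in> BX \<and> snd P \<in> BY \<and> [c * fst P = 2 * l\<^sup>2 * snd P] (mod int q)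
      \<and> (G l)\<^sup>2 \<le> 144 * real N ^ 3 * g P"
    using lball_shortest_large[OF q c N]
    unfolding bad_def BX_def BY_def g_def G_def y_def by auto
  then obtain P where P: "\<And>l. l \<in> bad \<Longrightarrow> fst (P l) \<in> BX" "\<And>l. l \<in> bad \<Longrightarrow> snd (P l) \<in> BY"
    "\<And>l. l \<in> bad \<Longrightarrow> [c * fst (P l) = 2 * l\<^sup>2 * snd (P l)] (mod int q)"
    "\<And>l. l \<in> bad \<Longrightarrow> (G l)\<^sup>2 \<le> 144 * real N ^ 3 * g (P l)"
    using that unfolding bchoice_iff by blast
  have "(\<Sum>l\<in>bad. (r l) ^ 4) \<le> (\<Sum>l\<in>bad. 9216 * D\<^sup>2 * real N ^ 3 * g (P l))"
  proof (rule sum_mono)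
    fix l assume l: "l \<in> bad"
    have "(r l) ^ 4 = ((r l)\<^sup>2)\<^sup>2" by simp
    also have "\<dots> \<le> (8 * D * G l)\<^sup>2" using r2 l by (intro power_mono) (auto simp: bad_def)
    also have "\<dots> = 64 * D\<^sup>2 * (G l)\<^sup>2" by (simp add: power_mult_distrib)
    also have "\<dots> \<le> 64 * D\<^sup>2 * (144 * real N ^ 3 * g (P l))" using P(4)[OF l] by (intro mult_left_mono) auto
    finally show "(r l) ^ 4 \<le> 9216 * D\<^sup>2 * real N ^ 3 * g (P l)" by simp
  qed
  also have "\<dots> = 9216 * D\<^sup>2 * real N ^ 3 * (\<Sum>l\<in>bad. g (P l))" by (simp add: sum_distrib_left)
  finally have badsum1: "(\<Sum>l\<in>bad. (r l) ^ 4) \<le> 9216 * D\<^sup>2 * real N ^ 3 * (\<Sum>l\<in>bad. g (P l))" .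
  \<comment> \<open>The vector \<open>P l\<close> determines \<open>l^2\<close> modulo
    \<open>q\<close>, because twice its second coordinate is a unit; so at most two \<open>l\<close>
    share a vector.\<close>
  have to_box: "(\<Sum>l\<in>bad. g (P l)) \<le> 2 * (\<Sum>p\<in>BX \<times> BY. g p)"
  proof (rule sum_le_two_to_one)
    fix p
    show "card {l \<in> bad. P l = p} \<le> 2"
    proof (rule card_square_class_le_2[OF q(1)])
      fix v w assume v: "v \<in> {l \<in> bad. P l = p}" and w: "w \<in> {l \<in> bad. P l = p}"
      have "snd p \<in> BY" using v P(2) by auto
      moreover have "2 * N \<noteq> q" using q(2) by auto
      ultimately have p: "snd p \<noteq> 0" "\<bar>snd p\<bar> < int q" using N by (auto simp: BY_def)
      have "\<not> int q dvd snd p"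
      proof
        assume "int q dvd snd p"
        from dvd_imp_le_int[OF p(1) this] show False using p(2) by linarith
      qed
      then have "coprime (2 * snd p) (int q)"
        using q prime_imp_coprime[of "int q" "snd p"] by (simp add: coprime_commute)
      moreover have "[2 * v\<^sup>2 * snd p = 2 * w\<^sup>2 * snd p] (mod int q)"
        using P(3)[of v] P(3)[of w] v w by (auto intro: cong_trans cong_sym)
      then have "[(2 * snd p) * v\<^sup>2 = (2 * snd p) * w\<^sup>2] (mod int q)" by (simp add: mult_ac)
      ultimately show "[v\<^sup>2 = w\<^sup>2] (mod int q)" by (simp only: cong_mult_lcancel)
    qed (auto simp: bad_def)
    show "P ` bad \<subseteq> BX \<times> BY"
      by (rule image_subsetI) (simp add: mem_Times_iff P(1,2))
  qed (auto simp: BX_def BY_def g_def fin)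
  have "(\<Sum>p\<in>BX \<times> BY. g p) = (\<Sum>x\<in>BX. 1 / \<bar>real_of_int x\<bar>) * (\<Sum>y\<in>BY. 1 / \<bar>real_of_int y\<bar>)"
    by (simp add: g_def sum_product sum.cartesian_product case_prod_unfold)
  also have "\<dots> \<le> (2 * L) * (2 * L)"
  proof (rule mult_mono)
    have "(2 * N)\<^sup>2 \<le> q\<^sup>2" using N by (intro power_mono) auto
    then have "2 * N\<^sup>2 \<le> q\<^sup>2" by (simp add: power_mult_distrib)
    then show "(\<Sum>x\<in>BX. 1 / \<bar>real_of_int x\<bar>) \<le> 2 * L"
      unfolding BX_def L_def by (rule sum_inverse_abs_le)
    have "2 * N \<le> q\<^sup>2" using N q0 by (simp add: power2_eq_square) (metis le_square le_trans)
    then show "(\<Sum>y\<in>BY. 1 / \<bar>real_of_int y\<bar>) \<le> 2 * L"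
      unfolding BY_def L_def by (rule sum_inverse_abs_le)
  qed (use L in \<open>auto intro: sum_nonneg\<close>)
  finally have "(\<Sum>l\<in>bad. g (P l)) \<le> 8 * L\<^sup>2" using to_box by (simp add: power2_eq_square)
  then have "9216 * D\<^sup>2 * real N ^ 3 * (\<Sum>l\<in>bad. g (P l)) \<le> 9216 * D\<^sup>2 * real N ^ 3 * (8 * L\<^sup>2)"
    by (intro mult_left_mono) auto
  then have "(\<Sum>l\<in>bad. (r l) ^ 4) \<le> 73728 * D\<^sup>2 * L\<^sup>2 * real N ^ 3"
    using badsum1 by (simp add: mult_ac)
  also have "\<dots> \<le> 73728 * D\<^sup>2 * L\<^sup>2 * (real N ^ 3 + (real N)\<^sup>2 * y powr (3/2))"
    by (intro mult_left_mono) auto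
  finally have badsum: "(\<Sum>l\<in>bad. (r l) ^ 4)
      \<le> 73728 * D\<^sup>2 * L\<^sup>2 * (real N ^ 3 + (real N)\<^sup>2 * y powr (3/2))" .
  have "256000 * D\<^sup>2 * (real N ^ 3 + (real N)\<^sup>2 * y powr (3/2))
      \<le> 256000 * D\<^sup>2 * L\<^sup>2 * (real N ^ 3 + (real N)\<^sup>2 * y powr (3/2))"
    using L mult_left_mono[of 1 "L\<^sup>2" "256000 * D\<^sup>2"] by (intro mult_right_mono) auto
  moreover have "(\<Sum>l\<in>?R. (r l) ^ 4) = (\<Sum>l\<in>good. (r l) ^ 4) + (\<Sum>l\<in>bad. (r l) ^ 4)"
    using split fin by (metis sum.union_disjoint)
  moreover have "0 \<le> D\<^sup>2 * L\<^sup>2 * (real N ^ 3 + (real N)\<^sup>2 * y powr (3/2))"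
    by (intro mult_nonneg_nonneg add_nonneg_nonneg) auto
  \<comment> \<open>The small balls contribute \<open>256000 = 4 * 64 * 1000\<close>, the large ones
    \<open>73728 = 64 * 144 * 8\<close>.\<close>
  ultimately have "(\<Sum>l\<in>?R. (r l) ^ 4) \<le> 400000 * D\<^sup>2 * L\<^sup>2 * (real N ^ 3 + (real N)\<^sup>2 * y powr (3/2))"
    using goodsum badsum unfolding mult.assoc by linarith
  then show ?thesis unfolding r_def D_def L_def y_def .
qed

section \<open>Pointwise bound via Weyl sums\<close>


text \<open>Bounds the geometric sum of frequency \<open>t\<close> over any interval, for
  \<open>t\<close> nonzero modulo \<open>q\<close>. At multiples of \<open>q\<close> the convention
  \<open>2 / 0 = 0\<close> makes it vanish, so it is no bound there and the frequency has to be
  checked at each use.\<close>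

definition gker :: "nat \<Rightarrow> int \<Rightarrow> real" where
  "gker q t = 2 / cmod (1 - eq q t)"

lemma gker_cong: "[s = t] (mod int q) \<Longrightarrow> gker q s = gker q t"
  unfolding gker_def by (simp add: eq_cong[of s t])

lemma gker_minus: "gker q (- t) = gker q t"
proof -
  have "cmod (1 - eq q (- t)) = cmod (cnj (1 - eq q t))" by (simp add: cnj_eq)
  then show ?thesis unfolding gker_def complex_mod_cnj by simp
qed

lemma gker_nonneg: "gker q t \<ge> 0"
  by (simp add: gker_def)

lemma norm_1_minus_cis: "cmod (1 - cis t) = 2 * \<bar>sin (t / 2)\<bar>"
proof -
  have "(cmod (1 - cis t))\<^sup>2 = (1 - cos t)\<^sup>2 + (sin t)\<^sup>2"
    by (simp add: cmod_power2)
  also have "\<dots> = 2 - 2 * cos t"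
    using sin_cos_squared_add[of t] by (simp add: power2_eq_square algebra_simps)
  also have "\<dots> = (2 * \<bar>sin (t / 2)\<bar>)\<^sup>2"
    using cos_double_sin[of "t / 2"] by (simp add: power_mult_distrib)
  finally show ?thesis by (rule power2_eq_imp_eq) auto
qed

text \<open>From \<open>sin x >= x - x^3 / 6\<close> and \<open>x^2 <= 1.6^2 < 3\<close>.\<close>

lemma sin_ge_half:
  fixes x :: real
  assumes "0 \<le> x" "x \<le> pi / 2"
  shows "sin x \<ge> x / 2"
proof -
  have "x \<le> 1.6" using assms pi_approx by simp
  then have "x * x \<le> 1.6 * 1.6" using assms by (intro mult_mono) auto
  then have "x * (x * x) \<le> x * 3" using assms by (intro mult_left_mono) auto
  moreover have "\<bar>sin x - (\<Sum>k<3. sin_coeff k * x ^ k)\<bar> \<le> inverse (fact 3) * \<bar>x\<bar> ^ 3"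
    by (rule Maclaurin_sin_bound)
  then have "\<bar>sin x - x\<bar> \<le> x ^ 3 / 6"
    using assms by (simp add: sin_coeff_def eval_nat_numeral)
  then have "x - sin x \<le> x * (x * x) / 6" unfolding power3_eq_cube mult.assoc abs_le_iff by linarith
  ultimately show ?thesis by linarith
qed

text \<open>For \<open>m <= q / 2\<close> the denominator is
  \<open>2 sin (pi m / q) >= pi m / q >= 2 m / q\<close>; the other half follows by the symmetry
  \<open>m -> q - m\<close>. Adding the two cases gives a bound whose sum over \<open>m\<close> is
  directly two harmonic sums.\<close>

lemma gker_le:
  assumes "m \<in> {1..<q}"
  shows "gker q (int m) \<le> real q / real m + real q / real (q - m)"
proof -
  have half: "gker q (int m) \<le> real q / real m" if m: "0 < m" "2 * m \<le> q" for m
  proof -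
    have q0: "real q > 0" using m by simp
    have x: "0 \<le> pi * real m / real q" "pi * real m / real q \<le> pi / 2"
      using m q0 by (auto simp: field_simps)
    have "cmod (1 - eq q (int m)) = 2 * \<bar>sin (pi * real m / real q)\<bar>"
      unfolding eq_eq_cis norm_1_minus_cis by (simp add: mult.assoc)
    moreover have "sin (pi * real m / real q) \<ge> (pi * real m / real q) / 2"
      using sin_ge_half[OF x] .
    moreover have "1 * (real m / real q) \<le> pi / 2 * (real m / real q)"
      using pi_ge_two by (intro mult_right_mono) auto
    ultimately have "2 * (real m / real q) \<le> cmod (1 - eq q (int m))" by simp
    then have "2 / cmod (1 - eq q (int m)) \<le> 2 / (2 * (real m / real q))"
      using m q0 by (intro frac_le) auto
    then show ?thesis by (simp add: gker_def)
  qed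
  show ?thesis
  proof (cases "2 * m \<le> q")
    case True
    then show ?thesis using half[of m] assms by (simp add: add_increasing2)
  next
    case False
    have "[int m = - int (q - m)] (mod int q)"
      using assms by (simp add: cong_iff_dvd_diff of_nat_diff)
    then have "gker q (int m) = gker q (int (q - m))"
      using gker_cong gker_minus by metis
    then show ?thesis using half[of "q - m"] assms False by (simp add: add_increasing)
  qed
qed

lemma sum_gker_le:
  assumes "q > 0"
  shows "(\<Sum>m\<in>{1..<q}. gker q (int m)) \<le> 2 * real q * logsum q"
proof -
  have "q - 1 \<le> q\<^sup>2" using assms by (simp add: power2_eq_square) (metis diff_le_self le_square le_trans)
  moreover have "{1..<q} = {1..q - 1}" using assms by auto
  ultimately have L: "(\<Sum>m\<in>{1..<q}. 1 / real m) \<le> logsum q" using sum_inverse_le_logsum by metis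
  have "(\<Sum>m\<in>{1..<q}. gker q (int m)) \<le> (\<Sum>m\<in>{1..<q}. real q * (1 / real m) + real q * (1 / real (q - m)))"
    using gker_le by (intro sum_mono) simp
  also have "\<dots> = real q * (\<Sum>m\<in>{1..<q}. 1 / real m) + real q * (\<Sum>m\<in>{1..<q}. 1 / real (q - m))"
    by (simp only: sum.distrib sum_distrib_left)
  also have "(\<Sum>m\<in>{1..<q}. 1 / real (q - m)) = (\<Sum>m\<in>{1..<q}. 1 / real m)"
    by (rule sum.reindex_bij_witness[of _ "\<lambda>m. q - m" "\<lambda>m. q - m"]) auto
  also have "real q * (\<Sum>m\<in>{1..<q}. 1 / real m) + real q * (\<Sum>m\<in>{1..<q}. 1 / real m)
      \<le> real q * logsum q + real q * logsum q"
    using L by (intro add_mono mult_left_mono) auto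
  finally show ?thesis by (simp add: mult_ac)
qed

text \<open>Multiplication by a unit permutes the nonzero residues.\<close>

lemma sum_gker_mult_le:
  assumes q: "prime q" and a: "coprime a (int q)"
  shows "(\<Sum>m\<in>{1..<q}. gker q (a * int m)) \<le> 2 * real q * logsum q"
proof -
  have q0: "q > 0" using q prime_gt_0_nat by blast
  define \<phi> where "\<phi> m = nat ((a * int m) mod int q)" for m
  have \<phi>: "int (\<phi> m) = (a * int m) mod int q" for m using q0 by (simp add: \<phi>_def)
  have into: "\<phi> ` {1..<q} \<subseteq> {1..<q}"
  proof (rule image_subsetI)
    fix m assume m: "m \<in> {1..<q}"
    have "\<not> int q dvd a * int m"
      using a m not_dvd_residue[of "int m" q] by (auto simp: coprime_dvd_mult_right_iff coprime_commute)
    then have "int (\<phi> m) \<noteq> 0" unfolding \<phi> by (simp add: dvd_eq_mod_eq_0)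
    moreover have "int (\<phi> m) < int q" unfolding \<phi> using q0 by simp
    ultimately show "\<phi> m \<in> {1..<q}" by simp
  qed
  have inj: "inj_on \<phi> {1..<q}"
  proof (rule inj_onI)
    fix m n assume mn: "m \<in> {1..<q}" "n \<in> {1..<q}" and "\<phi> m = \<phi> n"
    then have "int (\<phi> m) = int (\<phi> n)" by simp
    then have "[a * int m = a * int n] (mod int q)" unfolding \<phi> by (simp add: cong_def)
    then have "[int m = int n] (mod int q)" using a by (simp only: cong_mult_lcancel)
    then show "m = n" using mn residues_eqI[of "int m" "int n" q] by auto
  qed
  have "\<phi> ` {1..<q} = {1..<q}" by (rule endo_inj_surj[OF _ into inj]) simp
  then have "(\<Sum>m\<in>{1..<q}. gker q (int m)) = (\<Sum>m\<in>{1..<q}. gker q (int (\<phi> m)))"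
    using sum.reindex[OF inj, of "\<lambda>m. gker q (int m)"] by (simp add: o_def)
  also have "\<dots> = (\<Sum>m\<in>{1..<q}. gker q (a * int m))"
    unfolding \<phi> by (intro sum.cong refl gker_cong) (simp add: cong_def)
  finally show ?thesis using sum_gker_le[OF q0] by simp
qed

text \<open>A given \<open>m\<close> is a product \<open>k h\<close> in at most
  \<open>ndiv m\<close> ways, and \<open>K H < q\<close> keeps all products among the
  representatives of the nonzero residues.\<close>

lemma sum_products_le_divmax:
  fixes G :: "nat \<Rightarrow> real"
  assumes G: "\<And>m. G m \<ge> 0" and KH: "K * H < q"
  shows "(\<Sum>k\<in>{1..K}. \<Sum>h\<in>{1..H}. G (k * h)) \<le> divmax q * (\<Sum>m\<in>{1..<q}. G m)"
proof -
  let ?A = "{1..K} \<times> {1..H}"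
  have "(\<Sum>k\<in>{1..K}. \<Sum>h\<in>{1..H}. G (k * h)) = (\<Sum>p\<in>?A. G (fst p * snd p))"
    by (simp add: sum.cartesian_product case_prod_unfold)
  also have "\<dots> = (\<Sum>m\<in>{1..<q}. \<Sum>p\<in>{p \<in> ?A. fst p * snd p = m}. G (fst p * snd p))"
  proof (rule sum.group[symmetric])
    show "(\<lambda>p. fst p * snd p) ` ?A \<subseteq> {1..<q}"
    proof (rule image_subsetI)
      fix p assume p: "p \<in> ?A"
      then have "fst p * snd p \<le> K * H" by (intro mult_mono) auto
      then show "fst p * snd p \<in> {1..<q}" using p KH by (auto simp: Suc_le_eq)
    qed
  qed auto
  also have "\<dots> = (\<Sum>m\<in>{1..<q}. real (card {p \<in> ?A. fst p * snd p = m}) * G m)"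
    by (intro sum.cong refl) simp
  also have "\<dots> \<le> (\<Sum>m\<in>{1..<q}. divmax q * G m)"
  proof (intro sum_mono mult_right_mono G)
    fix m assume m: "m \<in> {1..<q}"
    have "card {p \<in> ?A. fst p * snd p = m} \<le> card {d. d dvd m}"
    proof (rule card_inj_on_le[of fst])
      show "inj_on fst {p \<in> ?A. fst p * snd p = m}"
        by (rule inj_onI) (auto simp: prod_eq_iff)
      show "finite {d. d dvd m}" using m by (intro finite_divisors_nat) auto
    qed auto
    also have "real (card {d. d dvd m}) \<le> divmax q"
      using m ndiv_le_divmax[of m q] self_le_power[of q 2] unfolding ndiv_def
      by (auto simp: power2_eq_square intro: le_trans[OF less_imp_le_nat le_square])
    finally show "real (card {p \<in> ?A. fst p * snd p = m}) \<le> divmax q" by simp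
  qed
  finally show ?thesis by (simp add: sum_distrib_left)
qed

section \<open>Quadratic Weyl sums and detection by a Fejer kernel\<close>

definition weyl :: "nat \<Rightarrow> int \<Rightarrow> nat \<Rightarrow> int \<Rightarrow> complex" where
  "weyl q A N k = (\<Sum>d\<in>{1 - int N..<int N}. eq q (k * A * d\<^sup>2))"

lemma weyl_minus: "cmod (weyl q A N (- k)) = cmod (weyl q A N k)"
proof -
  have "weyl q A N (- k) = cnj (weyl q A N k)" by (simp add: weyl_def cnj_eq)
  then show ?thesis by simp
qed

lemma weyl_0: "N > 0 \<Longrightarrow> cmod (weyl q A N 0) \<le> 2 * real N"
  unfolding weyl_def by (rule order_trans[OF norm_sum]) (simp add: nat_diff_distrib)

text \<open>Weyl differencing: with \<open>d + h\<close> and \<open>d\<close> as the variables of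
  the opened square the quadratic terms in \<open>d\<close> cancel, and the inner sum is geometric
  with frequency \<open>2 k A h\<close>.\<close>

lemma weyl_square_le:
  assumes N: "N > 0" and nz: "\<And>h. h \<in> {1..2 * N} \<Longrightarrow> eq q (2 * k * A * int h) \<noteq> 1"
  shows "(cmod (weyl q A N k))\<^sup>2 \<le> 2 * real N + 2 * (\<Sum>h\<in>{1..2 * N}. gker q (2 * k * A * int h))"
proof -
  define I where "I = {1 - int N..<int N}"
  \<comment> \<open>The interval intersected with its translate by \<open>- h\<close>. It is empty
    for \<open>|h| >= 2 N - 1\<close>, so the range \<open>H\<close> contains every shift that
    occurs.\<close>
  define J where "J h = {max (1 - int N) (1 - int N - h)..<min (int N) (int N - h)}" for h
  define H where "H = {- int (2 * N)..int (2 * N)}"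
  define T where "T h = cmod (\<Sum>d\<in>J h. eq q (d * (2 * k * A * h)))" for h
  have "complex_of_real ((cmod (weyl q A N k))\<^sup>2) = (\<Sum>d\<in>I. \<Sum>d'\<in>I. eq q (k * A * (d\<^sup>2 - d'\<^sup>2)))"
    unfolding weyl_def complex_norm_square cnj_sum sum_product I_def
    by (intro sum.cong refl) (simp add: cnj_eq right_diff_distrib flip: eq_add)
  also have "\<dots> = (\<Sum>(d, d')\<in>I \<times> I. eq q (k * A * (d\<^sup>2 - d'\<^sup>2)))"
    by (simp add: sum.cartesian_product)
  also have "\<dots> = (\<Sum>(h, d)\<in>Sigma H J. eq q (k * A * ((d + h)\<^sup>2 - d\<^sup>2)))"
    by (rule sum.reindex_bij_witness[of _ "\<lambda>(h, d). (d + h, d)" "\<lambda>(d, d'). (d - d', d')"])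
       (auto simp: I_def J_def H_def)
  also have "\<dots> = (\<Sum>h\<in>H. \<Sum>d\<in>J h. eq q (k * A * ((d + h)\<^sup>2 - d\<^sup>2)))"
    by (subst sum.Sigma) (auto simp: H_def J_def)
  also have "\<dots> = (\<Sum>h\<in>H. eq q (k * A * h\<^sup>2) * (\<Sum>d\<in>J h. eq q (d * (2 * k * A * h))))"
    unfolding sum_distrib_left
    by (intro sum.cong refl) (simp add: power2_eq_square algebra_simps flip: eq_add)
  finally have expand: "complex_of_real ((cmod (weyl q A N k))\<^sup>2)
      = (\<Sum>h\<in>H. eq q (k * A * h\<^sup>2) * (\<Sum>d\<in>J h. eq q (d * (2 * k * A * h))))" .
  have "(cmod (weyl q A N k))\<^sup>2 = cmod (complex_of_real ((cmod (weyl q A N k))\<^sup>2))"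
    unfolding norm_of_real by simp
  also have "\<dots> \<le> (\<Sum>h\<in>H. T h)"
    unfolding expand T_def by (rule order_trans[OF norm_sum]) (simp add: norm_mult)
  also have "H = insert 0 (int ` {1..2 * N} \<union> (\<lambda>h. - int h) ` {1..2 * N})"
  proof (rule Set.set_eqI, rule iffI)
    fix x assume "x \<in> H"
    then have "nat \<bar>x\<bar> \<in> {1..2 * N} \<or> x = 0" "x = int (nat \<bar>x\<bar>) \<or> x = - int (nat \<bar>x\<bar>)"
      by (auto simp: H_def)
    then show "x \<in> insert 0 (int ` {1..2 * N} \<union> (\<lambda>h. - int h) ` {1..2 * N})" by blast
  qed (auto simp: H_def)
  also have "(\<Sum>h\<in>\<dots>. T h) = T 0 + ((\<Sum>h\<in>int ` {1..2 * N}. T h) + (\<Sum>h\<in>(\<lambda>h. - int h) ` {1..2 * N}. T h))"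
    by (subst sum.insert, simp, force, subst sum.union_disjoint) auto
  also have "\<dots> = T 0 + ((\<Sum>h\<in>{1..2 * N}. T (int h)) + (\<Sum>h\<in>{1..2 * N}. T (- int h)))"
    by (simp add: sum.reindex inj_on_def)
  also have "\<dots> \<le> 2 * real N + ((\<Sum>h\<in>{1..2 * N}. gker q (2 * k * A * int h))
      + (\<Sum>h\<in>{1..2 * N}. gker q (2 * k * A * int h)))"
  proof (intro add_mono sum_mono)
    show "T 0 \<le> 2 * real N" by (simp add: T_def J_def)
    fix h assume h: "h \<in> {1..2 * N}"
    show "T (int h) \<le> gker q (2 * k * A * int h)"
      unfolding T_def J_def gker_def by (rule norm_sum_eq_interval_le[OF nz[OF h]])
    have "eq q (- (2 * k * A * int h)) \<noteq> 1"
      using nz[OF h] by (metis cnj_eq complex_cnj_cnj complex_cnj_one)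
    then have "T (- int h) \<le> gker q (- (2 * k * A * int h))"
      using norm_sum_eq_interval_le[of q "- (2 * k * A * int h)"]
      unfolding T_def J_def gker_def by simp
    then show "T (- int h) \<le> gker q (2 * k * A * int h)" by (simp only: gker_minus)
  qed
  finally show ?thesis by simp
qed

text \<open>The frequencies are \<open>2 A k h\<close> with \<open>0 < k h < q\<close>, so none
  vanishes modulo \<open>q\<close> and each residue occurs at most \<open>divmax q\<close> times.
  Averaging over \<open>k\<close> thus replaces the worst case of one Weyl sum by a sum of the
  kernel over all residues.\<close>

lemma sum_weyl_square_le:
  assumes q: "prime q" "odd q" and A: "coprime A (int q)" and N: "N > 0" "2 * N * K < q"
  shows "(\<Sum>k\<in>{1..K}. (cmod (weyl q A N (int k)))\<^sup>2) \<le> 2 * real N * real K + 4 * divmax q * real q * logsum q"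
proof -
  have q0: "q > 0" using q(1) prime_gt_0_nat by blast
  have A2: "coprime (2 * A) (int q)" using A q by (simp add: coprime_commute)
  have "(\<Sum>k\<in>{1..K}. (cmod (weyl q A N (int k)))\<^sup>2)
      \<le> (\<Sum>k\<in>{1..K}. 2 * real N + 2 * (\<Sum>h\<in>{1..2 * N}. gker q (2 * int k * A * int h)))"
  proof (rule sum_mono, rule weyl_square_le[OF N(1)])
    fix k h assume k: "k \<in> {1..K}" and h: "h \<in> {1..2 * N}"
    have "k * h \<le> K * (2 * N)" using k h by (intro mult_mono) auto
    then have "k * h < q" using N by (simp add: mult_ac)
    moreover have "k * h \<ge> 1" using k h by (simp add: Suc_le_eq)
    ultimately have "int (k * h) \<in> {1..<int q}" unfolding atLeastLessThan_iff by linarith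
    then have "\<not> int q dvd (2 * A) * int (k * h)"
      using A2 not_dvd_residue by (auto simp: coprime_dvd_mult_right_iff coprime_commute simp del: of_nat_mult)
    then show "eq q (2 * int k * A * int h) \<noteq> 1"
      using eq_eq_1_iff[OF q0] by (simp add: mult_ac)
  qed
  also have "\<dots> = 2 * real N * real K + 2 * (\<Sum>k\<in>{1..K}. \<Sum>h\<in>{1..2 * N}. gker q (2 * A * int (k * h)))"
    by (simp add: sum.distrib sum_distrib_left mult_ac)
  also have "(\<Sum>k\<in>{1..K}. \<Sum>h\<in>{1..2 * N}. gker q (2 * A * int (k * h)))
      \<le> divmax q * (\<Sum>m\<in>{1..<q}. gker q (2 * A * int m))"
    using N by (intro sum_products_le_divmax[of "\<lambda>m. gker q (2 * A * int m)"] gker_nonneg) (simp add: mult_ac)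
  also have "(\<Sum>m\<in>{1..<q}. gker q (2 * A * int m)) \<le> 2 * real q * logsum q"
    by (rule sum_gker_mult_le[OF q(1) A2])
  finally show ?thesis using divmax_ge_1[OF q0] by (simp add: mult_left_mono mult.assoc)
qed

text \<open>Dividing by the unit \<open>2 c l^2\<close> expresses \<open>s\<close> as a quadratic
  polynomial in \<open>d\<close>; membership then means that this polynomial takes a value in a
  short interval.\<close>

lemma gap_set_quadratic:
  assumes q: "prime q" "odd q" and c: "coprime c (int q)" and l: "l \<in> {1..<int q}"
  obtains A B where "coprime A (int q)"
    "\<And>d. d \<in> gap_set q c N l \<Longrightarrow> \<exists>s\<in>{2 * int N..<4 * int N}. [A * d\<^sup>2 + B = s] (mod int q)"
proof -
  have ql: "coprime l (int q)"
    using prime_imp_coprime[of "int q" l] not_dvd_residue[OF l] q by (auto simp: coprime_commute)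
  have cop: "coprime (2 * c * l\<^sup>2) (int q)" using ql c q by simp
  obtain w where w: "[2 * c * l\<^sup>2 * w = 1] (mod int q)"
    using cong_solve_coprime_int[OF cop] by blast
  have "coprime w (int q)"
    using w by (metis cong_solve_coprime_int coprime_iff_invertible_int mult.commute)
  then have "coprime (w * c\<^sup>2) (int q)" using c by simp
  moreover have "\<exists>s\<in>{2 * int N..<4 * int N}. [w * c\<^sup>2 * d\<^sup>2 + w * l ^ 4 = s] (mod int q)"
    if d: "d \<in> gap_set q c N l" for d
  proof -
    obtain s where s: "s \<in> {2 * int N..<4 * int N}" "[c\<^sup>2 * d\<^sup>2 + l ^ 4 = 2 * c * l\<^sup>2 * s] (mod int q)"
      using d by (auto simp: gap_set_def)
    have "[w * (c\<^sup>2 * d\<^sup>2 + l ^ 4) = w * (2 * c * l\<^sup>2 * s)] (mod int q)"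
      by (intro cong_mult s(2) cong_refl)
    also have "w * (2 * c * l\<^sup>2 * s) = (2 * c * l\<^sup>2 * w) * s" by (simp add: mult_ac)
    also have "[(2 * c * l\<^sup>2 * w) * s = 1 * s] (mod int q)" by (intro cong_mult w cong_refl)
    finally have "[w * c\<^sup>2 * d\<^sup>2 + w * l ^ 4 = s] (mod int q)" by (simp add: algebra_simps)
    then show ?thesis using s(1) by blast
  qed
  ultimately show thesis using that by blast
qed

text \<open>If \<open>8 N K <= q\<close>, all angles \<open>2 pi k x / q\<close> are at most
  \<open>pi / 4\<close> in absolute value, so every term has real part at least 1/2. The alternative
  \<open>K = 1\<close> serves the case \<open>8 N > q\<close>; the sum is then the single term
  1.\<close>

lemma fejer_lower_bound:
  fixes x :: int
  assumes x: "\<bar>x\<bar> \<le> int N" and K: "K > 0" "K = 1 \<or> 8 * N * K \<le> q"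
  shows "(real K)\<^sup>2 / 4 \<le> (cmod (\<Sum>k<K. eq q (int k * x)))\<^sup>2"
proof -
  have "real K * (1/2) = (\<Sum>k<K. 1/2)" by simp
  also have "\<dots> \<le> (\<Sum>k<K. Re (eq q (int k * x)))"
  proof (rule sum_mono)
    fix k assume k: "k \<in> {..<K}"
    show "1/2 \<le> Re (eq q (int k * x))"
    proof (cases "K = 1")
      case True
      then show ?thesis using k by simp
    next
      case False
      then have KN: "8 * N * K \<le> q" using K by blast
      define \<theta> where "\<theta> = 2 * pi * (\<bar>real_of_int (int k * x)\<bar> / real q)"
      have "\<bar>int k * x\<bar> \<le> int K * int N"
        unfolding abs_mult using k x by (intro mult_mono) auto
      then have "8 * \<bar>int k * x\<bar> \<le> int (8 * N * K)" by (simp add: mult_ac)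
      also have "\<dots> \<le> int q" using KN by (simp only: of_nat_le_iff)
      finally have le: "8 * \<bar>real_of_int (int k * x)\<bar> \<le> real q" by linarith
      have "\<bar>real_of_int (int k * x)\<bar> / real q \<le> 1 / 8"
        using le by (cases "q = 0") (auto simp: field_simps)
      then have "\<theta> \<le> 2 * pi * (1 / 8)" unfolding \<theta>_def by (intro mult_left_mono) auto
      also have "\<dots> \<le> pi / 3" using pi_ge_zero by linarith
      finally have th: "\<theta> \<le> pi / 3" .
      have th0: "0 \<le> \<theta>" unfolding \<theta>_def by simp
      have "1/2 \<le> cos \<theta>"
        using cos_monotone_0_pi_le[OF th0 th] pi_ge_zero by (simp add: cos_60)
      also have "cos \<theta> = cos \<bar>2 * pi * real_of_int (int k * x) / real q\<bar>"
        unfolding \<theta>_def by (simp add: abs_mult abs_divide)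
      also have "\<dots> = Re (eq q (int k * x))" unfolding cos_abs_real eq_eq_cis by simp
      finally show ?thesis .
    qed
  qed
  also have "\<dots> = Re (\<Sum>k<K. eq q (int k * x))" by simp
  also have "\<dots> \<le> cmod (\<Sum>k<K. eq q (int k * x))" by (rule complex_Re_le_cmod)
  finally have "(real K * (1/2))\<^sup>2 \<le> (cmod (\<Sum>k<K. eq q (int k * x)))\<^sup>2"
    by (intro power_mono) auto
  then show ?thesis by (simp add: power_mult_distrib power_divide)
qed

text \<open>Opening the square and summing over \<open>d\<close> first gives a Weyl sum for each
  difference \<open>k - m\<close>. The phases from \<open>B\<close> have modulus 1, and for fixed
  \<open>k\<close> every difference in \<open>(-K, K)\<close> occurs at most once.\<close>

lemma fejer_sum_le:
  fixes A B :: int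
  assumes N: "N > 0"
  shows "(\<Sum>d\<in>{1 - int N..<int N}. (cmod (\<Sum>k<K. eq q (int k * (A * d\<^sup>2 + B))))\<^sup>2)
     \<le> real K * (2 * real N + 2 * (\<Sum>j\<in>{1..<K}. cmod (weyl q A N (int j))))"
proof -
  let ?I = "{1 - int N..<int N}"
  have "complex_of_real (\<Sum>d\<in>?I. (cmod (\<Sum>k<K. eq q (int k * (A * d\<^sup>2 + B))))\<^sup>2)
      = (\<Sum>d\<in>?I. \<Sum>k<K. \<Sum>m<K. eq q ((int k - int m) * B) * eq q ((int k - int m) * A * d\<^sup>2))"
    unfolding of_real_sum complex_norm_square cnj_sum sum_product
    by (intro sum.cong refl) (simp add: cnj_eq algebra_simps flip: eq_add)
  also have "\<dots> = (\<Sum>k<K. \<Sum>d\<in>?I. \<Sum>m<K. eq q ((int k - int m) * B) * eq q ((int k - int m) * A * d\<^sup>2))"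
    by (rule sum.swap)
  also have "\<dots> = (\<Sum>k<K. \<Sum>m<K. \<Sum>d\<in>?I. eq q ((int k - int m) * B) * eq q ((int k - int m) * A * d\<^sup>2))"
    by (rule sum.cong[OF refl], rule sum.swap)
  also have "\<dots> = (\<Sum>k<K. \<Sum>m<K. eq q ((int k - int m) * B) * weyl q A N (int k - int m))"
    by (simp add: weyl_def sum_distrib_left)
  finally have expand: "complex_of_real (\<Sum>d\<in>?I. (cmod (\<Sum>k<K. eq q (int k * (A * d\<^sup>2 + B))))\<^sup>2)
      = (\<Sum>k<K. \<Sum>m<K. eq q ((int k - int m) * B) * weyl q A N (int k - int m))" .
  define Z where "Z j = cmod (weyl q A N j)" for j
  have Z0: "Z j \<ge> 0" for j by (simp add: Z_def)
  have "(\<Sum>d\<in>?I. (cmod (\<Sum>k<K. eq q (int k * (A * d\<^sup>2 + B))))\<^sup>2)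
      = cmod (complex_of_real (\<Sum>d\<in>?I. (cmod (\<Sum>k<K. eq q (int k * (A * d\<^sup>2 + B))))\<^sup>2))"
    unfolding norm_of_real by (simp add: sum_nonneg)
  also have "\<dots> \<le> (\<Sum>k<K. \<Sum>m<K. Z (int k - int m))"
    unfolding expand Z_def
    by (rule order_trans[OF norm_sum], intro sum_mono, rule order_trans[OF norm_sum]) (simp add: norm_mult)
  also have "\<dots> \<le> (\<Sum>k<K. 2 * real N + 2 * (\<Sum>j\<in>{1..<K}. Z (int j)))"
  proof (rule sum_mono)
    fix k assume k: "k \<in> {..<K}"
    let ?P = "int ` {1..<K}" and ?M = "(\<lambda>j. - int j) ` {1..<K}"
    have "(\<Sum>m<K. Z (int k - int m)) = (\<Sum>j\<in>(\<lambda>m. int k - int m) ` {..<K}. Z j)"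
      by (simp add: sum.reindex inj_on_def)
    also have "\<dots> \<le> (\<Sum>j\<in>insert 0 (?P \<union> ?M). Z j)"
    proof (rule sum_mono2)
      show "(\<lambda>m. int k - int m) ` {..<K} \<subseteq> insert 0 (?P \<union> ?M)"
      proof (rule image_subsetI)
        fix m assume m: "m \<in> {..<K}"
        consider "m = k" | "m < k" | "k < m" by linarith
        then show "int k - int m \<in> insert 0 (?P \<union> ?M)"
        proof cases
          case 2
          then have "int k - int m = int (k - m)" "k - m \<in> {1..<K}" using k by auto
          then show ?thesis by blast
        next
          case 3
          then have "int k - int m = - int (m - k)" "m - k \<in> {1..<K}" using m by auto
          then show ?thesis by blast
        qed simp
      qed
    qed (auto simp: Z0)
    also have "\<dots> = Z 0 + ((\<Sum>j\<in>?P. Z j) + (\<Sum>j\<in>?M. Z j))"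
      by (subst sum.insert, simp, force, subst sum.union_disjoint) auto
    also have "\<dots> = Z 0 + ((\<Sum>j\<in>{1..<K}. Z (int j)) + (\<Sum>j\<in>{1..<K}. Z (- int j)))"
      by (simp add: sum.reindex inj_on_def)
    also have "\<dots> = Z 0 + 2 * (\<Sum>j\<in>{1..<K}. Z (int j))"
      by (simp add: Z_def weyl_minus)
    finally show "(\<Sum>m<K. Z (int k - int m)) \<le> 2 * real N + 2 * (\<Sum>j\<in>{1..<K}. Z (int j))"
      using weyl_0[OF N, of q A] unfolding Z_def by linarith
  qed
  also have "\<dots> = real K * (2 * real N + 2 * (\<Sum>j\<in>{1..<K}. Z (int j)))" by simp
  finally show ?thesis unfolding Z_def .
qed

text \<open>Each gap makes the squared kernel at least \<open>K^2 / 4\<close>, while its total over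
  \<open>|d| < N\<close> is at most \<open>K (2 N + 2 S)\<close>. With \<open>K\<close> about
  \<open>q / (8 N)\<close> the term \<open>N / K\<close> is the expected \<open>N^2 / q\<close>, and
  the Weyl sums contribute \<open>sqrt N\<close> on average over their frequency.\<close>

lemma card_gap_set_le:
  assumes q: "prime q" "odd q" and c: "coprime c (int q)" and N: "N > 0" "2 * N \<le> q"
    and l: "l \<in> {1..<int q}"
  shows "real (card (gap_set q c N l))
      \<le> 128 * (real N)\<^sup>2 / real q + 72 * sqrt (divmax q * logsum q * real N)"
proof -
  have q0: "q > 0" using q(1) prime_gt_0_nat by blast
  \<comment> \<open>The largest \<open>K\<close> with \<open>8 N K <= q\<close>, but at least 1; in
    both cases \<open>q <= 16 N K\<close>.\<close>
  define K where "K = max 1 (q div (8 * N))"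
  have K: "K > 0" "K = 1 \<or> 8 * N * K \<le> q"
    using times_div_less_eq_dividend[of "8 * N" q] by (auto simp: K_def max_def)
  have Kinv: "1 / real K \<le> 16 * real N / real q"
  proof -
    have "q < 8 * N * (q div (8 * N)) + 8 * N"
      using N by (metis mult_div_mod_eq add_less_cancel_left mod_less_divisor mult_pos_pos zero_less_numeral)
    also have "\<dots> \<le> 8 * N * K + 8 * N * K"
      using K(1) by (intro add_mono mult_left_mono) (auto simp: K_def)
    finally have "real q \<le> real (16 * N * K)" by (simp only: of_nat_le_iff)
    then show ?thesis using K q0 by (simp add: field_simps)
  qed
  define D where "D = divmax q * logsum q"
  have D1: "D \<ge> 1"
    using mult_mono[of 1 "divmax q" 1 "logsum q"] divmax_ge_1[OF q0] logsum_ge_1[OF q0] by (simp add: D_def)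
  obtain A B where A: "coprime A (int q)"
    and AB: "\<And>d. d \<in> gap_set q c N l \<Longrightarrow> \<exists>s\<in>{2 * int N..<4 * int N}. [A * d\<^sup>2 + B = s] (mod int q)"
    using gap_set_quadratic[OF q c l] by metis
  let ?I = "{1 - int N..<int N}"
  \<comment> \<open>Shift by the midpoint of \<open>[2 N, 4 N)\<close>, so that the value to be
    detected satisfies \<open>|s - 3 N| <= N\<close>.\<close>
  define B' where "B' = B - 3 * int N"
  define S where "S = (\<Sum>j\<in>{1..<K}. cmod (weyl q A N (int j)))"
  define T where "T d = (cmod (\<Sum>k<K. eq q (int k * (A * d\<^sup>2 + B'))))\<^sup>2" for d
  have low: "(real K)\<^sup>2 / 4 \<le> T d" if d: "d \<in> gap_set q c N l" for d
  proof -
    obtain s where s: "s \<in> {2 * int N..<4 * int N}" "[A * d\<^sup>2 + B = s] (mod int q)"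
      using AB[OF d] by blast
    have "[A * d\<^sup>2 + B' = s - 3 * int N] (mod int q)"
      using cong_diff[OF s(2) cong_refl, of "3 * int N"] by (simp add: B'_def algebra_simps)
    then have "eq q (int k * (A * d\<^sup>2 + B')) = eq q (int k * (s - 3 * int N))" for k
      by (intro eq_cong cong_mult cong_refl)
    then have "T d = (cmod (\<Sum>k<K. eq q (int k * (s - 3 * int N))))\<^sup>2" by (simp add: T_def)
    also have "\<dots> \<ge> (real K)\<^sup>2 / 4" using s(1) by (intro fejer_lower_bound[OF _ K]) auto
    finally show ?thesis .
  qed
  have "real (card (gap_set q c N l)) * ((real K)\<^sup>2 / 4) = (\<Sum>d\<in>gap_set q c N l. (real K)\<^sup>2 / 4)" by simp
  also have "\<dots> \<le> (\<Sum>d\<in>gap_set q c N l. T d)" by (intro sum_mono low)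
  also have "\<dots> \<le> (\<Sum>d\<in>?I. T d)" by (intro sum_mono2) (auto simp: gap_set_def T_def)
  also have "\<dots> \<le> real K * (2 * real N + 2 * S)"
    unfolding T_def S_def by (rule fejer_sum_le[OF N(1)])
  finally have "real K * (real (card (gap_set q c N l)) * real K) \<le> real K * (8 * real N + 8 * S)"
    by (simp add: power2_eq_square mult_ac)
  then have "real (card (gap_set q c N l)) * real K \<le> 8 * real N + 8 * S"
    using K(1) by simp
  then have main: "real (card (gap_set q c N l)) \<le> 8 * real N * (1 / real K) + 8 * (S / real K)"
    using K(1) by (simp add: field_simps)
  have "8 * real N * (1 / real K) \<le> 8 * real N * (16 * real N / real q)"
    using Kinv by (intro mult_left_mono) auto
  also have "\<dots> = 128 * (real N)\<^sup>2 / real q" by (simp add: power2_eq_square)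
  finally have first: "8 * real N * (1 / real K) \<le> 128 * (real N)\<^sup>2 / real q" .
  have "S / real K \<le> 9 * sqrt (D * real N)"
  proof (cases "K = 1")
    case True
    then show ?thesis using D1 by (simp add: S_def)
  next
    case False
    then have KN: "8 * N * K \<le> q" using K by blast
    have NK0: "N * K > 0" using N K by simp
    have NKq: "2 * N * K < q" using KN NK0 unfolding mult.assoc by linarith
    have "S\<^sup>2 \<le> (\<Sum>j\<in>{1..<K}. 1\<^sup>2) * (\<Sum>j\<in>{1..<K}. (cmod (weyl q A N (int j)))\<^sup>2)"
      unfolding S_def using Cauchy_Schwarz_ineq_sum[of "\<lambda>_. 1" "\<lambda>j. cmod (weyl q A N (int j))" "{1..<K}"] by simp
    also have "\<dots> \<le> real K * (\<Sum>j\<in>{1..K}. (cmod (weyl q A N (int j)))\<^sup>2)"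
      by (intro mult_mono sum_mono2) (auto intro: sum_nonneg)
    also have "\<dots> \<le> real K * (2 * real N * real K + 4 * divmax q * real q * logsum q)"
      by (intro mult_left_mono sum_weyl_square_le[OF q A N(1) NKq]) auto
    also have "\<dots> \<le> real K * (5 * D * real q)"
    proof (intro mult_left_mono)
      have "real (8 * N * K) \<le> real q" using KN by (simp only: of_nat_le_iff)
      then have "2 * real N * real K \<le> 1 * real q" by simp
      also have "\<dots> \<le> D * real q" using D1 by (intro mult_right_mono) auto
      finally show "2 * real N * real K + 4 * divmax q * real q * logsum q \<le> 5 * D * real q"
        by (simp add: D_def mult_ac)
    qed auto
    finally have "S\<^sup>2 / (real K)\<^sup>2 \<le> real K * (5 * D * real q) / (real K)\<^sup>2" by (intro divide_right_mono) auto
    also have "\<dots> = (5 * D * real q) * (1 / real K)" using K(1) by (simp add: power2_eq_square)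
    also have "\<dots> \<le> (5 * D * real q) * (16 * real N / real q)"
      using Kinv D1 by (intro mult_left_mono) auto
    also have "\<dots> = 80 * (D * real N)" using q0 by simp
    \<comment> \<open>Round up to a square, whose root is the 9 of the claim.\<close>
    also have "\<dots> \<le> 81 * (D * real N)" using D1 by (intro mult_right_mono) auto
    finally have "(S / real K)\<^sup>2 \<le> 81 * (D * real N)" by (simp add: power_divide)
    then have "S / real K \<le> sqrt (81 * (D * real N))" by (rule real_le_rsqrt)
    also have "\<dots> = 9 * sqrt (D * real N)" by (simp add: real_sqrt_mult)
    finally show ?thesis .
  qed
  then show ?thesis using main first unfolding D_def by linarith
qed

section \<open>Averaged factorisation of the bilinear form\<close>


lemma modular_inverse_exists:
  assumes "prime q" "v \<in> {1..<int q}"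
  shows "\<exists>w. [v * w = 1] (mod int q)"
proof -
  have "coprime v (int q)"
    using prime_imp_coprime[of "int q" v] not_dvd_residue[OF assms(2)] assms(1)
    by (auto simp: coprime_commute)
  then show ?thesis using cong_solve_coprime_int by blast
qed

lemma mod_in_units:
  assumes "q > 0" "\<not> int q dvd x"
  shows "x mod int q \<in> {1..<int q}"
proof -
  have "x mod int q \<noteq> 0" using assms(2) by (simp add: dvd_eq_mod_eq_0)
  moreover have "0 \<le> x mod int q" "x mod int q < int q" using assms(1) by simp_all
  ultimately show ?thesis by simp
qed

text \<open>Every solution of \<open>x\<^sup>2 = a m n\<close> factors as \<open>x = u v\<close> with \<open>j u\<^sup>2 = a m\<close> and \<open>v\<^sup>2 = j n\<close> in
  exactly one way for each unit \<open>v\<close>; averaging over \<open>j\<close> avoids choosing a quadratic nonresidue.\<close>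

lemma sum_factored_roots:
  fixes F :: "int \<Rightarrow> complex"
  assumes q: "prime q" and n: "\<not> int q dvd int n"
    and F: "\<And>x y. [x = y] (mod int q) \<Longrightarrow> F x = F y"
  shows "(\<Sum>j\<in>{1..<int q}. \<Sum>u\<in>{u \<in> {0..<int q}. [j * u\<^sup>2 = a * int m] (mod int q)}.
            \<Sum>v\<in>roots q j n. F (u * v))
       = of_nat (q - 1) * (\<Sum>x\<in>{x \<in> {0..<int q}. [x\<^sup>2 = a * int m * int n] (mod int q)}. F x)"
proof -
  let ?p = "int q"
  have q0: "q > 0" using q prime_gt_0_nat by blast
  define X where "X = {x \<in> {0..<?p}. [x\<^sup>2 = a * int m * int n] (mod ?p)}"
  define R where "R = {1..<?p}"
  define T where "T = Sigma R (\<lambda>j. {u \<in> {0..<?p}. [j * u\<^sup>2 = a * int m] (mod ?p)} \<times> roots q j n)"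
  have "coprime (int n) ?p" using prime_imp_coprime[of ?p "int n"] n q by (auto simp: coprime_commute)
  then obtain n' where n': "[int n * n' = 1] (mod ?p)" using cong_solve_coprime_int by blast
  define iv where "iv v = (SOME w. [v * w = 1] (mod ?p))" for v
  have iv: "[v * iv v = 1] (mod ?p)" if "v \<in> R" for v
    unfolding iv_def using someI_ex[OF modular_inverse_exists[OF q that[unfolded R_def]]] .
  have notdvd: "\<not> ?p dvd v" if "v \<in> R" for v using that not_dvd_residue by (simp add: R_def)
  have n'dvd: "\<not> ?p dvd n'"
  proof
    assume "?p dvd n'"
    then have "?p dvd int n * n'" by simp
    then have "?p dvd 1" using n' cong_dvd_iff by blast
    then show False using q by (auto simp: prime_ge_2_nat)
  qed
  have finU: "finite {u \<in> {0..<?p}. [j * u\<^sup>2 = a * int m] (mod ?p)}" for j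
    by (rule finite_subset[of _ "{0..<?p}"]) auto
  have finR: "finite R" by (simp add: R_def)
  have "(\<Sum>j\<in>R. \<Sum>u\<in>{u \<in> {0..<?p}. [j * u\<^sup>2 = a * int m] (mod ?p)}. \<Sum>v\<in>roots q j n. F (u * v))
      = (\<Sum>(j, u, v)\<in>T. F (u * v))"
    unfolding T_def sum.cartesian_product
    by (rule sum.Sigma[OF finR]) (intro ballI finite_cartesian_product finU finite_roots)
  \<comment> \<open>A triple is determined by \<open>v\<close> and \<open>x = u v\<close>:
    \<open>j = v^2 / n\<close> and \<open>u = x / v\<close> modulo \<open>q\<close>. Here
    \<open>v\<close> is a unit because \<open>j\<close> and \<open>n\<close> are.\<close>
  also have "\<dots> = (\<Sum>(v, x)\<in>R \<times> X. F x)"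
  proof (rule sum.reindex_bij_witness[of _
        "\<lambda>(v, x). ((v\<^sup>2 * n') mod ?p, (x * iv v) mod ?p, v)" "\<lambda>(j, u, v). (v, (u * v) mod ?p)"])
    fix t assume t: "t \<in> T"
    obtain j u v where juv: "t = (j, u, v)" using prod_cases3 by blast
    have j: "j \<in> R" and u: "u \<in> {0..<?p}" "[j * u\<^sup>2 = a * int m] (mod ?p)"
      and v: "v \<in> {0..<?p}" "[v\<^sup>2 = j * int n] (mod ?p)"
      using t juv by (auto simp: T_def roots_def)
    have vR: "v \<in> R"
    proof -
      have "v \<noteq> 0"
      proof
        assume "v = 0"
        then have "?p dvd j * int n" using cong_sym[OF v(2)] by (simp add: cong_0_iff)
        then show False using notdvd[OF j] n prime_int_dvd_mult_iff[OF q] by blast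
      qed
      then show ?thesis using v(1) by (simp add: R_def)
    qed
    have "[v\<^sup>2 * n' = j * int n * n'] (mod ?p)" by (intro cong_mult v(2) cong_refl)
    also have "[j * int n * n' = j * 1] (mod ?p)"
      unfolding mult.assoc by (intro cong_mult n' cong_refl)
    finally have 1: "(v\<^sup>2 * n') mod ?p = j" using j by (simp add: cong_def R_def)
    have "[((u * v) mod ?p) * iv v = (u * v) * iv v] (mod ?p)"
      by (intro cong_mult cong_refl) (simp add: cong_def)
    also have "(u * v) * iv v = u * (v * iv v)" by simp
    also have "[u * (v * iv v) = u * 1] (mod ?p)" by (intro cong_mult iv[OF vR] cong_refl)
    finally have 2: "((u * v) mod ?p * iv v) mod ?p = u" using u by (simp add: cong_def)
    show "(case (case t of (j, u, v) \<Rightarrow> (v, (u * v) mod ?p)) of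
        (v, x) \<Rightarrow> ((v\<^sup>2 * n') mod ?p, (x * iv v) mod ?p, v)) = t"
      using 1 2 juv by simp
    have "[j * (u * v)\<^sup>2 = (j * u\<^sup>2) * v\<^sup>2] (mod ?p)" by (simp add: power_mult_distrib mult.assoc)
    also have "[(j * u\<^sup>2) * v\<^sup>2 = (a * int m) * (j * int n)] (mod ?p)" by (intro cong_mult u v)
    also have "(a * int m) * (j * int n) = j * (a * int m * int n)" by simp
    finally have "[(u * v)\<^sup>2 = a * int m * int n] (mod ?p)"
      using notdvd[OF j] q prime_imp_coprime[of ?p j] by (simp add: cong_mult_lcancel coprime_commute)
    then have "[((u * v) mod ?p)\<^sup>2 = a * int m * int n] (mod ?p)"
      by (simp add: cong_def power_mod)
    then show "(case t of (j, u, v) \<Rightarrow> (v, (u * v) mod ?p)) \<in> R \<times> X"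
      using vR q0 juv by (simp add: X_def)
    show "(case (case t of (j, u, v) \<Rightarrow> (v, (u * v) mod ?p)) of (v, x) \<Rightarrow> F x)
        = (case t of (j, u, v) \<Rightarrow> F (u * v))"
      using juv by (auto intro: F simp: cong_def)
  next
    fix s assume s: "s \<in> R \<times> X"
    obtain v x where vx: "s = (v, x)" by fastforce
    have v: "v \<in> R" and x: "x \<in> {0..<?p}" "[x\<^sup>2 = a * int m * int n] (mod ?p)"
      using s vx by (auto simp: X_def)
    let ?j = "(v\<^sup>2 * n') mod ?p" and ?u = "(x * iv v) mod ?p"
    have "[?u * v = x * iv v * v] (mod ?p)" by (intro cong_mult cong_refl) (simp add: cong_def)
    also have "x * iv v * v = x * (v * iv v)" by simp
    also have "[x * (v * iv v) = x * 1] (mod ?p)" by (intro cong_mult iv[OF v] cong_refl)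
    finally have uv: "(?u * v) mod ?p = x" using x by (simp add: cong_def)
    then show "(case (case s of (v, x) \<Rightarrow> ((v\<^sup>2 * n') mod ?p, (x * iv v) mod ?p, v)) of
        (j, u, v) \<Rightarrow> (v, (u * v) mod ?p)) = s"
      using vx by simp
    have "\<not> ?p dvd v\<^sup>2 * n'"
      using notdvd[OF v] n'dvd prime_int_dvd_mult_iff[OF q] unfolding power2_eq_square by blast
    then have j: "?j \<in> R" unfolding R_def by (rule mod_in_units[OF q0])
    have jc: "[?j = v\<^sup>2 * n'] (mod ?p)" and uc: "[?u = x * iv v] (mod ?p)" by (simp_all add: cong_def)
    have "[?j * ?u\<^sup>2 = (v\<^sup>2 * n') * (x * iv v)\<^sup>2] (mod ?p)" by (intro cong_mult cong_pow jc uc)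
    also have "(v\<^sup>2 * n') * (x * iv v)\<^sup>2 = n' * (x\<^sup>2 * (v * iv v)\<^sup>2)" by (simp add: power_mult_distrib)
    also have "[n' * (x\<^sup>2 * (v * iv v)\<^sup>2) = n' * (a * int m * int n * 1\<^sup>2)] (mod ?p)"
      by (intro cong_mult cong_pow iv[OF v] x cong_refl)
    also have "n' * (a * int m * int n * 1\<^sup>2) = a * int m * (int n * n')" by simp
    also have "[a * int m * (int n * n') = a * int m * 1] (mod ?p)" by (intro cong_mult n' cong_refl)
    finally have ju: "[?j * ?u\<^sup>2 = a * int m] (mod ?p)" by simp
    have "[?j * int n = v\<^sup>2 * n' * int n] (mod ?p)" by (intro cong_mult jc cong_refl)
    also have "v\<^sup>2 * n' * int n = v\<^sup>2 * (int n * n')" by simp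
    also have "[v\<^sup>2 * (int n * n') = v\<^sup>2 * 1] (mod ?p)" by (intro cong_mult n' cong_refl)
    finally have "[v\<^sup>2 = ?j * int n] (mod ?p)" by (simp add: cong_sym)
    then show "(case s of (v, x) \<Rightarrow> ((v\<^sup>2 * n') mod ?p, (x * iv v) mod ?p, v)) \<in> T"
      using vx j ju v q0 by (simp add: T_def roots_def R_def)
  qed
  also have "\<dots> = (\<Sum>v\<in>R. \<Sum>x\<in>X. F x)" by (simp only: sum.cartesian_product)
  also have "\<dots> = of_nat (q - 1) * (\<Sum>x\<in>X. F x)"
    using q0 by (simp add: R_def nat_diff_distrib)
  finally show ?thesis unfolding R_def X_def .
qed

text \<open>Since \<open>0 < n < q\<close>, the factorisation applies to every inner sum. With
  \<open>j\<close> outermost, each fixed \<open>j\<close> leaves a genuine bilinear form in the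
  roots \<open>u\<close> of \<open>a m / j\<close> and \<open>v\<close> of
  \<open>j n\<close>.\<close>

lemma W_eq_average:
  assumes q: "prime q" and N: "2 * N \<le> q"
  shows "of_nat (q - 1) * W a q \<alpha> \<beta> h M N
    = (\<Sum>j\<in>{1..<int q}. \<Sum>m\<in>dyad M. \<Sum>u\<in>{u \<in> {0..<int q}. [j * u\<^sup>2 = int a * int m] (mod int q)}.
        \<Sum>n\<in>dyad N. \<Sum>v\<in>roots q j n. \<alpha> m * \<beta> n * eq q (int h * u * v))"
proof -
  let ?U = "\<lambda>j m. {u \<in> {0..<int q}. [j * u\<^sup>2 = int a * int m] (mod int q)}"
  have inner: "of_nat (q - 1) * (\<Sum>x\<in>{x. x < q \<and> [x\<^sup>2 = a * m * n] (mod q)}. eq q (int h * int x))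
      = (\<Sum>j\<in>{1..<int q}. \<Sum>u\<in>?U j m. \<Sum>v\<in>roots q j n. eq q (int h * u * v))"
    if n: "n \<in> dyad N" for m n
  proof -
    have ndvd: "\<not> int q dvd int n"
      using n N not_dvd_residue[of "int n" q] by (auto simp: dyad_def)
    have "(\<Sum>x\<in>{x. x < q \<and> [x\<^sup>2 = a * m * n] (mod q)}. eq q (int h * int x))
        = (\<Sum>x\<in>{x \<in> {0..<int q}. [x\<^sup>2 = int a * int m * int n] (mod int q)}. eq q (int h * x))"
      by (rule sum.reindex_bij_witness[of _ nat int]) (auto simp flip: cong_int_iff)
    moreover have "(\<Sum>j\<in>{1..<int q}. \<Sum>u\<in>?U j m. \<Sum>v\<in>roots q j n. eq q (int h * (u * v)))
        = of_nat (q - 1) * (\<Sum>x\<in>{x \<in> {0..<int q}. [x\<^sup>2 = int a * int m * int n] (mod int q)}. eq q (int h * x))"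
      by (rule sum_factored_roots[OF q ndvd]) (intro eq_cong cong_mult cong_refl)
    ultimately show ?thesis by (simp add: mult.assoc)
  qed
  have "of_nat (q - 1) * W a q \<alpha> \<beta> h M N = (\<Sum>m\<in>dyad M. \<Sum>n\<in>dyad N. \<alpha> m * \<beta> n *
      (of_nat (q - 1) * (\<Sum>x\<in>{x. x < q \<and> [x\<^sup>2 = a * m * n] (mod q)}. eq q (int h * int x))))"
    unfolding W_def sum_distrib_left[of "of_nat (q - 1) :: complex" _ "dyad M"]
      sum_distrib_left[of "of_nat (q - 1) :: complex" _ "dyad N"]
    by (simp add: mult_ac)
  also have "\<dots> = (\<Sum>m\<in>dyad M. \<Sum>n\<in>dyad N. \<Sum>j\<in>{1..<int q}. \<Sum>u\<in>?U j m. \<Sum>v\<in>roots q j n.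
      \<alpha> m * \<beta> n * eq q (int h * u * v))"
    by (intro sum.cong refl) (subst inner, assumption, simp only: sum_distrib_left)
  also have "\<dots> = (\<Sum>m\<in>dyad M. \<Sum>j\<in>{1..<int q}. \<Sum>n\<in>dyad N. \<Sum>u\<in>?U j m. \<Sum>v\<in>roots q j n.
      \<alpha> m * \<beta> n * eq q (int h * u * v))"
    by (rule sum.cong[OF refl], rule sum.swap)
  also have "\<dots> = (\<Sum>j\<in>{1..<int q}. \<Sum>m\<in>dyad M. \<Sum>n\<in>dyad N. \<Sum>u\<in>?U j m. \<Sum>v\<in>roots q j n.
      \<alpha> m * \<beta> n * eq q (int h * u * v))"
    by (rule sum.swap)
  also have "\<dots> = (\<Sum>j\<in>{1..<int q}. \<Sum>m\<in>dyad M. \<Sum>u\<in>?U j m. \<Sum>n\<in>dyad N. \<Sum>v\<in>roots q j n.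
      \<alpha> m * \<beta> n * eq q (int h * u * v))"
    by (rule sum.cong[OF refl], rule sum.cong[OF refl], rule sum.swap)
  finally show ?thesis .
qed

section \<open>Additive energy of modular square roots\<close>


text \<open>Hoelder interpolation of the second moment between the first and the fourth; the
  exponents come from \<open>2 = 2/3 * 1 + 1/3 * 4\<close>.\<close>

lemma sum_power2_le_interpolate:
  fixes f :: "'a \<Rightarrow> real"
  assumes "\<And>x. x \<in> A \<Longrightarrow> f x \<ge> 0"
  shows "(\<Sum>x\<in>A. (f x)\<^sup>2) \<le> (\<Sum>x\<in>A. f x) powr (2/3) * (\<Sum>x\<in>A. (f x) ^ 4) powr (1/3)"
proof (cases "finite A \<and> (\<exists>x\<in>A. f x > 0)")
  case False
  then have "(\<Sum>x\<in>A. (f x)\<^sup>2) = 0"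
  proof (cases "finite A")
    case True
    then have "f x = 0" if "x \<in> A" for x using False assms[OF that] that by force
    then show ?thesis by simp
  qed simp
  then show ?thesis by simp
next
  case True
  then obtain x0 where x0: "x0 \<in> A" "f x0 > 0" and fin: "finite A" by blast
  define S where "S = (\<Sum>x\<in>A. f x)"
  define T where "T = (\<Sum>x\<in>A. (f x) ^ 4)"
  have S: "S > 0" unfolding S_def using x0 fin assms by (intro sum_pos2[of _ x0]) auto
  have T: "T > 0" unfolding T_def using x0 fin assms by (intro sum_pos2[of _ x0]) auto
  define t where "t = (T / S) powr (1/3)"
  have t: "t > 0" using S T by (simp add: t_def)
  have t3: "t ^ 3 = T / S"
    unfolding t_def using S T by (simp add: powr_power)
  \<comment> \<open>\<open>2 t y + y\<^sup>4 / t\<^sup>2 \<ge> 3 y\<^sup>2\<close> by AM-GM, and \<open>t\<close> balances the two sums.\<close>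
  have "3 * (f x)\<^sup>2 \<le> 2 * t * f x + (f x) ^ 4 / t\<^sup>2" if "x \<in> A" for x
  proof -
    let ?y = "f x"
    have y: "?y \<ge> 0" using assms that by blast
    have "0 \<le> ?y * ((?y - t)\<^sup>2 * (?y + 2 * t))" using y t by simp
    also have "\<dots> = ?y ^ 4 - 3 * t\<^sup>2 * ?y\<^sup>2 + 2 * t ^ 3 * ?y"
      by (simp add: power2_eq_square power3_eq_cube power4_eq_xxxx algebra_simps)
    finally have "3 * t\<^sup>2 * ?y\<^sup>2 \<le> ?y ^ 4 + 2 * t ^ 3 * ?y" by linarith
    then have "(3 * t\<^sup>2 * ?y\<^sup>2) / t\<^sup>2 \<le> (?y ^ 4 + 2 * t ^ 3 * ?y) / t\<^sup>2"
      by (intro divide_right_mono) auto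
    then show ?thesis using t by (simp add: add_divide_distrib power2_eq_square power3_eq_cube)
  qed
  then have "(\<Sum>x\<in>A. 3 * (f x)\<^sup>2) \<le> (\<Sum>x\<in>A. 2 * t * f x + (f x) ^ 4 / t\<^sup>2)" by (rule sum_mono)
  also have "\<dots> = 2 * t * S + T / t\<^sup>2"
    by (simp add: S_def T_def sum.distrib sum_distrib_left sum_divide_distrib)
  also have "T = t ^ 3 * S" using t3 S by simp
  also have "2 * t * S + t ^ 3 * S / t\<^sup>2 = 3 * (t * S)"
    using t by (simp add: power2_eq_square power3_eq_cube)
  finally have "(\<Sum>x\<in>A. (f x)\<^sup>2) \<le> t * S" by (simp flip: sum_distrib_left)
  also have "t * S = S powr (2/3) * T powr (1/3)"
  proof -
    have "t * S = T powr (1/3) * (S powr 1 / S powr (1/3))"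
      using S T by (simp add: t_def powr_divide)
    also have "S powr 1 / S powr (1/3) = S powr (2/3)" unfolding powr_diff[symmetric] by simp
    finally show ?thesis by simp
  qed
  finally show ?thesis unfolding S_def T_def .
qed

text \<open>For \<open>0 <= w <= x + y\<close> the ratio \<open>w / (x + y)\<close> is at most its
  \<open>p\<close>-th power, and the ratios for \<open>w = x\<close> and \<open>w = y\<close> add up
  to 1.\<close>

lemma powr_add_le:
  fixes x y p :: real
  assumes "x \<ge> 0" "y \<ge> 0" "0 \<le> p" "p \<le> 1"
  shows "(x + y) powr p \<le> x powr p + y powr p"
proof (cases "x + y = 0")
  case False
  then have z: "x + y > 0" using assms by linarith
  have part: "(x + y) powr p * (w / (x + y)) \<le> w powr p" if w: "0 \<le> w" "w \<le> x + y" for w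
  proof -
    have "w / (x + y) \<le> (w / (x + y)) powr p"
    proof (cases "w = 0")
      case False
      then have "(w / (x + y)) powr 1 \<le> (w / (x + y)) powr p"
        using w z assms by (intro powr_mono') auto
      then show ?thesis using w z False by simp
    qed simp
    then have "(x + y) powr p * (w / (x + y)) \<le> (x + y) powr p * (w / (x + y)) powr p"
      by (intro mult_left_mono) auto
    also have "\<dots> = w powr p" using w z by (simp add: powr_divide)
    finally show ?thesis .
  qed
  have "(x + y) powr p = (x + y) powr p * (x / (x + y)) + (x + y) powr p * (y / (x + y))"
    using z by (simp flip: distrib_left add_divide_distrib)
  also have "\<dots> \<le> x powr p + y powr p" using assms by (intro add_mono part) auto
  finally show ?thesis .
qed simp

lemma corr_le_square_mult:
  assumes "\<And>v. v \<in> V \<Longrightarrow> 0 \<le> b v" "\<And>v. v \<in> V \<Longrightarrow> b v \<le> B"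
  shows "corr q V b l \<le> B\<^sup>2 * corr q V (\<lambda>_. 1) l"
proof -
  have "corr q V b l \<le> (\<Sum>(v, w)\<in>{(v, w) \<in> V \<times> V. (v - w) mod int q = l}. B\<^sup>2)"
    unfolding corr_def power2_eq_square case_prod_unfold
    using assms by (intro sum_mono mult_mono) (auto intro: order_trans)
  then show ?thesis by (simp add: corr_def case_prod_unfold mult.commute)
qed

text \<open>The parabola bounds require a unit \<open>l\<close>, so \<open>l = 0\<close> is treated
  apart. Elements of \<open>V\<close> are reduced residues, and only the diagonal pairs
  remain.\<close>

lemma corr_0_le:
  assumes V: "finite V" "V \<subseteq> {0..<int q}"
    and b: "\<And>v. v \<in> V \<Longrightarrow> 0 \<le> b v" "\<And>v. v \<in> V \<Longrightarrow> b v \<le> B"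
  shows "corr q V b 0 \<le> B * (\<Sum>v\<in>V. b v)"
proof -
  have "{(v, w) \<in> V \<times> V. (v - w) mod int q = 0} = (\<lambda>v. (v, v)) ` V"
  proof (rule Set.set_eqI, rule iffI)
    fix p assume "p \<in> {(v, w) \<in> V \<times> V. (v - w) mod int q = 0}"
    then obtain v w where p: "p = (v, w)" "v \<in> V" "w \<in> V" "int q dvd v - w" by auto
    then have "v = w"
      using subsetD[OF V(2)] by (intro residues_eqI[of v w q]) (auto simp: cong_iff_dvd_diff)
    then show "p \<in> (\<lambda>v. (v, v)) ` V" using p by blast
  qed auto
  then have "corr q V b 0 = (\<Sum>v\<in>V. b v * b v)"
    unfolding corr_def by (simp add: sum.reindex inj_on_def)
  also have "\<dots> \<le> (\<Sum>v\<in>V. B * b v)" using b by (intro sum_mono mult_right_mono) auto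
  finally show ?thesis by (simp add: sum_distrib_left)
qed

lemma sum_corr_square_split:
  assumes "q > 0"
  shows "(\<Sum>l\<in>{0..<int q}. (corr q V b l)\<^sup>2)
    = (corr q V b 0)\<^sup>2 + (\<Sum>l\<in>{1..<int q}. (corr q V b l)\<^sup>2)"
proof -
  have "{0..<int q} = insert 0 {1..<int q}" using assms by auto
  then show ?thesis by simp
qed

context
  fixes q :: nat and c :: int and N :: nat and b :: "int \<Rightarrow> real" and B :: real
  assumes q: "prime q" "odd q" and c: "coprime c (int q)" and N: "N > 0" "2 * N \<le> q"
    and b: "\<And>v. v \<in> dyad_roots q c N \<Longrightarrow> 0 \<le> b v" "\<And>v. v \<in> dyad_roots q c N \<Longrightarrow> b v \<le> B"
begin

text \<open>For nonzero \<open>l\<close> the square is at most the pointwise maximum times the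
  correlation itself, whose total is the squared sum of the weights.\<close>

lemma energy_gap_bound:
  "(\<Sum>l\<in>{0..<int q}. (corr q (dyad_roots q c N) b l)\<^sup>2)
    \<le> 201 * (divmax q * logsum q) * (B\<^sup>2 * (\<Sum>v\<in>dyad_roots q c N. b v)\<^sup>2)
        * ((real N)\<^sup>2 / real q + real N powr (1/2))"
proof -
  let ?V = "dyad_roots q c N"
  let ?\<rho> = "corr q ?V b"
  have q0: "q > 0" using q(1) prime_gt_0_nat by blast
  define s where "s = (\<Sum>v\<in>?V. b v)"
  define Q where "Q = divmax q * logsum q"
  have Q1: "Q \<ge> 1"
    using mult_mono[of 1 "divmax q" 1 "logsum q"] divmax_ge_1[OF q0] logsum_ge_1[OF q0] by (simp add: Q_def)
  define m where "m = 128 * (real N)\<^sup>2 / real q + 72 * sqrt (Q * real N)"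
  have V: "?V \<subseteq> {0..<int q}" by (auto simp: dyad_roots_def roots_def)
  have \<rho>0: "?\<rho> l \<ge> 0" for l by (rule corr_nonneg[OF b(1)])
  have s0: "s \<ge> 0" unfolding s_def by (intro sum_nonneg b)
  have "(?\<rho> 0)\<^sup>2 \<le> (B * s)\<^sup>2"
    unfolding s_def by (intro power_mono \<rho>0 corr_0_le[OF _ V b]) auto
  then have zero: "(?\<rho> 0)\<^sup>2 \<le> B\<^sup>2 * s\<^sup>2" by (simp add: power_mult_distrib)
  have "(\<Sum>l\<in>{1..<int q}. (?\<rho> l)\<^sup>2) \<le> (\<Sum>l\<in>{1..<int q}. B\<^sup>2 * m * ?\<rho> l)"
  proof (rule sum_mono)
    fix l assume l: "l \<in> {1..<int q}"
    have "?\<rho> l \<le> B\<^sup>2 * corr q ?V (\<lambda>_. 1) l" by (rule corr_le_square_mult[OF b])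
    also have "\<dots> \<le> B\<^sup>2 * m"
      using corr_le_card_gap_set[OF q l, of c N] card_gap_set_le[OF q c N l]
      unfolding m_def Q_def by (intro mult_left_mono) auto
    finally show "(?\<rho> l)\<^sup>2 \<le> B\<^sup>2 * m * ?\<rho> l"
      unfolding power2_eq_square using \<rho>0 by (intro mult_right_mono) auto
  qed
  also have "\<dots> = B\<^sup>2 * m * (\<Sum>l\<in>{1..<int q}. ?\<rho> l)" by (simp add: sum_distrib_left)
  also have "\<dots> \<le> B\<^sup>2 * m * (\<Sum>l\<in>{0..<int q}. ?\<rho> l)"
    using \<rho>0 Q1 by (intro mult_left_mono sum_mono2) (auto simp: m_def)
  also have "\<dots> = B\<^sup>2 * m * s\<^sup>2" unfolding sum_corr[OF q0 finite_dyad_roots] s_def ..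
  finally have "(\<Sum>l\<in>{0..<int q}. (?\<rho> l)\<^sup>2) \<le> B\<^sup>2 * s\<^sup>2 * (1 + m)"
    using zero unfolding sum_corr_square_split[OF q0] by (simp add: algebra_simps)
  \<comment> \<open>The constant is \<open>1 + 128 + 72\<close>, for the diagonal and the two terms
    of \<open>m\<close>.\<close>
  also have "\<dots> \<le> B\<^sup>2 * s\<^sup>2 * (201 * Q * ((real N)\<^sup>2 / real q + real N powr (1/2)))"
  proof (intro mult_left_mono)
    have "sqrt Q \<le> Q" using Q1 by (intro real_le_lsqrt) (auto simp: power2_eq_square)
    then have "sqrt (Q * real N) \<le> Q * sqrt (real N)"
      unfolding real_sqrt_mult by (intro mult_right_mono) auto
    moreover have "1 * 1 \<le> Q * sqrt (real N)" using Q1 N by (intro mult_mono) auto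
    moreover have "1 * ((real N)\<^sup>2 / real q) \<le> Q * ((real N)\<^sup>2 / real q)"
      using Q1 by (intro mult_right_mono) auto
    moreover have "0 \<le> Q * ((real N)\<^sup>2 / real q)" using Q1 by simp
    moreover have "m = 128 * ((real N)\<^sup>2 / real q) + 72 * sqrt (Q * real N)" by (simp add: m_def)
    moreover have "201 * Q * ((real N)\<^sup>2 / real q + real N powr (1/2))
        = 201 * (Q * ((real N)\<^sup>2 / real q)) + 201 * (Q * sqrt (real N))"
      by (simp add: powr_half_sqrt distrib_left)
    ultimately show "1 + m \<le> 201 * Q * ((real N)\<^sup>2 / real q + real N powr (1/2))"
      by linarith
  qed auto
  finally show ?thesis unfolding s_def Q_def by (simp only: mult_ac)
qed

text \<open>For nonzero \<open>l\<close>, interpolation between the total \<open>s^2\<close> of the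
  correlations and \<open>B^8\<close> times the unweighted fourth moment gives
  \<open>s^(4/3) B^(8/3)\<close> times the cube root of \<open>N^3 + N^2 y^(3/2)\<close>. With
  \<open>y = N^3 / q\<close> the second summand has cube root
  \<open>N^(2/3 + 3/2) / q^(1/2)\<close>.\<close>

lemma energy_lattice_bound:
  assumes B: "B > 0"
  shows "(\<Sum>l\<in>{0..<int q}. (corr q (dyad_roots q c N) b l)\<^sup>2)
    \<le> 76 * (divmax q * logsum q) * (B powr (8/3) * (\<Sum>v\<in>dyad_roots q c N. b v) powr (4/3))
        * (real N powr (13/6) / real q powr (1/2) + real N)"
proof -
  let ?V = "dyad_roots q c N"
  let ?\<rho> = "corr q ?V b" and ?r = "corr q ?V (\<lambda>_. 1)"
  have q0: "q > 0" using q(1) prime_gt_0_nat by blast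
  define s where "s = (\<Sum>v\<in>?V. b v)"
  define Q where "Q = divmax q * logsum q"
  have Q1: "Q \<ge> 1"
    using mult_mono[of 1 "divmax q" 1 "logsum q"] divmax_ge_1[OF q0] logsum_ge_1[OF q0] by (simp add: Q_def)
  define E where "E = real N powr (13/6) / real q powr (1/2)"
  define G where "G = B powr (8/3) * s powr (4/3)"
  have V: "?V \<subseteq> {0..<int q}" by (auto simp: dyad_roots_def roots_def)
  have \<rho>0: "?\<rho> l \<ge> 0" for l by (rule corr_nonneg[OF b(1)])
  have s0: "s \<ge> 0" unfolding s_def by (intro sum_nonneg b)
  have sle: "s \<le> 2 * real N * B"
  proof -
    have "s \<le> real (card ?V) * B" unfolding s_def using b by (intro sum_bounded_above) auto
    also have "\<dots> \<le> real (2 * N) * B"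
      using B card_dyad_roots_le[OF q(1) c N(2)] by (intro mult_right_mono of_nat_mono) auto
    finally show ?thesis by simp
  qed
  have "(?\<rho> 0)\<^sup>2 \<le> (B * s)\<^sup>2"
    unfolding s_def by (intro power_mono \<rho>0 corr_0_le[OF _ V b]) auto
  \<comment> \<open>Only \<open>s^(2/3)\<close> is estimated, by \<open>s <= 2 N B\<close>, so that
    the diagonal takes the shape \<open>B^(8/3) s^(4/3)\<close> of the other part.\<close>
  also have "\<dots> = B powr 2 * (s powr (4/3) * s powr (2/3))"
    using s0 B by (simp add: power_mult_distrib flip: powr_add)
  also have "\<dots> \<le> B powr 2 * (s powr (4/3) * (2 * real N * B) powr (2/3))"
    using s0 sle by (intro mult_left_mono powr_mono2) auto
  also have "\<dots> = (B powr 2 * B powr (2/3)) * s powr (4/3) * (2 * real N) powr (2/3)"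
    using B by (simp add: powr_mult mult_ac)
  also have "B powr 2 * B powr (2/3) = B powr (8/3)" unfolding powr_add[symmetric] by simp
  also have "B powr (8/3) * s powr (4/3) * (2 * real N) powr (2/3) \<le> G * (2 * real N)"
  proof -
    have "(2 * real N) powr (2/3) \<le> (2 * real N) powr 1" using N by (intro powr_mono) auto
    then show ?thesis unfolding G_def by (intro mult_left_mono) auto
  qed
  finally have zero: "(?\<rho> 0)\<^sup>2 \<le> G * (2 * real N)" .

  define y where "y = real N ^ 3 / real q"
  have "(\<Sum>l\<in>{1..<int q}. (?\<rho> l)\<^sup>2)
      \<le> (\<Sum>l\<in>{1..<int q}. ?\<rho> l) powr (2/3) * (\<Sum>l\<in>{1..<int q}. (?\<rho> l) ^ 4) powr (1/3)"
    by (rule sum_power2_le_interpolate) (rule \<rho>0)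
  also have "\<dots> \<le> (s\<^sup>2) powr (2/3) * (B ^ 8 * (400000 * Q\<^sup>2 * (real N ^ 3 + (real N)\<^sup>2 * y powr (3/2)))) powr (1/3)"
  proof (intro mult_mono powr_mono2 sum_nonneg \<rho>0)
    have "(\<Sum>l\<in>{1..<int q}. ?\<rho> l) \<le> (\<Sum>l\<in>{0..<int q}. ?\<rho> l)"
      using \<rho>0 by (intro sum_mono2) auto
    then show "(\<Sum>l\<in>{1..<int q}. ?\<rho> l) \<le> s\<^sup>2"
      unfolding sum_corr[OF q0 finite_dyad_roots] s_def .
    have "(\<Sum>l\<in>{1..<int q}. (?\<rho> l) ^ 4) \<le> (\<Sum>l\<in>{1..<int q}. B ^ 8 * (?r l) ^ 4)"
    proof (rule sum_mono)
      fix l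
      have "(?\<rho> l) ^ 4 \<le> (B\<^sup>2 * ?r l) ^ 4"
        by (intro power_mono \<rho>0 corr_le_square_mult[OF b])
      then show "(?\<rho> l) ^ 4 \<le> B ^ 8 * (?r l) ^ 4" by (simp add: power_mult_distrib)
    qed
    also have "\<dots> = B ^ 8 * (\<Sum>l\<in>{1..<int q}. (?r l) ^ 4)" by (simp add: sum_distrib_left)
    also have "\<dots> \<le> B ^ 8 * (400000 * Q\<^sup>2 * (real N ^ 3 + (real N)\<^sup>2 * y powr (3/2)))"
      using sum_corr_fourth_power_le[OF q c N] unfolding Q_def y_def power_mult_distrib
      by (intro mult_left_mono) (auto simp: mult.assoc)
    finally show "(\<Sum>l\<in>{1..<int q}. (?\<rho> l) ^ 4)
        \<le> B ^ 8 * (400000 * Q\<^sup>2 * (real N ^ 3 + (real N)\<^sup>2 * y powr (3/2)))" .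
  qed (auto intro!: sum_nonneg)
  also have "\<dots> = s powr (4/3) * B powr (8/3)
      * (400000 powr (1/3) * Q powr (2/3) * (real N ^ 3 + (real N)\<^sup>2 * y powr (3/2)) powr (1/3))"
  proof -
    have "(s\<^sup>2) powr (2/3) = (s powr 2) powr (2/3)" using s0 by simp
    also have "\<dots> = s powr (4/3)" unfolding powr_powr by simp
    finally have 1: "(s\<^sup>2) powr (2/3) = s powr (4/3)" .
    have "(B ^ 8) powr (1/3) = (B powr 8) powr (1/3)" using B by simp
    also have "\<dots> = B powr (8/3)" unfolding powr_powr by simp
    finally have 2: "(B ^ 8) powr (1/3) = B powr (8/3)" .
    have "(Q\<^sup>2) powr (1/3) = (Q powr 2) powr (1/3)" using Q1 by simp
    also have "\<dots> = Q powr (2/3)" unfolding powr_powr by simp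
    finally have 3: "(Q\<^sup>2) powr (1/3) = Q powr (2/3)" .
    show ?thesis using B Q1 by (simp add: powr_mult 1 2 3 mult.assoc)
  qed
  also have "\<dots> = G * (400000 powr (1/3) * Q powr (2/3) * (real N ^ 3 + (real N)\<^sup>2 * y powr (3/2)) powr (1/3))"
    by (simp add: G_def)
  also have "\<dots> \<le> G * (74 * Q * (real N + E))"
  proof (intro mult_left_mono mult_mono)
    \<comment> \<open>\<open>74^3 = 405224\<close>.\<close>
    have "(400000 :: real) powr (1/3) \<le> (74 ^ 3) powr (1/3)" by (intro powr_mono2) auto
    also have "(74 ^ 3 :: real) powr (1/3) = (74 powr 3) powr (1/3)" by simp
    also have "\<dots> = 74" unfolding powr_powr by simp
    finally show "(400000 :: real) powr (1/3) \<le> 74" .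
    have "Q powr (2/3) \<le> Q powr 1" using Q1 by (intro powr_mono) auto
    then show "Q powr (2/3) \<le> Q" using Q1 by simp
    have "(real N ^ 3 + (real N)\<^sup>2 * y powr (3/2)) powr (1/3)
        \<le> (real N ^ 3) powr (1/3) + ((real N)\<^sup>2 * y powr (3/2)) powr (1/3)"
      by (rule powr_add_le) auto
    also have "(real N ^ 3) powr (1/3) = (real N powr 3) powr (1/3)" by simp
    also have "\<dots> = real N" unfolding powr_powr by simp
    also have "((real N)\<^sup>2 * y powr (3/2)) powr (1/3) = E"
    proof -
      have "y = real N powr 3 / real q" by (simp add: y_def)
      then have "((real N)\<^sup>2 * y powr (3/2)) powr (1/3)
          = (real N powr 2 * (real N powr 3 / real q) powr (3/2)) powr (1/3)" by simp
      also have "\<dots> = real N powr (2/3) * (real N powr (3/2) / real q powr (1/2))"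
        by (simp add: powr_mult powr_divide powr_powr del: powr_numeral)
      also have "\<dots> = real N powr (13/6) / real q powr (1/2)"
        by (simp flip: powr_add)
      finally show ?thesis unfolding E_def .
    qed
    finally show "(real N ^ 3 + (real N)\<^sup>2 * y powr (3/2)) powr (1/3) \<le> real N + E" .
  qed (use Q1 in \<open>auto simp: G_def\<close>)
  finally have nonzero: "(\<Sum>l\<in>{1..<int q}. (?\<rho> l)\<^sup>2) \<le> G * (74 * Q * (real N + E))" .
  have "G * (2 * real N) \<le> G * (2 * Q * (real N + E))"
  proof (rule mult_left_mono)
    have "1 * real N \<le> Q * (real N + E)" using Q1 by (intro mult_mono) (auto simp: E_def)
    then show "2 * real N \<le> 2 * Q * (real N + E)" by simp
  qed (auto simp: G_def)
  then have "(\<Sum>l\<in>{0..<int q}. (?\<rho> l)\<^sup>2) \<le> G * (2 * Q * (real N + E)) + G * (74 * Q * (real N + E))"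
    using zero nonzero unfolding sum_corr_square_split[OF q0] by linarith
  also have "\<dots> = 76 * Q * G * (E + real N)" by (simp add: algebra_simps)
  finally show ?thesis unfolding G_def E_def Q_def s_def .
qed

end

section \<open>Bounds for the bilinear form\<close>


lemma wnorm_1: "wnorm 1 w N = (\<Sum>n\<in>dyad N. cmod (w n))"
  by (simp add: wnorm_def sum_nonneg)

lemma wnorm_2_square: "(wnorm 2 w M)\<^sup>2 = (\<Sum>m\<in>dyad M. (cmod (w m))\<^sup>2)"
  by (simp add: wnorm_def powr_half_sqrt sum_nonneg)

lemma wnorm_nonneg: "wnorm \<sigma> w M \<ge> 0"
  by (simp add: wnorm_def)

lemma norm_le_wnorm_inf: "n \<in> dyad N \<Longrightarrow> cmod (w n) \<le> wnorm_inf w N"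
  by (simp add: wnorm_inf_def)

lemma wnorm_inf_nonneg:
  assumes "N > 0"
  shows "wnorm_inf w N \<ge> 0"
proof -
  have "N \<in> dyad N" using assms by (simp add: dyad_def)
  from norm_le_wnorm_inf[OF this, of w] show ?thesis using norm_ge_zero[of "w N"] by linarith
qed

text \<open>The bilinear form for one value of \<open>j\<close>, with \<open>c = a / j\<close> and
  \<open>d = j\<close> modulo \<open>q\<close>.\<close>

definition twisted_sum :: "nat \<Rightarrow> int \<Rightarrow> int \<Rightarrow> (nat \<Rightarrow> complex) \<Rightarrow> (nat \<Rightarrow> complex) \<Rightarrow> int \<Rightarrow> nat \<Rightarrow> nat \<Rightarrow> complex" where
  "twisted_sum q c d \<alpha> \<beta> h M N = (\<Sum>m\<in>dyad M. \<Sum>u\<in>roots q c m. \<Sum>n\<in>dyad N. \<Sum>v\<in>roots q d n.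
     \<alpha> m * \<beta> n * eq q (h * u * v))"

text \<open>Because \<open>j u^2 = a m\<close> is equivalent to \<open>u^2 = (a / j) m\<close>,
  \<open>W\<close> is the mean of \<open>q - 1\<close> twisted sums and is at most their common
  bound.\<close>

lemma W_le_twisted_sum:
  assumes q: "prime q" and a: "a \<in> {1..<q}" and N: "2 * N \<le> q"
    and Z: "\<And>c d. coprime c (int q) \<Longrightarrow> coprime d (int q) \<Longrightarrow>
              cmod (twisted_sum q c d \<alpha> \<beta> (int h) M N) \<le> Z"
  shows "cmod (W a q \<alpha> \<beta> h M N) \<le> Z"
proof -
  have cop: "coprime j (int q)" if "j \<in> {1..<int q}" for j
    using prime_imp_coprime[of "int q" j] not_dvd_residue[OF that] q by (auto simp: coprime_commute)
  let ?U = "\<lambda>j m. {u \<in> {0..<int q}. [j * u\<^sup>2 = int a * int m] (mod int q)}"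
  have each: "cmod (\<Sum>m\<in>dyad M. \<Sum>u\<in>?U j m. \<Sum>n\<in>dyad N. \<Sum>v\<in>roots q j n. \<alpha> m * \<beta> n * eq q (int h * u * v)) \<le> Z"
    if j: "j \<in> {1..<int q}" for j
  proof -
    obtain i where i: "[j * i = 1] (mod int q)" using modular_inverse_exists[OF q j] by blast
    have ic: "coprime i (int q)"
      using i by (metis coprime_iff_invertible_int mult.commute)
    have "?U j m = roots q (int a * i) m" for m
    proof -
      have "[j * u\<^sup>2 = int a * int m] (mod int q) \<longleftrightarrow> [u\<^sup>2 = int a * i * int m] (mod int q)" for u
      proof -
        have "[i * (j * u\<^sup>2) = u\<^sup>2] (mod int q)"
          using cong_mult[OF i cong_refl[of "u\<^sup>2"]] by (simp add: mult_ac)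
        then have "[u\<^sup>2 = int a * i * int m] (mod int q) \<longleftrightarrow> [i * (j * u\<^sup>2) = i * (int a * int m)] (mod int q)"
          by (simp add: cong_def mult_ac)
        also have "\<dots> \<longleftrightarrow> [j * u\<^sup>2 = int a * int m] (mod int q)"
          using ic by (simp only: cong_mult_lcancel)
        finally show ?thesis by blast
      qed
      then show ?thesis by (simp add: roots_def)
    qed
    moreover have "coprime (int a * i) (int q)" using ic cop[of "int a"] a by simp
    ultimately show ?thesis
      using Z[of "int a * i" j] cop[OF j] unfolding twisted_sum_def by simp
  qed
  have "cmod (of_nat (q - 1) * W a q \<alpha> \<beta> h M N) \<le> (\<Sum>j\<in>{1..<int q}. Z)"
    unfolding W_eq_average[OF q N] by (rule order_trans[OF norm_sum], rule sum_mono, rule each)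
  also have "\<dots> = real (q - 1) * Z"
    using prime_gt_1_nat[OF q] by (simp add: of_nat_diff)
  finally have "real (q - 1) * cmod (W a q \<alpha> \<beta> h M N) \<le> real (q - 1) * Z"
    by (simp only: norm_mult norm_of_nat)
  then show ?thesis using prime_gt_1_nat[OF q] by simp
qed

text \<open>The 256 is \<open>2^4 * 2^4\<close>: an index has at most two roots, so passing from
  roots back to indices doubles each of the two sums at most.\<close>

lemma twisted_sum_power_8_le:
  assumes q: "prime q" and M: "2 * M \<le> q" and N: "2 * N \<le> q"
    and c: "coprime c (int q)" and d: "coprime d (int q)" and h: "coprime h (int q)"
  shows "(cmod (twisted_sum q c d \<alpha> \<beta> h M N)) ^ 8
    \<le> 256 * wnorm 2 \<alpha> M ^ 8 * wnorm 1 \<beta> N ^ 4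
      * (\<Sum>l\<in>{0..<int q}. (corr q (dyad_roots q d N) (\<lambda>v. cmod (\<beta> (root_index q d N v))) l)\<^sup>2)
      * (real q * (\<Sum>l\<in>{0..<int q}. (corr q (dyad_roots q c M) (\<lambda>_. 1) l)\<^sup>2))"
proof -
  have q0: "q > 0" using q prime_gt_0_nat by blast
  let ?U = "dyad_roots q c M" and ?V = "dyad_roots q d N"
  let ?i = "root_index q c M" and ?k = "root_index q d N"
  have "twisted_sum q c d \<alpha> \<beta> h M N = (\<Sum>u\<in>?U. \<Sum>v\<in>?V. \<alpha> (?i u) * \<beta> (?k v) * eq q (h * u * v))"
    unfolding twisted_sum_def sum_dyad_roots[OF d N] by (rule sum_dyad_roots[OF c M])
  then have "(cmod (twisted_sum q c d \<alpha> \<beta> h M N)) ^ 8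
      \<le> (\<Sum>u\<in>?U. (cmod (\<alpha> (?i u)))\<^sup>2) ^ 4 * (\<Sum>v\<in>?V. cmod (\<beta> (?k v))) ^ 4
        * (\<Sum>l\<in>{0..<int q}. (corr q ?V (\<lambda>v. cmod (\<beta> (?k v))) l)\<^sup>2)
        * (real q * (\<Sum>l\<in>{0..<int q}. (corr q ?U (\<lambda>_. 1) l)\<^sup>2))"
    using bilinear_sum_power_8_le[OF q0 finite_dyad_roots finite_dyad_roots h] by simp
  also have "\<dots> \<le> (2 * (wnorm 2 \<alpha> M)\<^sup>2) ^ 4 * (2 * wnorm 1 \<beta> N) ^ 4
        * (\<Sum>l\<in>{0..<int q}. (corr q ?V (\<lambda>v. cmod (\<beta> (?k v))) l)\<^sup>2)
        * (real q * (\<Sum>l\<in>{0..<int q}. (corr q ?U (\<lambda>_. 1) l)\<^sup>2))"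
    unfolding wnorm_1 wnorm_2_square
    by (intro mult_right_mono mult_mono power_mono sum_dyad_roots_le[OF q c M] sum_dyad_roots_le[OF q d N]
        sum_nonneg mult_nonneg_nonneg) auto
  finally show ?thesis by (simp add: power_mult_distrib mult_ac)
qed

text \<open>Three uses of \<open>y^2 + 1 <= (y + 1)^2\<close>. It lets an energy bound of the shape
  \<open>X^8 + 1\<close> leave the eighth root as \<open>X + 1\<close>.\<close>

lemma power_8_plus_1_le:
  fixes x :: real
  assumes "x \<ge> 0"
  shows "x ^ 8 + 1 \<le> (x + 1) ^ 8"
proof -
  have step: "y\<^sup>2 + 1 \<le> (y + 1)\<^sup>2" if "y \<ge> 0" for y :: real
    using that by (simp add: power2_eq_square algebra_simps)
  have "x ^ 8 + 1 = ((x\<^sup>2)\<^sup>2)\<^sup>2 + 1" by simp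
  also have "\<dots> \<le> ((x\<^sup>2)\<^sup>2 + 1)\<^sup>2" by (rule step) simp
  also have "\<dots> \<le> ((x\<^sup>2 + 1)\<^sup>2)\<^sup>2" by (intro power_mono step) auto
  also have "\<dots> \<le> (((x + 1)\<^sup>2)\<^sup>2)\<^sup>2" by (intro power_mono step assms) auto
  finally show ?thesis by simp
qed

text \<open>Enlarging \<open>Q^2\<close> to \<open>Q^8\<close> gives a clean eighth root and is
  harmless, as \<open>Q\<close> will be subpolynomial. The value \<open>16^8\<close> exceeds the
  constants \<open>256 * 804^2\<close> and \<open>256 * 304^2\<close> of the two
  applications.\<close>

lemma le_of_power_8_le:
  fixes S T Q P C :: real
  assumes "S ^ 8 \<le> C * Q\<^sup>2 * P" "P \<le> T ^ 8" "0 \<le> C" "C \<le> 16 ^ 8" "Q \<ge> 1" "T \<ge> 0" "S \<ge> 0"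
  shows "S \<le> 16 * Q * T"
proof -
  have "S ^ 8 \<le> C * Q\<^sup>2 * T ^ 8"
    using assms mult_left_mono[of P "T ^ 8" "C * Q\<^sup>2"] by fastforce
  also have "\<dots> \<le> 16 ^ 8 * Q ^ 8 * T ^ 8"
    using assms by (intro mult_right_mono mult_mono power_increasing) auto
  also have "\<dots> = (16 * Q * T) ^ 8" by (simp add: power_mult_distrib)
  finally show ?thesis
    using assms by (intro power_le_imp_le_base[of S 7]) (auto simp: eval_nat_numeral)
qed

lemma powr_power_8: "(x powr p) ^ 8 = x powr (8 * p)" for x :: real
  by (cases "x = 0") (simp_all add: powr_power)

text \<open>Extracting \<open>M^(1/2)\<close> leaves \<open>M^(3/2) / q + 1\<close>, and
  \<open>3/2 = 8 * 3/16\<close>.\<close>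

lemma gap_factor_le:
  assumes "M > 0" "q > 0"
  shows "(real M)\<^sup>2 / real q + real M powr (1/2)
    \<le> real M powr (1/2) * (real M powr (3/16) / real q powr (1/8) + 1) ^ 8"
proof -
  have "(real M)\<^sup>2 = real M powr (1/2) * real M powr (3/2)"
    using assms by (simp flip: powr_add)
  then have "(real M)\<^sup>2 / real q + real M powr (1/2)
      = real M powr (1/2) * ((real M powr (3/16) / real q powr (1/8)) ^ 8 + 1)"
    using assms by (simp add: power_divide powr_power_8 distrib_left)
  also have "\<dots> \<le> real M powr (1/2) * (real M powr (3/16) / real q powr (1/8) + 1) ^ 8"
    by (intro mult_left_mono power_8_plus_1_le) auto
  finally show ?thesis .
qed

text \<open>Extracting \<open>M\<close> leaves \<open>M^(7/6) / q^(1/2) + 1\<close>, and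
  \<open>7/6 = 8 * 7/48\<close>.\<close>

lemma lattice_factor_le:
  assumes "M > 0" "q > 0"
  shows "real M powr (13/6) / real q powr (1/2) + real M
    \<le> real M * (real M powr (7/48) / real q powr (1/16) + 1) ^ 8"
proof -
  have "real M powr (13/6) = real M powr 1 * real M powr (7/6)"
    unfolding powr_add[symmetric] by simp
  then have "real M powr (13/6) / real q powr (1/2) + real M
      = real M * ((real M powr (7/48) / real q powr (1/16)) ^ 8 + 1)"
    using assms by (simp add: power_divide powr_power_8 distrib_left)
  also have "\<dots> \<le> real M * (real M powr (7/48) / real q powr (1/16) + 1) ^ 8"
    by (intro mult_left_mono power_8_plus_1_le) auto
  finally show ?thesis .
qed

context
  fixes q M N :: nat and c d h :: int and \<alpha> \<beta> :: "nat \<Rightarrow> complex"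
  assumes q: "prime q" "odd q" and M: "M > 0" "2 * M \<le> q" and N: "N > 0" "2 * N \<le> q"
    and c: "coprime c (int q)" and d: "coprime d (int q)" and h: "coprime h (int q)"
begin

lemma weights_le:
  assumes "v \<in> dyad_roots q d N"
  shows "cmod (\<beta> (root_index q d N v)) \<le> wnorm_inf \<beta> N"
  using root_index(1)[OF assms] norm_le_wnorm_inf by blast

lemma sum_weights_le: "(\<Sum>v\<in>dyad_roots q d N. cmod (\<beta> (root_index q d N v))) \<le> 2 * wnorm 1 \<beta> N"
  unfolding wnorm_1 by (rule sum_dyad_roots_le[OF q(1) d N(2)]) simp

text \<open>The exponents are eighths of those in \<open>b1^(4 + 2)\<close>, \<open>B^2\<close> and
  \<open>N^(1/2)\<close>, and of \<open>M^(2 + 1/2)\<close>: on the \<open>m\<close> side the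
  weights are 1, so their squared sum is at most \<open>(2 M)^2\<close>.\<close>

lemma twisted_sum_gap_bound:
  "cmod (twisted_sum q c d \<alpha> \<beta> h M N) \<le> 16 * (divmax q * logsum q)
     * (wnorm 2 \<alpha> M * wnorm 1 \<beta> N powr (3/4) * wnorm_inf \<beta> N powr (1/4)
         * real q powr (1/8) * real M powr (5/16) * real N powr (1/16)
         * (real M powr (3/16) / real q powr (1/8) + 1)
         * (real N powr (3/16) / real q powr (1/8) + 1))"
proof -
  have q0: "q > 0" using q(1) prime_gt_0_nat by blast
  define a2 b1 B where "a2 = wnorm 2 \<alpha> M" and "b1 = wnorm 1 \<beta> N" and "B = wnorm_inf \<beta> N"
  define Q where "Q = divmax q * logsum q"
  have Q1: "Q \<ge> 1"
    using mult_mono[of 1 "divmax q" 1 "logsum q"] divmax_ge_1[OF q0] logsum_ge_1[OF q0] by (simp add: Q_def)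
  have nn: "a2 \<ge> 0" "b1 \<ge> 0" "B \<ge> 0"
    by (simp_all add: a2_def b1_def B_def wnorm_nonneg wnorm_inf_nonneg[OF N(1)])
  define PM where "PM = real M powr (3/16) / real q powr (1/8) + 1"
  define PN where "PN = real N powr (3/16) / real q powr (1/8) + 1"
  have P0: "PM \<ge> 0" "PN \<ge> 0" by (simp_all add: PM_def PN_def)
  define EV where "EV = (\<Sum>l\<in>{0..<int q}. (corr q (dyad_roots q d N) (\<lambda>v. cmod (\<beta> (root_index q d N v))) l)\<^sup>2)"
  define EU where "EU = (\<Sum>l\<in>{0..<int q}. (corr q (dyad_roots q c M) (\<lambda>_. 1) l)\<^sup>2)"
  have "EV \<le> 201 * Q * (B\<^sup>2 * (\<Sum>v\<in>dyad_roots q d N. cmod (\<beta> (root_index q d N v)))\<^sup>2)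
      * ((real N)\<^sup>2 / real q + real N powr (1/2))"
    unfolding EV_def Q_def B_def
    by (rule energy_gap_bound[OF q d N]) (auto intro: weights_le)
  also have "\<dots> \<le> 201 * Q * (B\<^sup>2 * (2 * b1)\<^sup>2) * (real N powr (1/2) * PN ^ 8)"
    unfolding PN_def b1_def using Q1 sum_weights_le
    by (intro mult_mono mult_left_mono power_mono gap_factor_le N q0) (auto intro: sum_nonneg)
  finally have EV: "EV \<le> 804 * Q * B\<^sup>2 * b1\<^sup>2 * real N powr (1/2) * PN ^ 8"
    by (simp add: power_mult_distrib mult_ac)
  have "EU \<le> 201 * Q * (1\<^sup>2 * (\<Sum>v\<in>dyad_roots q c M. 1)\<^sup>2)
      * ((real M)\<^sup>2 / real q + real M powr (1/2))"
    unfolding EU_def Q_def by (rule energy_gap_bound[OF q c M]) auto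
  also have "\<dots> \<le> 201 * Q * (1\<^sup>2 * (2 * real M)\<^sup>2) * (real M powr (1/2) * PM ^ 8)"
    unfolding PM_def using Q1 card_dyad_roots_le[OF q(1) c M(2)]
    by (intro mult_mono mult_left_mono power_mono gap_factor_le M q0) auto
  also have "\<dots> = 804 * Q * (real M powr 2 * real M powr (1/2)) * PM ^ 8"
    by (simp add: power_mult_distrib)
  also have "real M powr 2 * real M powr (1/2) = real M powr (5/2)" unfolding powr_add[symmetric] by simp
  finally have EU: "EU \<le> 804 * Q * real M powr (5/2) * PM ^ 8" .
  have E0: "EV \<ge> 0" "EU \<ge> 0" by (auto simp: EV_def EU_def intro: sum_nonneg)
  define P where "P = a2 ^ 8 * b1 ^ 6 * B\<^sup>2 * real q * real M powr (5/2) * real N powr (1/2) * PM ^ 8 * PN ^ 8"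
  define T where "T = a2 * b1 powr (3/4) * B powr (1/4) * real q powr (1/8) * real M powr (5/16)
    * real N powr (1/16) * PM * PN"
  have "(cmod (twisted_sum q c d \<alpha> \<beta> h M N)) ^ 8 \<le> 256 * a2 ^ 8 * b1 ^ 4 * EV * (real q * EU)"
    unfolding a2_def b1_def EV_def EU_def by (rule twisted_sum_power_8_le[OF q(1) M(2) N(2) c d h])
  also have "\<dots> \<le> 256 * a2 ^ 8 * b1 ^ 4 * (804 * Q * B\<^sup>2 * b1\<^sup>2 * real N powr (1/2) * PN ^ 8)
      * (real q * (804 * Q * real M powr (5/2) * PM ^ 8))"
    using nn E0 EU EV Q1 P0 by (intro mult_mono mult_left_mono) auto
  also have "\<dots> = (256 * 804 * 804) * Q\<^sup>2 * P"
    by (simp add: P_def power2_eq_square eval_nat_numeral)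
  finally have main: "(cmod (twisted_sum q c d \<alpha> \<beta> h M N)) ^ 8 \<le> (256 * 804 * 804) * Q\<^sup>2 * P" .
  have "T ^ 8 = P"
    using nn q0 by (simp add: T_def P_def power_mult_distrib powr_power_8)
  then have "cmod (twisted_sum q c d \<alpha> \<beta> h M N) \<le> 16 * Q * T"
    using nn P0 by (intro le_of_power_8_le[OF main _ _ _ Q1]) (auto simp: T_def)
  then show ?thesis unfolding T_def Q_def a2_def b1_def B_def PM_def PN_def .
qed

text \<open>Again eighths: of \<open>b1^(4 + 4/3)\<close>, \<open>B^(8/3)\<close> and
  \<open>N\<close>, and of \<open>M^(4/3 + 1)\<close> from the unit weights on the \<open>m\<close>
  side. If the sup norm vanishes, where the energy bound does not apply, all weights and hence the
  sum are zero.\<close>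

lemma twisted_sum_lattice_bound:
  "cmod (twisted_sum q c d \<alpha> \<beta> h M N) \<le> 16 * (divmax q * logsum q)
     * (wnorm 2 \<alpha> M * wnorm_inf \<beta> N powr (1/3) * wnorm 1 \<beta> N powr (2/3)
         * real q powr (1/8) * real M powr (7/24) * real N powr (1/8)
         * (real M powr (7/48) / real q powr (1/16) + 1)
         * (real N powr (7/48) / real q powr (1/16) + 1))"
proof (cases "wnorm_inf \<beta> N = 0")
  case True
  have "\<beta> n = 0" if "n \<in> dyad N" for n
    using norm_le_wnorm_inf[OF that, of \<beta>] True by simp
  then have "twisted_sum q c d \<alpha> \<beta> h M N = 0"
    unfolding twisted_sum_def by (intro sum.neutral ballI) simp
  then show ?thesis using True by simp
next
  case False
  have q0: "q > 0" using q(1) prime_gt_0_nat by blast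
  define a2 b1 B where "a2 = wnorm 2 \<alpha> M" and "b1 = wnorm 1 \<beta> N" and "B = wnorm_inf \<beta> N"
  define Q where "Q = divmax q * logsum q"
  have Q1: "Q \<ge> 1"
    using mult_mono[of 1 "divmax q" 1 "logsum q"] divmax_ge_1[OF q0] logsum_ge_1[OF q0] by (simp add: Q_def)
  have nn: "a2 \<ge> 0" "b1 \<ge> 0" "B > 0"
    using False wnorm_inf_nonneg[OF N(1), of \<beta>] by (simp_all add: a2_def b1_def B_def wnorm_nonneg)
  define PM where "PM = real M powr (7/48) / real q powr (1/16) + 1"
  define PN where "PN = real N powr (7/48) / real q powr (1/16) + 1"
  have P0: "PM \<ge> 0" "PN \<ge> 0" by (simp_all add: PM_def PN_def)
  define EV where "EV = (\<Sum>l\<in>{0..<int q}. (corr q (dyad_roots q d N) (\<lambda>v. cmod (\<beta> (root_index q d N v))) l)\<^sup>2)"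
  define EU where "EU = (\<Sum>l\<in>{0..<int q}. (corr q (dyad_roots q c M) (\<lambda>_. 1) l)\<^sup>2)"
  have four: "(2 * x) powr (4/3) \<le> 4 * x powr (4/3)" if "x \<ge> 0" for x :: real
  proof -
    have "(2 :: real) powr (4/3) \<le> 2 powr 2" by (intro powr_mono) auto
    then show ?thesis using that by (simp add: powr_mult mult_right_mono)
  qed
  have "EV \<le> 76 * Q * (B powr (8/3) * (\<Sum>v\<in>dyad_roots q d N. cmod (\<beta> (root_index q d N v))) powr (4/3))
      * (real N powr (13/6) / real q powr (1/2) + real N)"
    unfolding EV_def Q_def B_def
    by (rule energy_lattice_bound[OF q d N]) (use nn in \<open>auto intro: weights_le simp: B_def\<close>)
  also have "\<dots> \<le> 76 * Q * (B powr (8/3) * (2 * b1) powr (4/3)) * (real N * PN ^ 8)"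
    unfolding PN_def b1_def using Q1 sum_weights_le
    by (intro mult_mono mult_left_mono powr_mono2 lattice_factor_le N q0) (auto intro: sum_nonneg)
  also have "\<dots> \<le> 76 * Q * (B powr (8/3) * (4 * b1 powr (4/3))) * (real N * PN ^ 8)"
    using Q1 nn by (intro mult_right_mono mult_left_mono four) auto
  finally have EV: "EV \<le> 304 * Q * B powr (8/3) * b1 powr (4/3) * real N * PN ^ 8"
    by (simp add: mult_ac)
  have "EU \<le> 76 * Q * (1 powr (8/3) * (\<Sum>v\<in>dyad_roots q c M. 1) powr (4/3))
      * (real M powr (13/6) / real q powr (1/2) + real M)"
    unfolding EU_def Q_def by (rule energy_lattice_bound[OF q c M]) auto
  also have "\<dots> \<le> 76 * Q * (1 powr (8/3) * (2 * real M) powr (4/3)) * (real M * PM ^ 8)"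
    unfolding PM_def using Q1 card_dyad_roots_le[OF q(1) c M(2)]
    by (intro mult_mono mult_left_mono powr_mono2 lattice_factor_le M q0) auto
  also have "\<dots> \<le> 76 * Q * (1 powr (8/3) * (4 * real M powr (4/3))) * (real M * PM ^ 8)"
    using Q1 by (intro mult_right_mono mult_left_mono four) auto
  also have "\<dots> = 304 * Q * (real M powr (4/3) * real M powr 1) * PM ^ 8" by simp
  also have "real M powr (4/3) * real M powr 1 = real M powr (7/3)" unfolding powr_add[symmetric] by simp
  finally have EU: "EU \<le> 304 * Q * real M powr (7/3) * PM ^ 8" .
  have E0: "EV \<ge> 0" "EU \<ge> 0" by (auto simp: EV_def EU_def intro: sum_nonneg)
  define P where "P = a2 ^ 8 * B powr (8/3) * b1 powr (16/3) * real q * real M powr (7/3) * real N * PM ^ 8 * PN ^ 8"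
  define T where "T = a2 * B powr (1/3) * b1 powr (2/3) * real q powr (1/8) * real M powr (7/24)
    * real N powr (1/8) * PM * PN"
  have "(cmod (twisted_sum q c d \<alpha> \<beta> h M N)) ^ 8 \<le> 256 * a2 ^ 8 * b1 ^ 4 * EV * (real q * EU)"
    unfolding a2_def b1_def EV_def EU_def by (rule twisted_sum_power_8_le[OF q(1) M(2) N(2) c d h])
  also have "\<dots> \<le> 256 * a2 ^ 8 * b1 ^ 4 * (304 * Q * B powr (8/3) * b1 powr (4/3) * real N * PN ^ 8)
      * (real q * (304 * Q * real M powr (7/3) * PM ^ 8))"
    using nn E0 EU EV Q1 P0 by (intro mult_mono mult_left_mono) auto
  also have "\<dots> = (256 * 304 * 304) * Q\<^sup>2 * (a2 ^ 8 * B powr (8/3) * (b1 powr 4 * b1 powr (4/3)) * real q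
      * real M powr (7/3) * real N * PM ^ 8 * PN ^ 8)"
    using nn by (simp add: power2_eq_square mult_ac)
  also have "b1 powr 4 * b1 powr (4/3) = b1 powr (16/3)" unfolding powr_add[symmetric] by simp
  finally have main: "(cmod (twisted_sum q c d \<alpha> \<beta> h M N)) ^ 8 \<le> (256 * 304 * 304) * Q\<^sup>2 * P"
    unfolding P_def .
  have "T ^ 8 = P"
    using nn q0 by (simp add: T_def P_def power_mult_distrib powr_power_8)
  then have "cmod (twisted_sum q c d \<alpha> \<beta> h M N) \<le> 16 * Q * T"
    using nn P0 by (intro le_of_power_8_le[OF main _ _ _ Q1]) (auto simp: T_def)
  then show ?thesis unfolding T_def Q_def a2_def b1_def B_def PM_def PN_def .
qed

end

text \<open>The case \<open>q = 2\<close>, where \<open>M, N <= q / 2\<close> forces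
  \<open>M = N = 1\<close>: the form is a single product of weights times at most two roots of
  unity.\<close>

lemma W_2_le:
  assumes "Q \<ge> 1" "A \<ge> cmod (\<alpha> 1) * cmod (\<beta> 1)"
  shows "cmod (W a 2 \<alpha> \<beta> h 1 1) \<le> 16 * Q * A"
proof -
  let ?X = "{x. x < 2 \<and> [x\<^sup>2 = a * 1 * 1] (mod 2)}"
  have "cmod (\<Sum>x\<in>?X. eq 2 (int h * int x)) \<le> real (card ?X)"
    by (rule order_trans[OF norm_sum]) simp
  also have "card ?X \<le> card {..<2 :: nat}" by (rule card_mono) auto
  finally have "cmod (\<Sum>x\<in>?X. eq 2 (int h * int x)) \<le> 2" by simp
  then have "cmod (\<alpha> 1 * \<beta> 1 * (\<Sum>x\<in>?X. eq 2 (int h * int x))) \<le> cmod (\<alpha> 1) * cmod (\<beta> 1) * 2"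
    unfolding norm_mult by (intro mult_left_mono) auto
  moreover have "dyad 1 = {1}" by (auto simp: dyad_def)
  ultimately have "cmod (W a 2 \<alpha> \<beta> h 1 1) \<le> cmod (\<alpha> 1) * cmod (\<beta> 1) * 2" by (simp add: W_def)
  also have "\<dots> \<le> A * (16 * Q)"
  proof (rule mult_mono)
    show "0 \<le> A" using assms(2) by (meson mult_nonneg_nonneg norm_ge_zero order_trans)
  qed (use assms in auto)
  finally show ?thesis by (simp add: mult_ac)
qed


section \<open>The exponent o(1) and the final assembly\<close>

text \<open>Chosen so that \<open>q\<close> to this power is exactly the loss factor of the bounds.
  It depends on \<open>q\<close> alone, which is the required uniformity.\<close>

definition subpoly_exponent :: "nat \<Rightarrow> real" where
  "subpoly_exponent q = ln (16 * (divmax q * logsum q)) / ln (real q)"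

lemma subpoly_exponent_tendsto: "subpoly_exponent \<longlonglongrightarrow> 0"
proof -
  have "(\<lambda>q. ln 16 / ln (real q) + (ln (divmax q) / ln (real q) + ln (logsum q) / ln (real q))) \<longlonglongrightarrow> 0 + (0 + 0)"
  proof (intro tendsto_add ln_divmax_tendsto ln_logsum_tendsto)
    show "(\<lambda>q. ln 16 / ln (real q)) \<longlonglongrightarrow> 0" by real_asymp
  qed
  moreover have "\<forall>\<^sub>F q in sequentially. ln 16 / ln (real q) + (ln (divmax q) / ln (real q) + ln (logsum q) / ln (real q))
      = subpoly_exponent q"
    using eventually_gt_at_top[of 0]
  proof eventually_elim
    case (elim q)
    have "divmax q > 0" "logsum q > 0" using divmax_ge_1[OF elim] logsum_ge_1[OF elim] by simp_all
    then have "ln (16 * (divmax q * logsum q)) = ln 16 + (ln (divmax q) + ln (logsum q))"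
      by (simp add: ln_mult)
    then show ?case by (simp add: subpoly_exponent_def add_divide_distrib)
  qed
  ultimately show ?thesis using Lim_transform_eventually by fastforce
qed

lemma powr_subpoly_exponent:
  assumes "q \<ge> 2"
  shows "real q powr (p + subpoly_exponent q) = real q powr p * (16 * (divmax q * logsum q))"
proof -
  have "divmax q > 0" "logsum q > 0" using divmax_ge_1[of q] logsum_ge_1[of q] assms by simp_all
  then have "real q powr subpoly_exponent q = 16 * (divmax q * logsum q)"
    using assms by (simp add: subpoly_exponent_def powr_def)
  then show ?thesis by (simp add: powr_add)
qed

lemma W_bounds_odd:
  assumes q: "prime q" "odd q" and a: "a \<in> {1..<q}" and h: "h \<in> {1..<q}"
    and M: "M > 0" "2 * M \<le> q" and N: "N > 0" "2 * N \<le> q"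
  shows "cmod (W a q \<alpha> \<beta> h M N) \<le> 16 * (divmax q * logsum q)
     * (wnorm 2 \<alpha> M * wnorm_inf \<beta> N powr (1/3) * wnorm 1 \<beta> N powr (2/3)
         * real q powr (1/8) * real M powr (7/24) * real N powr (1/8)
         * (real M powr (7/48) / real q powr (1/16) + 1)
         * (real N powr (7/48) / real q powr (1/16) + 1))" (is ?lattice)
    and "cmod (W a q \<alpha> \<beta> h M N) \<le> 16 * (divmax q * logsum q)
     * (wnorm 2 \<alpha> M * wnorm 1 \<beta> N powr (3/4) * wnorm_inf \<beta> N powr (1/4)
         * real q powr (1/8) * real M powr (5/16) * real N powr (1/16)
         * (real M powr (3/16) / real q powr (1/8) + 1)
         * (real N powr (3/16) / real q powr (1/8) + 1))" (is ?gap)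
proof -
  have "coprime (int h) (int q)"
    using prime_imp_coprime[of "int q" "int h"] not_dvd_residue[of "int h" q] h q(1)
    by (auto simp: coprime_commute)
  then show ?lattice ?gap
    using twisted_sum_lattice_bound[OF q M N] twisted_sum_gap_bound[OF q M N]
    by (intro W_le_twisted_sum[OF q(1) a N(2)]; blast)+
qed

lemma W_bounds_2:
  shows "cmod (W a 2 \<alpha> \<beta> h 1 1) \<le> 16 * (divmax 2 * logsum 2)
     * (wnorm 2 \<alpha> 1 * wnorm_inf \<beta> 1 powr (1/3) * wnorm 1 \<beta> 1 powr (2/3)
         * real 2 powr (1/8) * real 1 powr (7/24) * real 1 powr (1/8)
         * (real 1 powr (7/48) / real 2 powr (1/16) + 1)
         * (real 1 powr (7/48) / real 2 powr (1/16) + 1))" (is "_ \<le> _ * ?A")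
    and "cmod (W a 2 \<alpha> \<beta> h 1 1) \<le> 16 * (divmax 2 * logsum 2)
     * (wnorm 2 \<alpha> 1 * wnorm 1 \<beta> 1 powr (3/4) * wnorm_inf \<beta> 1 powr (1/4)
         * real 2 powr (1/8) * real 1 powr (5/16) * real 1 powr (1/16)
         * (real 1 powr (3/16) / real 2 powr (1/8) + 1)
         * (real 1 powr (3/16) / real 2 powr (1/8) + 1))" (is "_ \<le> _ * ?B")
proof -
  have dyad: "dyad 1 = {1}" by (auto simp: dyad_def)
  define x where "x = cmod (\<alpha> 1)"
  define y where "y = cmod (\<beta> 1)"
  have xy: "x \<ge> 0" "y \<ge> 0" by (simp_all add: x_def y_def)
  have norms: "wnorm 2 \<alpha> 1 = x" "wnorm 1 \<beta> 1 = y" "wnorm_inf \<beta> 1 = y"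
    unfolding wnorm_def wnorm_inf_def dyad by (simp_all add: x_def y_def powr_half_sqrt)
  have Q: "divmax 2 * logsum 2 \<ge> 1"
    using mult_mono[of 1 "divmax 2" 1 "logsum 2"] divmax_ge_1[of 2] logsum_ge_1[of 2] by simp
  \<comment> \<open>On one-element ranges both norms of \<open>\<beta>\<close> equal
    \<open>y\<close>, the exponents \<open>s\<close> and \<open>t\<close> add up to 1, and all other
    factors are at least 1.\<close>
  have grow: "x * y \<le> x * (y powr s * y powr t) * (2 powr (1/8) * (u + 1) * (u + 1))"
    if "s + t = 1" "u \<ge> 0" for s t u :: real
  proof -
    have "y powr s * y powr t = y" using xy that by (simp flip: powr_add)
    moreover have "(1 :: real) * 1 * 1 \<le> 2 powr (1/8) * (u + 1) * (u + 1)"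
      using that by (intro mult_mono ge_one_powr_ge_zero) auto
    ultimately show ?thesis using xy mult_left_mono[of 1 _ "x * y"] by simp
  qed
  have "cmod (\<alpha> 1) * cmod (\<beta> 1) \<le> ?A"
    using grow[of "1/3" "2/3" "1 / 2 powr (1/16)"] unfolding norms x_def[symmetric] y_def[symmetric]
    by (simp add: mult_ac)
  then show "cmod (W a 2 \<alpha> \<beta> h 1 1) \<le> 16 * (divmax 2 * logsum 2) * ?A" by (rule W_2_le[OF Q])
  have "cmod (\<alpha> 1) * cmod (\<beta> 1) \<le> ?B"
    using grow[of "3/4" "1/4" "1 / 2 powr (1/8)"] unfolding norms x_def[symmetric] y_def[symmetric]
    by (simp add: mult_ac)
  then show "cmod (W a 2 \<alpha> \<beta> h 1 1) \<le> 16 * (divmax 2 * logsum 2) * ?B" by (rule W_2_le[OF Q])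
qed

theorem theorem1p4:
  "\<exists>\<delta> :: nat \<Rightarrow> real. \<delta> \<longlonglongrightarrow> 0 \<and>
    (\<forall>q a h M N (\<alpha> :: nat \<Rightarrow> complex) (\<beta> :: nat \<Rightarrow> complex).
       prime q \<longrightarrow> a \<in> {1..<q} \<longrightarrow> h \<in> {1..<q} \<longrightarrow>
       M \<ge> 1 \<longrightarrow> N \<ge> 1 \<longrightarrow> real M \<le> real q / 2 \<longrightarrow> real N \<le> real q / 2 \<longrightarrow>
       cmod (W a q \<alpha> \<beta> h M N) \<le>
         wnorm 2 \<alpha> M * wnorm_inf \<beta> N powr (1/3) * wnorm 1 \<beta> N powr (2/3)
         * real q powr (1/8 + \<delta> q) * real M powr (7/24) * real N powr (1/8)
         * (real M powr (7/48) / real q powr (1/16) + 1)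
         * (real N powr (7/48) / real q powr (1/16) + 1)
     \<and> cmod (W a q \<alpha> \<beta> h M N) \<le>
         wnorm 2 \<alpha> M * wnorm 1 \<beta> N powr (3/4) * wnorm_inf \<beta> N powr (1/4)
         * real q powr (1/8 + \<delta> q) * real M powr (5/16) * real N powr (1/16)
         * (real M powr (3/16) / real q powr (1/8) + 1)
         * (real N powr (3/16) / real q powr (1/8) + 1))"
proof (intro exI[of _ subpoly_exponent] conjI[OF subpoly_exponent_tendsto] allI impI)
  fix q a h M N and \<alpha> \<beta> :: "nat \<Rightarrow> complex"
  assume q: "prime q" and a: "a \<in> {1..<q}" and h: "h \<in> {1..<q}" and M: "M \<ge> 1" and N: "N \<ge> 1"
    and Mq: "real M \<le> real q / 2" and Nq: "real N \<le> real q / 2"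
  have MN: "M > 0" "2 * M \<le> q" "N > 0" "2 * N \<le> q" using M N Mq Nq by linarith+
  note exponent = powr_subpoly_exponent[OF prime_ge_2_nat[OF q]]
  show "cmod (W a q \<alpha> \<beta> h M N) \<le>
         wnorm 2 \<alpha> M * wnorm_inf \<beta> N powr (1/3) * wnorm 1 \<beta> N powr (2/3)
         * real q powr (1/8 + subpoly_exponent q) * real M powr (7/24) * real N powr (1/8)
         * (real M powr (7/48) / real q powr (1/16) + 1)
         * (real N powr (7/48) / real q powr (1/16) + 1)
     \<and> cmod (W a q \<alpha> \<beta> h M N) \<le>
         wnorm 2 \<alpha> M * wnorm 1 \<beta> N powr (3/4) * wnorm_inf \<beta> N powr (1/4)
         * real q powr (1/8 + subpoly_exponent q) * real M powr (5/16) * real N powr (1/16)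
         * (real M powr (3/16) / real q powr (1/8) + 1)
         * (real N powr (3/16) / real q powr (1/8) + 1)"
  proof (cases "q = 2")
    case True
    then have "M = 1" "N = 1" using MN by linarith+
    with True W_bounds_2[of a \<alpha> \<beta> h] show ?thesis
      unfolding exponent by (simp only: mult_ac)
  next
    case False
    then have "odd q" using q prime_odd_nat[of q] prime_ge_2_nat[OF q] by linarith
    from W_bounds_odd[OF q this a h MN, of \<alpha> \<beta>] show ?thesis
      unfolding exponent by (simp only: mult_ac)
  qed
qed

end
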